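(* Let $X_N\subset\mathbb S^{d-1}$ be a spherical $t$-design with $N$ points and define $$\widehat S_X(K):=\frac{2}{c_{d,1}}\,\frac1N\sum_{x\in X_N}\operatorname{vol}_{d-1}(K|x^\perp),\qquad c_{d,1}=\frac{\Gamma(d/2)}{\sqrt\pi\,\Gamma((d+1)/2)}.$$ Then $$\frac{|\widehat S_X(K)-S(K)|}{S(K)}\le\frac{2E_t(|\cdot|)_\infty}{c_{d,1}}$$ for every $K\in\mathcal K^d_\circ$. In particular, $$\sup_{K\in\mathcal K^d_\circ}\frac{|\widehat S_X(K)-S(K)|}{S(K)}=O_d(t^{-1}),$$ i.e. there is a constant $C_d$ depending only on $d$ such that for every integer $t\ge1$ and every spherical $t$-design $X_N$ the supremum is at most $C_d/t$.
   Context: Fix an integer $d\ge 2$. $\sigma$ is the normalized rotation-invariant Borel probability measure on the unit sphere $\mathbb S^{d-1}\subset\mathbb R^d$. $\mathcal K^d_\circ$ is the set of convex bodies (compact convex sets) in $\mathbb R^d$ with nonempty interior. $S(K)=\mathcal H^{d-1}(\partial K)$ is the surface area of $K\in\mathcal K^d_\circ$. $K|x^\perp$ is the orthogonal projection of $K$ onto the hyperplane $x^\perp$, and $\operatorname{vol}_{d-1}$ is $(d-1)$-dimensional volume. A spherical $t$-design is a finite set $X_N\subset\mathbb S^{d-1}$ of $N$ points such that $\frac1N\sum_{x\in X_N}f(x)=\int f\,d\sigma$ for every spherical polynomial $f$ (restriction of a real polynomial to the sphere) of degree at most $t$. $E_t(|\cdot|)_\infty:=\inf_q\sup_{s\in[-1,1]}\big||s|-q(s)\big|$,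 the infimum over real univariate polynomials $q$ of degree at most $t$. *)

theory Defs
  imports "HOL-Probability.Probability"
begin

text \<open>The measure lives on the sphere itself, i.e. its space is \<open>sphere 0 1\<close>. For \<open>CARD('n) \<ge> 2\<close> there is
  exactly one such measure.\<close>
definition uniform_sphere_measure :: "(real^'n) measure \<Rightarrow> bool" where
  "uniform_sphere_measure \<sigma> \<longleftrightarrow>
     prob_space \<sigma> \<and> sets \<sigma> = sets (restrict_space borel (sphere 0 1)) \<and>
     (\<forall>A. rotation_matrix A \<longrightarrow> distr \<sigma> \<sigma> ((*v) A) = \<sigma>)"

definition poly_of_degree_le :: "nat \<Rightarrow> (real^'n \<Rightarrow> real) \<Rightarrow> bool" where
  "poly_of_degree_le t p \<longleftrightarrow>
     (\<exists>a :: ('n \<Rightarrow> nat) \<Rightarrow> real. \<forall>x. p x = (\<Sum>\<alpha> | (\<Sum>i\<in>UNIV. \<alpha> i) \<le> t. a \<alpha> * (\<Prod>i\<in>UNIV. (x $ i) ^ \<alpha> i)))"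

text \<open>The index set of the sum above is finite, so the sum is not degenerate.\<close>
lemma finite_multi_indices: "finite {\<alpha> :: 'n::finite \<Rightarrow> nat. (\<Sum>i\<in>UNIV. \<alpha> i) \<le> t}"
proof (rule finite_subset)
  show "{\<alpha> :: 'n \<Rightarrow> nat. (\<Sum>i\<in>UNIV. \<alpha> i) \<le> t} \<subseteq> (\<Pi>\<^sub>E i\<in>UNIV. {..t})"
  proof (intro subsetI PiE_I)
    fix \<alpha> :: "'n \<Rightarrow> nat" and i :: 'n
    assume "\<alpha> \<in> {\<alpha>. (\<Sum>i\<in>UNIV. \<alpha> i) \<le> t}"
    moreover have "\<alpha> i \<le> (\<Sum>i\<in>UNIV. \<alpha> i)" by (rule member_le_sum) simp_all
    ultimately show "\<alpha> i \<in> {..t}" by simp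
  qed simp
qed (rule finite_PiE, simp_all)

definition spherical_design :: "(real^'n) measure \<Rightarrow> nat \<Rightarrow> (real^'n) set \<Rightarrow> bool" where
  "spherical_design \<sigma> t X \<longleftrightarrow> finite X \<and> X \<subseteq> sphere 0 1 \<and>
     (\<forall>p. poly_of_degree_le t p \<longrightarrow> (1 / real (card X)) * (\<Sum>x\<in>X. p x) = (\<integral>x. p x \<partial>\<sigma>))"

definition convex_bodies :: "(real^'n) set set" where
  "convex_bodies = {K. compact K \<and> convex K \<and> interior K \<noteq> {}}"

text \<open>
  The \<open>k\<close>-dimensional Hausdorff measure, normalised so that it agrees with Lebesgue measure on
  \<open>k\<close>-dimensional subspaces. Empty covering sets get weight 0 also for \<open>k = 0\<close>. Boundedness
  is required because \<open>diameter\<close> is only meaningful on bounded sets.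
\<close>
definition hausdorff_weight :: "nat \<Rightarrow> 'a::metric_space set \<Rightarrow> real" where
  "hausdorff_weight k C = (if C = {} then 0 else unit_ball_vol (real k) * (diameter C / 2) ^ k)"

definition hausdorff_content :: "nat \<Rightarrow> real \<Rightarrow> 'a::metric_space set \<Rightarrow> ennreal" where
  "hausdorff_content k \<delta> A =
     (INF C \<in> {C :: nat \<Rightarrow> 'a set. A \<subseteq> (\<Union>j. C j) \<and> (\<forall>j. bounded (C j) \<and> diameter (C j) \<le> \<delta>)}.
        \<Sum>j. ennreal (hausdorff_weight k (C j)))"

definition hausdorff_measure :: "nat \<Rightarrow> 'a::metric_space set \<Rightarrow> ennreal" where
  "hausdorff_measure k A = (SUP \<delta> \<in> {0<..}. hausdorff_content k \<delta> A)"

text \<open>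
  The measure of dimension \<open>d - 1\<close>, for \<open>d = CARD('n)\<close>, as a real number. It is applied
  below only to boundaries and projections of compact convex sets, where \<open>hausdorff_measure\<close> is finite.
\<close>
definition hyper_volume :: "(real^'n) set \<Rightarrow> real" where
  "hyper_volume A = enn2real (hausdorff_measure (CARD('n) - 1) A)"

definition surface_area :: "(real^'n) set \<Rightarrow> real" where
  "surface_area K = hyper_volume (frontier K)"

text \<open>For \<open>x \<noteq> 0\<close>: the orthogonal projection onto the hyperplane orthogonal to \<open>x\<close>.\<close>
definition proj_hyperplane :: "real^'n \<Rightarrow> real^'n \<Rightarrow> real^'n" where
  "proj_hyperplane x y = y - ((x \<bullet> y) / (x \<bullet> x)) *\<^sub>R x"

definition c1 :: "nat \<Rightarrow> real" where
  "c1 d = Gamma (real d / 2) / (sqrt pi * Gamma (real (d + 1) / 2))"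

definition surface_estimate :: "(real^'n) set \<Rightarrow> (real^'n) set \<Rightarrow> real" where
  "surface_estimate X K =
     2 / c1 CARD('n) * (1 / real (card X)) * (\<Sum>x\<in>X. hyper_volume (proj_hyperplane x ` K))"

definition abs_approx_error :: "nat \<Rightarrow> real" where
  "abs_approx_error t =
     (INF q \<in> {q :: real poly. degree q \<le> t}. SUP s \<in> {-1..1}. \<bar>\<bar>s\<bar> - poly q s\<bar>)"

end

theory Submission
  imports Defs
begin

text \<open>
  A polytope \<open>P\<close> with unit facet normals \<open>u\<^sub>i\<close> and facets \<open>F\<^sub>i\<close> satisfies Cauchy's formula
  \<open>2 vol (P | x\<^sup>\<bottom>) = \<Sum>\<^sub>i \<bar>\<langle>x, u\<^sub>i\<rangle>\<bar> H (F\<^sub>i)\<close>, and \<open>S (P) = \<Sum>\<^sub>i H (F\<^sub>i)\<close>. Averaging over the design replaces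
  \<open>\<bar>\<langle>x, u\<^sub>i\<rangle>\<bar>\<close> by its spherical mean \<open>c\<^sub>d\<^sub>,\<^sub>1\<close> up to an error \<open>2 E\<^sub>t\<close>, because the design integrates
  \<open>q (\<langle>x, u\<^sub>i\<rangle>)\<close> exactly for every polynomial \<open>q\<close> of degree at most \<open>t\<close>. A convex body \<open>K\<close> is squeezed
  between homothetic copies: \<open>K \<subseteq> P \<subseteq> (1 + \<epsilon>) K\<close>, and both \<open>S\<close> and \<open>vol (\<cdot> | x\<^sup>\<bottom>)\<close> are monotone on
  convex bodies and homogeneous, so no surface area measure of \<open>K\<close> itself is needed.

  Neither finiteness of the Hausdorff measure \<open>H\<close> on bodies nor its comparison with Lebesgue measure
  (the isodiametric inequality) plays a role: only the ratios of \<open>H\<close> under linear maps between hyperplanes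
  enter, and infinite values collapse to 0 under \<open>enn2real\<close>, where the quotient in the theorem is 0 as well.
\<close>

section \<open>Hausdorff measure of almost disjoint convex sets\<close>

text \<open>The weight \<open>\<bar>x \<bullet> u\<bar>\<close> in Cauchy's formula has to be found
  for \<open>hausdorff_measure\<close> as it is defined, by covers, so it is derived from
  translation invariance and additivity. The measure of a box is additive in one edge length, hence
  linear in it by Cauchy's functional equation, and grid cubes carry this over to convex pieces of
  hyperplanes. Additivity is established for finitely many compact convex sets with disjoint
  relative interiors; facets and their projections to one side are such families. The factor 2 in
  the bound arises because a polynomial \<open>q\<close> replaces the absolute value twice, once in
  the design sum and once in the integral. The constant \<open>c1\<close> is the quotient of the
  integrals of \<open>\<bar>x \<bullet> y\<bar>\<close> and \<open>norm y\<close> over the unit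
  ball, as integration over sphere times ball in both orders shows. For the rate
  \<open>1 / t\<close>, a polynomial is built as second antiderivative of a kernel concentrated at
  0, because the second derivative of the absolute value is a point mass there.\<close>

lemma hausdorff_weight_nonneg: "bounded C \<Longrightarrow> 0 \<le> hausdorff_weight k C"
  by (auto simp: hausdorff_weight_def diameter_ge_0)

lemma hausdorff_weight_empty [simp]: "hausdorff_weight k {} = 0"
  by (simp add: hausdorff_weight_def)

lemma hausdorff_content_antimono:
  assumes "\<delta> \<le> \<delta>'"
  shows "hausdorff_content k \<delta>' A \<le> hausdorff_content k \<delta> A"
  unfolding hausdorff_content_def using assms by (intro INF_superset_mono) (auto intro: order_trans)

lemma hausdorff_content_le:
  assumes "A \<subseteq> (\<Union>j. C j)" "\<And>j. bounded (C j)" "\<And>j. diameter (C j) \<le> \<delta>"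
  shows "hausdorff_content k \<delta> A \<le> (\<Sum>j. ennreal (hausdorff_weight k (C j)))"
  unfolding hausdorff_content_def using assms by (intro INF_lower) auto

lemma hausdorff_content_le_measure: "\<delta> > 0 \<Longrightarrow> hausdorff_content k \<delta> A \<le> hausdorff_measure k A"
  unfolding hausdorff_measure_def by (rule SUP_upper) simp

lemma hausdorff_measure_mono: "A \<subseteq> B \<Longrightarrow> hausdorff_measure k A \<le> hausdorff_measure k B"
  unfolding hausdorff_measure_def hausdorff_content_def
  by (intro SUP_mono' INF_superset_mono) auto

lemma hausdorff_measure_empty [simp]: "hausdorff_measure k {} = 0"
proof -
  have "hausdorff_content k \<delta> {} \<le> 0" if "\<delta> > 0" for \<delta> :: real
    using hausdorff_content_le[of "{}" "\<lambda>_. {}" \<delta> k] that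
    by (simp add: hausdorff_weight_def diameter_empty)
  then show ?thesis
    unfolding hausdorff_measure_def by (intro antisym SUP_least) auto
qed

section \<open>Lipschitz images, subadditivity and additivity of the Hausdorff measure\<close>

lemma hausdorff_measure_lipschitz_le:
  fixes f :: "'a::metric_space \<Rightarrow> 'b::metric_space"
  assumes L: "L > 0" and f: "\<And>x y. x \<in> A \<Longrightarrow> y \<in> A \<Longrightarrow> dist (f x) (f y) \<le> L * dist x y"
  shows "hausdorff_measure k (f ` A) \<le> ennreal (L ^ k) * hausdorff_measure k A"
proof -
  have cancel: "ennreal ((1 / L) ^ k) * (ennreal (L ^ k) * x) = x" for x
    using L by (simp add: mult.assoc[symmetric] ennreal_mult'[symmetric] power_mult_distrib[symmetric])
  have content: "hausdorff_content k (L * \<delta>) (f ` A) \<le> ennreal (L ^ k) * hausdorff_content k \<delta> A"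
    if "\<delta> > 0" for \<delta>
  proof -
    \<comment> \<open>With the factor on the left, the right-hand side is a bare infimum and each
      cover can be treated separately; \<open>cancel\<close> moves the factor back.\<close>
    have "ennreal ((1 / L) ^ k) * hausdorff_content k (L * \<delta>) (f ` A) \<le> hausdorff_content k \<delta> A"
      unfolding hausdorff_content_def[of k \<delta> A]
    proof (rule INF_greatest)
      fix C :: "nat \<Rightarrow> 'a set"
      assume "C \<in> {C :: nat \<Rightarrow> 'a set. A \<subseteq> (\<Union>j. C j) \<and> (\<forall>j. bounded (C j) \<and> diameter (C j) \<le> \<delta>)}"
      then have C: "A \<subseteq> (\<Union>j. C j)" "\<And>j. bounded (C j)" "\<And>j. diameter (C j) \<le> \<delta>" by auto
      \<comment> \<open>The Lipschitz bound holds only on \<open>A\<close>, so the cover is cut down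
        to \<open>A\<close> before it is mapped.\<close>
      define D where "D j = f ` (C j \<inter> A)" for j
      have dist_D: "dist u v \<le> L * diameter (C j)" if uv: "u \<in> D j" "v \<in> D j" for u v j
      proof -
        obtain x y where "x \<in> C j" "y \<in> C j" "x \<in> A" "y \<in> A" "u = f x" "v = f y"
          using uv unfolding D_def by auto
        then show ?thesis
          using f[of x y] diameter_bounded_bound[OF C(2), of x j y] L
          by (meson mult_left_mono less_imp_le order_trans)
      qed
      have bd: "bounded (D j)" for j
      proof (cases "D j = {}")
        case False
        then obtain u where "u \<in> D j" by auto
        then show ?thesis using dist_D by (meson bounded_def)
      qed simp
      have diam_D: "diameter (D j) \<le> L * diameter (C j)" for j
        using dist_D[of _ j] L C(2) by (auto simp: diameter_def[of "D j"] diameter_ge_0 intro!: cSUP_least)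
      have w: "hausdorff_weight k (D j) \<le> L ^ k * hausdorff_weight k (C j)" for j
      proof (cases "D j = {}")
        case False
        then have ne: "C j \<noteq> {}" unfolding D_def by auto
        have "(diameter (D j) / 2) ^ k \<le> (L * (diameter (C j) / 2)) ^ k"
          using diam_D[of j] diameter_ge_0[OF bd] by (intro power_mono) auto
        then have "unit_ball_vol k * (diameter (D j) / 2) ^ k \<le> unit_ball_vol k * (L * (diameter (C j) / 2)) ^ k"
          by (intro mult_left_mono) auto
        then show ?thesis using False ne by (simp add: hausdorff_weight_def power_mult_distrib power_divide mult_ac)
      qed (use L in \<open>simp add: hausdorff_weight_def diameter_ge_0 C\<close>)
      have "hausdorff_content k (L * \<delta>) (f ` A) \<le> (\<Sum>j. ennreal (hausdorff_weight k (D j)))"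
      proof (rule hausdorff_content_le)
        show "f ` A \<subseteq> (\<Union>j. D j)" using C(1) unfolding D_def by fastforce
        show "diameter (D j) \<le> L * \<delta>" for j
          using diam_D[of j] C(3)[of j] L by (meson mult_left_mono less_imp_le order_trans)
      qed (rule bd)
      also have "\<dots> \<le> (\<Sum>j. ennreal (L ^ k) * ennreal (hausdorff_weight k (C j)))"
      proof (rule suminf_le)
        show "ennreal (hausdorff_weight k (D j)) \<le> ennreal (L ^ k) * ennreal (hausdorff_weight k (C j))" for j
          using w[of j] L by (subst ennreal_mult'[symmetric]) (auto intro: ennreal_leI)
      qed auto
      also have "\<dots> = ennreal (L ^ k) * (\<Sum>j. ennreal (hausdorff_weight k (C j)))"
        by (rule ennreal_suminf_cmult)
      finally have "ennreal ((1 / L) ^ k) * hausdorff_content k (L * \<delta>) (f ` A)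
          \<le> ennreal ((1 / L) ^ k) * (ennreal (L ^ k) * (\<Sum>j. ennreal (hausdorff_weight k (C j))))"
        by (rule mult_left_mono) simp
      also have "\<dots> = (\<Sum>j. ennreal (hausdorff_weight k (C j)))"
        by (rule cancel)
      finally show "ennreal ((1 / L) ^ k) * hausdorff_content k (L * \<delta>) (f ` A) \<le> \<dots>" .
    qed
    then have "ennreal (L ^ k) * (ennreal ((1 / L) ^ k) * hausdorff_content k (L * \<delta>) (f ` A))
        \<le> ennreal (L ^ k) * hausdorff_content k \<delta> A"
      by (rule mult_left_mono) simp
    then show ?thesis
      using cancel[of "hausdorff_content k (L * \<delta>) (f ` A)"] by (simp add: mult.left_commute)
  qed
  show ?thesis unfolding hausdorff_measure_def[of k "f ` A"]
  proof (rule SUP_least)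
    fix \<delta> :: real assume "\<delta> \<in> {0<..}"
    then have "\<delta> / L > 0" using L by simp
    then have "hausdorff_content k (L * (\<delta> / L)) (f ` A) \<le> ennreal (L ^ k) * hausdorff_measure k A"
      by (intro order_trans[OF content] mult_left_mono hausdorff_content_le_measure) auto
    then show "hausdorff_content k \<delta> (f ` A) \<le> ennreal (L ^ k) * hausdorff_measure k A"
      using L by simp
  qed
qed

lemma ennreal_le_Inf_add:
  fixes x :: ennreal
  assumes "\<And>a b. a \<in> S \<Longrightarrow> b \<in> T \<Longrightarrow> x \<le> a + b"
  shows "x \<le> Inf S + Inf T"
proof (rule ennreal_le_epsilon)
  fix e :: real assume fin: "Inf S + Inf T < top" and e: "0 < e"
  have "Inf S \<noteq> \<infinity>" "Inf T \<noteq> \<infinity>"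
    using fin by (metis ennreal_add_eq_top infinity_ennreal_def less_irrefl)+
  then have "Inf S + 0 < Inf S + ennreal (e / 2)" "Inf T + 0 < Inf T + ennreal (e / 2)"
    unfolding ennreal_add_left_cancel_less using e by simp_all
  then obtain a b where "a \<in> S" "b \<in> T" "a < Inf S + ennreal (e / 2)" "b < Inf T + ennreal (e / 2)"
    unfolding add_0_right Inf_less_iff by blast
  then have "x \<le> (Inf S + ennreal (e / 2)) + (Inf T + ennreal (e / 2))"
    by (meson assms add_mono less_imp_le order_trans)
  also have "\<dots> = Inf S + Inf T + ennreal e"
    using e by (simp add: ac_simps ennreal_plus[symmetric] del: ennreal_plus)
  finally show "x \<le> Inf S + Inf T + ennreal e" .
qed

lemma hausdorff_measure_Un_le:
  "hausdorff_measure k (A \<union> B) \<le> hausdorff_measure k A + hausdorff_measure k B"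
proof -
  have "hausdorff_content k \<delta> (A \<union> B) \<le> hausdorff_content k \<delta> A + hausdorff_content k \<delta> B" for \<delta>
  proof -
    let ?\<C> = "\<lambda>A. {C :: nat \<Rightarrow> 'a set. A \<subseteq> (\<Union>j. C j) \<and> (\<forall>j. bounded (C j) \<and> diameter (C j) \<le> \<delta>)}"
    let ?w = "\<lambda>C. \<Sum>j. ennreal (hausdorff_weight k (C j))"
    have le: "hausdorff_content k \<delta> (A \<union> B) \<le> ?w C + ?w D" if C: "C \<in> ?\<C> A" and D: "D \<in> ?\<C> B" for C D
    proof -
      \<comment> \<open>Alternating the two covers gives one countable cover; its first
        \<open>2 * n\<close> weights are the first \<open>n\<close> of each.\<close>
      define E where "E n = (if even n then C (n div 2) else D (n div 2))" for n
      let ?e = "\<lambda>n. ennreal (hausdorff_weight k (E n))"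
      have cover: "A \<union> B \<subseteq> (\<Union>j. E j)"
      proof
        fix x assume "x \<in> A \<union> B"
        then consider j where "x \<in> C j" | j where "x \<in> D j" using C D by auto
        then show "x \<in> (\<Union>j. E j)"
        proof cases
          case (1 j)
          then have "x \<in> E (2 * j)" by (simp add: E_def)
          then show ?thesis by blast
        next
          case (2 j)
          then have "x \<in> E (2 * j + 1)" by (simp add: E_def)
          then show ?thesis by blast
        qed
      qed
      have "hausdorff_content k \<delta> (A \<union> B) \<le> (\<Sum>n. ?e n)"
        using C D by (intro hausdorff_content_le[OF cover]) (auto simp: E_def)
      also have "\<dots> \<le> ?w C + ?w D"
      proof (rule suminf_le_const)
        fix n
        have "sum ?e {..<n} \<le> sum ?e {..<2 * n}" by (rule sum_mono2) auto
        also have "\<dots> = (\<Sum>j<n. ennreal (hausdorff_weight k (C j))) + (\<Sum>j<n. ennreal (hausdorff_weight k (D j)))"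
          by (induction n) (auto simp: E_def algebra_simps)
        also have "\<dots> \<le> ?w C + ?w D"
          by (intro add_mono sum_le_suminf) auto
        finally show "sum ?e {..<n} \<le> ?w C + ?w D" .
      qed auto
      finally show ?thesis .
    qed
    show ?thesis
      unfolding hausdorff_content_def[of k \<delta> A] hausdorff_content_def[of k \<delta> B]
    proof (rule ennreal_le_Inf_add)
      fix a b assume "a \<in> ?w ` ?\<C> A" "b \<in> ?w ` ?\<C> B"
      then obtain C D where "C \<in> ?\<C> A" "D \<in> ?\<C> B" "a = ?w C" "b = ?w D" by blast
      then show "hausdorff_content k \<delta> (A \<union> B) \<le> a + b" using le by simp
    qed
  qed
  note le = this
  show ?thesis
    unfolding hausdorff_measure_def[of k "A \<union> B"]
  proof (rule SUP_least)
    fix \<delta> :: real assume "\<delta> \<in> {0<..}"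
    then have "hausdorff_content k \<delta> A + hausdorff_content k \<delta> B \<le> hausdorff_measure k A + hausdorff_measure k B"
      by (intro add_mono hausdorff_content_le_measure) auto
    then show "hausdorff_content k \<delta> (A \<union> B) \<le> hausdorff_measure k A + hausdorff_measure k B"
      using le by (rule order_trans[rotated])
  qed
qed

lemma hausdorff_measure_UN_le:
  "finite I \<Longrightarrow> hausdorff_measure k (\<Union>i\<in>I. A i) \<le> (\<Sum>i\<in>I. hausdorff_measure k (A i))"
proof (induction I rule: finite_induct)
  case (insert i I)
  then show ?case
    using hausdorff_measure_Un_le[of k "A i" "\<Union>i\<in>I. A i"] by (auto intro: order_trans add_left_mono)
qed auto

text \<open>A set of diameter below \<open>r\<close> meets at most one of \<open>A\<close> and
  \<open>B\<close>, so every fine cover of the union splits into a cover of \<open>A\<close> and one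
  of \<open>B\<close>.\<close>

lemma hausdorff_measure_Un_separated:
  assumes r: "r > 0" and sep: "\<And>x y. x \<in> A \<Longrightarrow> y \<in> B \<Longrightarrow> r \<le> dist x y"
  shows "hausdorff_measure k (A \<union> B) = hausdorff_measure k A + hausdorff_measure k B"
proof (rule antisym[OF hausdorff_measure_Un_le])
  have content: "hausdorff_content k \<delta> A + hausdorff_content k \<delta> B \<le> hausdorff_content k \<delta> (A \<union> B)"
    if \<delta>: "\<delta> < r" for \<delta>
    unfolding hausdorff_content_def[of k \<delta> "A \<union> B"]
  proof (rule INF_greatest)
    fix C :: "nat \<Rightarrow> 'a set"
    assume "C \<in> {C. A \<union> B \<subseteq> (\<Union>j. C j) \<and> (\<forall>j. bounded (C j) \<and> diameter (C j) \<le> \<delta>)}"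
    then have C: "A \<union> B \<subseteq> (\<Union>j. C j)" "\<And>j. bounded (C j)" "\<And>j. diameter (C j) \<le> \<delta>" by auto
    have le: "hausdorff_weight k (C j \<inter> A) + hausdorff_weight k (C j \<inter> B) \<le> hausdorff_weight k (C j)" for j
    proof -
      have "C j \<inter> A = {} \<or> C j \<inter> B = {}"
        using sep diameter_bounded_bound[OF C(2)] C(3)[of j] \<delta> by (meson disjoint_iff IntE order_trans not_le)
      moreover have "hausdorff_weight k (C j \<inter> S) \<le> hausdorff_weight k (C j)" for S
      proof (cases "C j \<inter> S = {}")
        case False
        then have "C j \<noteq> {}" by auto
        moreover have "bounded (C j \<inter> S)" using C(2) by auto
        moreover have "(diameter (C j \<inter> S) / 2) ^ k \<le> (diameter (C j) / 2) ^ k"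
          using C(2) by (intro power_mono divide_right_mono diameter_subset) (auto intro: diameter_ge_0)
        ultimately show ?thesis using False by (auto simp: hausdorff_weight_def intro: mult_left_mono)
      qed (use C(2) in \<open>simp add: hausdorff_weight_def diameter_ge_0\<close>)
      ultimately show ?thesis by (auto simp: hausdorff_weight_def[of k "{}"])
    qed
    have "hausdorff_content k \<delta> S \<le> (\<Sum>j. ennreal (hausdorff_weight k (C j \<inter> S)))" if "S \<subseteq> A \<union> B" for S
    proof (rule hausdorff_content_le)
      show "diameter (C j \<inter> S) \<le> \<delta>" for j
        using diameter_subset[OF _ C(2), of "C j \<inter> S" j] C(3)[of j] by auto
    qed (use that C in auto)
    then have "hausdorff_content k \<delta> A + hausdorff_content k \<delta> B
        \<le> (\<Sum>j. ennreal (hausdorff_weight k (C j \<inter> A))) + (\<Sum>j. ennreal (hausdorff_weight k (C j \<inter> B)))"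
      by (intro add_mono) auto
    also have "\<dots> = (\<Sum>j. ennreal (hausdorff_weight k (C j \<inter> A)) + ennreal (hausdorff_weight k (C j \<inter> B)))"
      by (rule suminf_add) auto
    also have "\<dots> \<le> (\<Sum>j. ennreal (hausdorff_weight k (C j)))"
    proof (rule suminf_le)
      show "ennreal (hausdorff_weight k (C j \<inter> A)) + ennreal (hausdorff_weight k (C j \<inter> B)) \<le> ennreal (hausdorff_weight k (C j))" for j
        using le[of j] C(2)[of j]
        by (subst ennreal_plus[symmetric]) (auto intro!: ennreal_leI hausdorff_weight_nonneg bounded_Int)
    qed auto
    finally show "hausdorff_content k \<delta> A + hausdorff_content k \<delta> B \<le> \<dots>" .
  qed
  have two: "hausdorff_content k \<delta>1 A + hausdorff_content k \<delta>2 B \<le> hausdorff_measure k (A \<union> B)"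
    if "\<delta>1 > 0" "\<delta>2 > 0" for \<delta>1 \<delta>2
  proof -
    \<comment> \<open>\<open>hausdorff_content\<close> grows as the scale shrinks, so both scales
      may be replaced by a common one below \<open>r\<close>.\<close>
    let ?\<delta> = "min (r / 2) (min \<delta>1 \<delta>2)"
    have "hausdorff_content k \<delta>1 A + hausdorff_content k \<delta>2 B \<le> hausdorff_content k ?\<delta> A + hausdorff_content k ?\<delta> B"
      by (intro add_mono hausdorff_content_antimono) auto
    also have "\<dots> \<le> hausdorff_content k ?\<delta> (A \<union> B)" using r that by (intro content) auto
    also have "\<dots> \<le> hausdorff_measure k (A \<union> B)" using r that by (intro hausdorff_content_le_measure) auto
    finally show ?thesis .
  qed
  have ne: "{0::real<..} \<noteq> {}" by auto
  have "hausdorff_measure k A + hausdorff_measure k B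
      = (SUP \<delta>1\<in>{0<..}. SUP \<delta>2\<in>{0<..}. hausdorff_content k \<delta>1 A + hausdorff_content k \<delta>2 B)"
    unfolding hausdorff_measure_def
    by (simp add: ennreal_SUP_add_left[OF ne, symmetric] ennreal_SUP_add_right[OF ne, symmetric])
  also have "\<dots> \<le> hausdorff_measure k (A \<union> B)"
    using two by (intro SUP_least) auto
  finally show "hausdorff_measure k A + hausdorff_measure k B \<le> hausdorff_measure k (A \<union> B)" .
qed

lemma hausdorff_measure_Un_compact:
  fixes A B :: "'a::heine_borel set"
  assumes "compact A" "closed B" "A \<inter> B = {}"
  shows "hausdorff_measure k (A \<union> B) = hausdorff_measure k A + hausdorff_measure k B"
proof -
  obtain d where "d > 0" "\<And>x y. x \<in> A \<Longrightarrow> y \<in> B \<Longrightarrow> d \<le> dist x y"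
    using separate_compact_closed[of A B] assms by blast
  then show ?thesis by (rule hausdorff_measure_Un_separated)
qed

lemma hausdorff_measure_UN_compact:
  fixes A :: "'i \<Rightarrow> 'a::heine_borel set"
  assumes "finite I" "\<And>i. i \<in> I \<Longrightarrow> compact (A i)" "pairwise (\<lambda>i j. A i \<inter> A j = {}) I"
  shows "hausdorff_measure k (\<Union>i\<in>I. A i) = (\<Sum>i\<in>I. hausdorff_measure k (A i))"
  using assms
proof (induction I rule: finite_induct)
  case (insert i I)
  have "hausdorff_measure k (A i \<union> (\<Union>i\<in>I. A i)) = hausdorff_measure k (A i) + hausdorff_measure k (\<Union>i\<in>I. A i)"
    using insert.prems insert.hyps
    by (intro hausdorff_measure_Un_compact compact_imp_closed compact_UN) (auto simp: pairwise_insert)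
  then show ?case using insert by (auto simp: pairwise_insert)
qed auto


text \<open>The map from \<open>g x\<close> to \<open>f x\<close> is well defined, because
  \<open>g x = g y\<close> forces \<open>f x = f y\<close>, and it is Lipschitz. Two images of the
  same set are thus compared without an explicit formula for a map between them; a projected facet
  and a stretched one are the case of interest.\<close>

lemma hausdorff_measure_image_le:
  assumes L: "L > 0" and fg: "\<And>x y. x \<in> A \<Longrightarrow> y \<in> A \<Longrightarrow> dist (f x) (f y) \<le> L * dist (g x) (g y)"
  shows "hausdorff_measure k (f ` A) \<le> ennreal (L ^ k) * hausdorff_measure k (g ` A)"
proof -
  have h: "f (inv_into A g (g x)) = f x" if "x \<in> A" for x
    using fg[of "inv_into A g (g x)" x] that inv_into_into[of "g x" g A] f_inv_into_f[of "g x" g A] by simp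
  then have "f ` A = (\<lambda>z. f (inv_into A g z)) ` (g ` A)"
    by (auto simp: image_image)
  then show ?thesis
    using h fg by (auto intro!: hausdorff_measure_lipschitz_le L)
qed

lemma hausdorff_measure_image_cong:
  assumes "\<And>x y. x \<in> A \<Longrightarrow> y \<in> A \<Longrightarrow> dist (f x) (f y) = dist (g x) (g y)"
  shows "hausdorff_measure k (f ` A) = hausdorff_measure k (g ` A)"
  using hausdorff_measure_image_le[of 1 A f g k] hausdorff_measure_image_le[of 1 A g f k] assms
  by (simp add: antisym)

lemma hausdorff_measure_homothety:
  fixes f :: "'a::metric_space \<Rightarrow> 'b::metric_space"
  assumes L: "L > 0" and f: "\<And>x y. x \<in> A \<Longrightarrow> y \<in> A \<Longrightarrow> dist (f x) (f y) = L * dist x y"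
  shows "hausdorff_measure k (f ` A) = ennreal (L ^ k) * hausdorff_measure k A"
proof (rule antisym)
  show "hausdorff_measure k (f ` A) \<le> ennreal (L ^ k) * hausdorff_measure k A"
    using f by (intro hausdorff_measure_lipschitz_le L) auto
  have "hausdorff_measure k A \<le> ennreal ((1 / L) ^ k) * hausdorff_measure k (f ` A)"
    using hausdorff_measure_image_le[of "1 / L" A "\<lambda>x. x" f k] L f by simp
  then have "ennreal (L ^ k) * hausdorff_measure k A \<le> ennreal (L ^ k) * (ennreal ((1 / L) ^ k) * hausdorff_measure k (f ` A))"
    by (rule mult_left_mono) simp
  also have "\<dots> = hausdorff_measure k (f ` A)"
    using L by (simp add: mult.assoc[symmetric] ennreal_mult'[symmetric] power_mult_distrib[symmetric])
  finally show "ennreal (L ^ k) * hausdorff_measure k A \<le> hausdorff_measure k (f ` A)" .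
qed

text \<open>Let \<open>l\<close> tend to 1. If \<open>a\<close> is infinite, \<open>l = 1/2\<close>
  already makes \<open>b\<close> infinite.\<close>

lemma ennreal_le_if_scaled_le:
  fixes a b :: ennreal
  assumes "\<And>l. 0 < l \<Longrightarrow> l < 1 \<Longrightarrow> ennreal (l ^ k) * a \<le> b"
  shows "a \<le> b"
proof (cases "b = \<infinity> \<or> a = \<infinity>")
  case True
  then show ?thesis using assms[of "1/2"] by (auto simp: ennreal_mult_top)
next
  case False
  then obtain x y where xy: "a = ennreal x" "x \<ge> 0" "b = ennreal y" "y \<ge> 0"
    by (metis ennreal_cases infinity_ennreal_def)
  have "((\<lambda>l. l ^ k * x) \<longlongrightarrow> 1 ^ k * x) (at_left 1)" by (intro tendsto_intros)
  moreover have "l ^ k * x \<le> y" if "0 < l" "l < 1" for l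
    using assms[OF that] that xy by (simp add: ennreal_mult'[symmetric] ennreal_le_iff)
  then have "\<forall>\<^sub>F l in at_left 1. l ^ k * x \<le> y"
    by (intro eventually_at_leftI[of 0]) auto
  ultimately have "1 ^ k * x \<le> y" by (intro tendsto_upperbound) auto
  then show ?thesis using xy by (simp add: ennreal_leI)
qed

text \<open>The homothety with centre \<open>c\<close> and ratio \<open>l\<close> is written in the
  shape that \<open>rel_interior_convex_shrink\<close> uses.\<close>

lemma hausdorff_measure_homothety_about:
  fixes A :: "'a::real_normed_vector set"
  assumes l: "0 < l"
  shows "hausdorff_measure k ((\<lambda>x. x - (1 - l) *\<^sub>R (x - c)) ` A) = ennreal (l ^ k) * hausdorff_measure k A"
proof (rule hausdorff_measure_homothety[OF l])
  fix x y
  have "(x - (1 - l) *\<^sub>R (x - c)) - (y - (1 - l) *\<^sub>R (y - c)) = l *\<^sub>R (x - y)"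
    by (simp add: algebra_simps)
  then show "dist (x - (1 - l) *\<^sub>R (x - c)) (y - (1 - l) *\<^sub>R (y - c)) = l * dist x y"
    using l by (simp add: dist_norm)
qed

text \<open>Homothetic copies with ratio \<open>l < 1\<close> about points of the relative interiors are disjoint compact sets, hence
  positively separated; this replaces Caratheodory measurability of the pieces.\<close>
lemma hausdorff_measure_UN_convex:
  fixes C :: "'i \<Rightarrow> 'a::euclidean_space set"
  assumes I: "finite I" and C: "\<And>i. i \<in> I \<Longrightarrow> compact (C i)" "\<And>i. i \<in> I \<Longrightarrow> convex (C i)"
    and disj: "pairwise (\<lambda>i j. rel_interior (C i) \<inter> rel_interior (C j) = {}) I"
  shows "hausdorff_measure k (\<Union>i\<in>I. C i) = (\<Sum>i\<in>I. hausdorff_measure k (C i))"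
proof (rule antisym[OF hausdorff_measure_UN_le[OF I]], rule ennreal_le_if_scaled_le)
  fix l :: real assume l: "0 < l" "l < 1"
  have "\<exists>c. C i \<noteq> {} \<longrightarrow> c \<in> rel_interior (C i)" if "i \<in> I" for i
    using rel_interior_eq_empty[OF C(2)[OF that]] by auto
  then obtain c where c: "\<And>i. i \<in> I \<Longrightarrow> C i \<noteq> {} \<Longrightarrow> c i \<in> rel_interior (C i)" by metis
  define D where "D i = (\<lambda>x. x - (1 - l) *\<^sub>R (x - c i)) ` C i" for i
  have D_sub: "D i \<subseteq> rel_interior (C i)" if "i \<in> I" for i
    unfolding D_def using rel_interior_convex_shrink[OF C(2) c, OF that that, of _ "1 - l"] l by auto
  have D_compact: "compact (D i)" if "i \<in> I" for i
    unfolding D_def using C(1)[OF that] by (intro compact_continuous_image continuous_intros)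
  have D_measure: "hausdorff_measure k (D i) = ennreal (l ^ k) * hausdorff_measure k (C i)" for i
    unfolding D_def by (rule hausdorff_measure_homothety_about[OF l(1)])
  have "ennreal (l ^ k) * (\<Sum>i\<in>I. hausdorff_measure k (C i)) = (\<Sum>i\<in>I. hausdorff_measure k (D i))"
    by (simp add: D_measure sum_distrib_left)
  also have "\<dots> = hausdorff_measure k (\<Union>i\<in>I. D i)"
    using D_sub disj by (intro hausdorff_measure_UN_compact[symmetric] I D_compact) (fastforce simp: pairwise_def)+
  also have "\<dots> \<le> hausdorff_measure k (\<Union>i\<in>I. C i)"
    using D_sub rel_interior_subset by (intro hausdorff_measure_mono) blast
  finally show "ennreal (l ^ k) * (\<Sum>i\<in>I. hausdorff_measure k (C i)) \<le> \<dots>" .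
qed

section \<open>Projections of pieces of hyperplanes\<close>

text \<open>Cauchy's functional equation on the positive reals. Nonnegativity makes \<open>g\<close>
  monotone, so \<open>N * g s = g (N * s)\<close> lies between the values of \<open>g\<close> at the
  integers next to \<open>N * s\<close>; dividing by \<open>N\<close> leaves an error
  \<open>g 1 / N\<close>.\<close>

lemma additive_nonneg_linear:
  fixes g :: "real \<Rightarrow> real"
  assumes nonneg: "\<And>s. s > 0 \<Longrightarrow> 0 \<le> g s"
    and add: "\<And>s t. s > 0 \<Longrightarrow> t > 0 \<Longrightarrow> g (s + t) = g s + g t"
    and s: "s > 0"
  shows "g s = s * g 1"
proof -
  have mono: "g x \<le> g y" if "0 < x" "x \<le> y" for x y
  proof (cases "x = y")
    case False
    then have "g (x + (y - x)) = g x + g (y - x)" "0 \<le> g (y - x)" using that by (intro add nonneg; simp)+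
    then show ?thesis by simp
  qed simp
  have mult: "g (real (Suc n) * x) = real (Suc n) * g x" if "x > 0" for n x
  proof (induction n)
    case (Suc n)
    have "real (Suc (Suc n)) * x = real (Suc n) * x + x" by (simp add: distrib_right)
    then have "g (real (Suc (Suc n)) * x) = g (real (Suc n) * x + x)" by (rule arg_cong)
    also have "\<dots> = g (real (Suc n) * x) + g x" using that by (intro add) auto
    finally show ?case using Suc by (simp add: algebra_simps)
  qed simp
  have bound: "\<bar>g s - s * g 1\<bar> \<le> g 1 / real (Suc n)" for n
  proof -
    define N where "N = real (Suc n)"
    define p where "p = nat \<lfloor>N * s\<rfloor>"
    have N: "N > 0" "g (N * s) = N * g s" using mult[OF s] by (simp_all add: N_def)
    then have "real p = of_int \<lfloor>N * s\<rfloor>" using s by (simp add: p_def)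
    then have p: "real p \<le> N * s" "N * s \<le> real p + 1"
      using of_int_floor_le[of "N * s"] real_of_int_floor_add_one_ge[of "N * s"] by simp_all
    have "N * g s = g (N * s)" using N by simp
    also have "\<dots> \<le> g (real (Suc p) * 1)" using p s N by (intro mono) auto
    also have "\<dots> = real (Suc p) * g 1" by (rule mult) simp
    also have "\<dots> \<le> (N * s + 1) * g 1" using p nonneg[of 1] by (intro mult_right_mono) auto
    finally have 1: "N * g s \<le> (N * s + 1) * g 1" .
    have "(N * s - 1) * g 1 \<le> real p * g 1" using p nonneg[of 1] by (intro mult_right_mono) auto
    also have "\<dots> \<le> N * g s"
    proof (cases p)
      \<comment> \<open>Nothing is assumed at argument 0, so \<open>p = 0\<close> cannot go through
        \<open>mult\<close> and is settled by nonnegativity.\<close>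
      case 0
      then show ?thesis using nonneg[OF s] N by simp
    next
      case (Suc p')
      have "real p * g 1 = g (real p * 1)" using mult[of 1 p'] Suc by simp
      also have "\<dots> \<le> g (N * s)" using p Suc by (intro mono) auto
      also have "\<dots> = N * g s" using N by simp
      finally show ?thesis .
    qed
    finally have 2: "(N * s - 1) * g 1 \<le> N * g s" .
    have "\<bar>N * (g s - s * g 1)\<bar> \<le> g 1" using 1 2 unfolding abs_le_iff by (simp add: algebra_simps)
    then have "N * \<bar>g s - s * g 1\<bar> \<le> g 1" using N by (simp add: abs_mult)
    then have "\<bar>g s - s * g 1\<bar> \<le> g 1 / N" using N by (simp add: pos_le_divide_eq mult.commute)
    then show ?thesis by (simp add: N_def)
  qed
  have "(\<lambda>n. g 1 / real (Suc n)) \<longlonglongrightarrow> 0"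
    using tendsto_mult_right_zero[OF LIMSEQ_inverse_real_of_nat, of "g 1"] by (simp add: divide_inverse)
  then have "\<bar>g s - s * g 1\<bar> \<le> 0" by (rule LIMSEQ_le_const) (use bound in auto)
  then show ?thesis by simp
qed

lemma additive_ennreal_linear:
  fixes g :: "real \<Rightarrow> ennreal"
  assumes add: "\<And>s t. s > 0 \<Longrightarrow> t > 0 \<Longrightarrow> g (s + t) = g s + g t" and s: "s > 0"
  shows "g s = ennreal s * g 1"
proof -
  have mono: "g x \<le> g y" if "0 < x" "x \<le> y" for x y
  proof (cases "x = y")
    case False
    then have "g (x + (y - x)) = g x + g (y - x)" using that by (intro add) auto
    then show ?thesis by simp
  qed simp
  have mult: "g (real (Suc n) * x) = of_nat (Suc n) * g x" if "x > 0" for n x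
  proof (induction n)
    case (Suc n)
    have "real (Suc (Suc n)) * x = real (Suc n) * x + x" by (simp add: distrib_right)
    then have "g (real (Suc (Suc n)) * x) = g (real (Suc n) * x + x)" by (rule arg_cong)
    also have "\<dots> = g (real (Suc n) * x) + g x" using that by (intro add) auto
    finally show ?case using Suc by (simp add: algebra_simps)
  qed simp
  \<comment> \<open>One infinite value spreads to all arguments through monotonicity and multiples.
    So \<open>g\<close> is real-valued throughout or infinite throughout, and the latter is linear
    too, as \<open>ennreal s * \<infinity> = \<infinity>\<close> for \<open>s > 0\<close>.\<close>
  have all_inf: "g x = \<infinity>" if x: "x > 0" and y: "y > 0" "g y = \<infinity>" for x y
  proof -
    obtain n where "y / x < real n" using reals_Archimedean2 by blast
    then have "y \<le> real (Suc n) * x" using x by (simp add: field_simps)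
    then have "\<infinity> \<le> of_nat (Suc n) * g x" using mono[of y "real (Suc n) * x"] mult[OF x, of n] y by simp
    then show ?thesis by (simp add: top_unique ennreal_mult_eq_top_iff del: of_nat_Suc)
  qed
  show ?thesis
  proof (cases "g 1 = \<infinity>")
    case True
    then show ?thesis using all_inf[OF s, of 1] s by (simp add: ennreal_mult_top)
  next
    case False
    have fin: "g x \<noteq> \<infinity>" if "x > 0" for x
      using all_inf[of 1 x] that False by auto
    then have eq: "g x = ennreal (enn2real (g x))" if "x > 0" for x
      using that by (simp add: less_top)
    have "enn2real (g (x + y)) = enn2real (g x) + enn2real (g y)" if "x > 0" "y > 0" for x y
      using that fin by (simp add: add enn2real_plus less_top)
    from additive_nonneg_linear[of "\<lambda>x. enn2real (g x)", OF _ this s]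
    have "enn2real (g s) = s * enn2real (g 1)" by simp
    then show ?thesis using eq[OF s] eq[of 1] s by (metis ennreal_mult' less_imp_le zero_less_one)
  qed
qed

text \<open>A common point \<open>y\<close> lies on the separating hyperplane. As a relative
  interior point of \<open>C\<close>, it allows the segment from \<open>z\<close> through
  \<open>y\<close> to be prolonged inside \<open>C\<close>, and since \<open>z\<close> is strictly
  on one side, the prolongation ends strictly on the other.\<close>

lemma rel_interior_disjoint_if_separated:
  fixes C D :: "'a::euclidean_space set"
  assumes "convex C" "\<And>y. y \<in> C \<Longrightarrow> a \<bullet> y \<le> b" "\<And>y. y \<in> D \<Longrightarrow> b \<le> a \<bullet> y" "z \<in> C" "a \<bullet> z < b"
  shows "rel_interior C \<inter> rel_interior D = {}"
proof (rule ccontr)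
  assume "rel_interior C \<inter> rel_interior D \<noteq> {}"
  then obtain y where y: "y \<in> rel_interior C" "y \<in> D" using rel_interior_subset by blast
  then have "a \<bullet> y = b" using assms(2,3) rel_interior_subset by (metis antisym subsetD)
  obtain e where e: "e > 1" "(1 - e) *\<^sub>R z + e *\<^sub>R y \<in> C"
    using y assms(1,4) convex_rel_interior_iff[of C y] by blast
  have "a \<bullet> ((1 - e) *\<^sub>R z + e *\<^sub>R y) = b + (e - 1) * (b - a \<bullet> z)"
    using \<open>a \<bullet> y = b\<close> by (simp add: algebra_simps)
  moreover have "(e - 1) * (b - a \<bullet> z) > 0" using e assms(5) by simp
  ultimately show False using assms(2)[OF e(2)] by simp
qed

lemma hausdorff_measure_translation:
  fixes A :: "'a::real_normed_vector set"
  shows "hausdorff_measure k ((\<lambda>x. v + x) ` A) = hausdorff_measure k A"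
  using hausdorff_measure_image_cong[of A "\<lambda>x. v + x" "\<lambda>x. x" k] by simp

lemma hausdorff_measure_isometry:
  assumes "\<And>x y. x \<in> A \<Longrightarrow> y \<in> A \<Longrightarrow> dist (f x) (f y) = dist x y"
  shows "hausdorff_measure k (f ` A) = hausdorff_measure k A"
  using hausdorff_measure_image_cong[of A f "\<lambda>x. x" k] assms by simp

section \<open>Boxes and convex sets under the stretching of one coordinate\<close>

text \<open>Model for projecting a facet: up to isometries, the projection of a hyperplane piece
  along \<open>x\<close> multiplies one coordinate inside the hyperplane by
  \<open>\<bar>x \<bullet> u\<bar>\<close> and keeps the others.\<close>

definition coord_stretch :: "'n \<Rightarrow> real \<Rightarrow> real^'n \<Rightarrow> real^'n" where
  "coord_stretch b s y = (\<chi> i. if i = b then s * y $ i else y $ i)"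

lemma coord_stretch_nth: "coord_stretch b s y $ i = (if i = b then s * y $ i else y $ i)"
  by (simp add: coord_stretch_def)

lemma linear_coord_stretch: "linear (coord_stretch b s)"
  by (rule linearI) (simp_all add: vec_eq_iff coord_stretch_nth algebra_simps)

lemma inj_coord_stretch:
  assumes "s \<noteq> 0"
  shows "inj (coord_stretch b s)"
proof (rule injI)
  fix x y :: "real^'a" assume eq: "coord_stretch b s x = coord_stretch b s y"
  have "x $ i = y $ i" for i
    using arg_cong[OF eq, of "\<lambda>z. z $ i"] assms by (auto simp: coord_stretch_nth split: if_splits)
  then show "x = y" by (simp add: vec_eq_iff)
qed

lemma coord_stretch_cbox:
  assumes s: "s > 0"
  shows "coord_stretch b s ` cbox l u = cbox (coord_stretch b s l) (coord_stretch b s u)"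
proof -
  have le: "coord_stretch b s x $ i \<le> coord_stretch b s y $ i \<longleftrightarrow> x $ i \<le> y $ i" for x y i
    using s by (cases "i = b") (simp_all add: coord_stretch_nth)
  have iff: "coord_stretch b s y \<in> cbox (coord_stretch b s l) (coord_stretch b s u) \<longleftrightarrow> y \<in> cbox l u" for y
    unfolding mem_box_cart le ..
  have inv: "y = coord_stretch b s (coord_stretch b (1 / s) y)" for y
    using s by (simp add: vec_eq_iff coord_stretch_nth)
  show ?thesis
  proof (intro subset_antisym subsetI)
    fix y assume "y \<in> cbox (coord_stretch b s l) (coord_stretch b s u)"
    then have "coord_stretch b (1 / s) y \<in> cbox l u" using iff[of "coord_stretch b (1 / s) y"] inv[of y] by simp
    then show "y \<in> coord_stretch b s ` cbox l u" using inv[of y] by (rule image_eqI[rotated])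
  qed (use iff in auto)
qed

text \<open>Stacking a box of edge \<open>s\<close> in direction \<open>b\<close> and a translated
  box of edge \<open>t\<close> gives one of edge \<open>s + t\<close>, and the two share only a
  face. So the measure solves Cauchy's equation in the edge length.\<close>

lemma hausdorff_measure_cbox_linear:
  fixes l u :: "real^'n" and b :: 'n
  defines "Q \<equiv> \<lambda>s. cbox l (\<chi> i. if i = b then l $ i + s else u $ i)"
  assumes s: "s > 0"
  shows "hausdorff_measure k (Q s) = ennreal s * hausdorff_measure k (Q 1)"
proof (rule additive_ennreal_linear[where g = "\<lambda>s. hausdorff_measure k (Q s)", OF _ s])
  fix s t :: real assume st: "s > 0" "t > 0"
  let ?R = "(\<lambda>x. axis b s + x) ` Q t"
  show "hausdorff_measure k (Q (s + t)) = hausdorff_measure k (Q s) + hausdorff_measure k (Q t)"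
  proof (cases "Q s = {}")
    case True
    \<comment> \<open>The \<open>b\<close>-edge has positive length, so emptiness comes from another
      coordinate and holds for every edge length.\<close>
    then obtain i where "i \<noteq> b" "u $ i < l $ i"
      using st by (auto simp: Q_def interval_eq_empty_cart split: if_splits)
    then have "Q r = {}" for r
      unfolding Q_def interval_eq_empty_cart by (intro exI[of _ i]) auto
    then show ?thesis by simp
  next
    case False
    have R: "?R = cbox (\<chi> i. if i = b then l $ i + s else l $ i) (\<chi> i. if i = b then l $ i + (s + t) else u $ i)"
      unfolding Q_def cbox_translation[symmetric]
      by (rule arg_cong2[where f = cbox]) (auto simp: vec_eq_iff axis_def)
    have Q_iff: "y \<in> Q r \<longleftrightarrow> (\<forall>i. l $ i \<le> y $ i) \<and> (\<forall>i. i \<noteq> b \<longrightarrow> y $ i \<le> u $ i) \<and> y $ b \<le> l $ b + r" for y r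
      unfolding Q_def mem_box_cart by auto
    have R_iff: "y \<in> ?R \<longleftrightarrow> (\<forall>i. i \<noteq> b \<longrightarrow> l $ i \<le> y $ i) \<and> l $ b + s \<le> y $ b \<and> (\<forall>i. i \<noteq> b \<longrightarrow> y $ i \<le> u $ i) \<and> y $ b \<le> l $ b + (s + t)" for y
      unfolding R mem_box_cart by auto
    have union: "Q (s + t) = Q s \<union> ?R"
    proof (rule set_eqI)
      fix y
      have "(\<forall>i. l $ i \<le> y $ i) \<longleftrightarrow> (\<forall>i. i \<noteq> b \<longrightarrow> l $ i \<le> y $ i) \<and> l $ b \<le> y $ b" by auto
      moreover have "l $ b + s \<le> y $ b \<Longrightarrow> l $ b \<le> y $ b" "y $ b \<le> l $ b + s \<Longrightarrow> y $ b \<le> l $ b + (s + t)"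
        "l $ b + s \<le> y $ b \<or> y $ b \<le> l $ b + s" using st by linarith+
      ultimately show "y \<in> Q (s + t) \<longleftrightarrow> y \<in> Q s \<union> ?R"
        unfolding Un_iff Q_iff R_iff by blast
    qed
    have "rel_interior (Q s) \<inter> rel_interior ?R = {}"
    proof (rule rel_interior_disjoint_if_separated[where a = "axis b 1" and b = "l $ b + s" and z = l])
      show "convex (Q s)" by (simp add: Q_def)
      show "l \<in> Q s" using False unfolding Q_def interval_ne_empty_cart by (simp add: mem_box_cart)
      show "axis b 1 \<bullet> y \<le> l $ b + s" if "y \<in> Q s" for y
        using that unfolding Q_iff by (simp add: inner_axis')
      show "l $ b + s \<le> axis b 1 \<bullet> y" if "y \<in> ?R" for y
        using that unfolding R_iff by (simp add: inner_axis')
      show "axis b 1 \<bullet> l < l $ b + s" using st by (simp add: inner_axis')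
    qed
    moreover have "compact (Q s)" "convex (Q s)" "compact ?R" "convex ?R"
      unfolding R by (simp_all add: Q_def)
    ultimately have "hausdorff_measure k (\<Union>i\<in>{True, False}. if i then Q s else ?R) = (\<Sum>i\<in>{True, False}. hausdorff_measure k (if i then Q s else ?R))"
      by (intro hausdorff_measure_UN_convex) (auto simp: pairwise_def Int_commute)
    then show ?thesis using union hausdorff_measure_translation[of k "axis b s" "Q t"] by (simp add: Un_commute)
  qed
qed

text \<open>Stretching lengthens the \<open>b\<close>-edge by the factor \<open>s\<close> and shifts
  the lower corner by \<open>(s - 1) * l $ b\<close>, which the measure ignores. The box may be flat
  in other directions, as the grid cubes in a hyperplane are.\<close>

lemma hausdorff_measure_coord_stretch_cbox:
  fixes l u :: "real^'n"
  assumes s: "s > 0" and lu: "l $ b < u $ b"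
  shows "hausdorff_measure k (coord_stretch b s ` cbox l u) = ennreal s * hausdorff_measure k (cbox l u)"
proof -
  let ?Q = "\<lambda>s. cbox l (\<chi> i. if i = b then l $ i + s else u $ i)"
  let ?r = "u $ b - l $ b"
  have "coord_stretch b s ` cbox l u = (\<lambda>x. axis b ((s - 1) * l $ b) + x) ` ?Q (s * ?r)"
    unfolding coord_stretch_cbox[OF s] cbox_translation[symmetric]
    by (rule arg_cong2[where f = cbox]) (auto simp: vec_eq_iff axis_def coord_stretch_nth algebra_simps)
  then have "hausdorff_measure k (coord_stretch b s ` cbox l u) = hausdorff_measure k (?Q (s * ?r))"
    by (simp add: hausdorff_measure_translation)
  also have "\<dots> = ennreal (s * ?r) * hausdorff_measure k (?Q 1)"
    using s lu by (intro hausdorff_measure_cbox_linear) simp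
  also have "\<dots> = ennreal s * (ennreal ?r * hausdorff_measure k (?Q 1))"
    using s lu by (simp add: ennreal_mult mult.assoc)
  also have "ennreal ?r * hausdorff_measure k (?Q 1) = hausdorff_measure k (?Q ?r)"
    using lu by (intro hausdorff_measure_cbox_linear[symmetric]) simp
  also have "?Q ?r = cbox l u"
    by (rule arg_cong2[where f = cbox]) (auto simp: vec_eq_iff)
  finally show ?thesis .
qed


lemma coord_stretch_homothety:
  fixes y :: "real^'n"
  shows "coord_stretch b s (y - e *\<^sub>R (y - z)) = coord_stretch b s y - e *\<^sub>R (coord_stretch b s y - coord_stretch b s z)"
  using linear_coord_stretch[of b s] by (simp add: linear_diff linear_scale)

text \<open>The cubes of a fine grid in the hyperplane \<open>y $ a = c\<close> that lie in a convex body \<open>F\<close> of this hyperplane cover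
  a homothetic copy of \<open>F\<close> with ratio close to 1.\<close>
lemma grid_cubes_in_convex:
  fixes F :: "(real^'n) set"
  assumes F: "compact F" "convex F" "F \<subseteq> {y. y $ a = c}" and r: "r > 0" "ball z r \<inter> {y. y $ a = c} \<subseteq> F"
    and z: "z \<in> F" and l: "0 < l" "l < 1"
  obtains M :: "('n \<Rightarrow> int) set" and L U :: "('n \<Rightarrow> int) \<Rightarrow> real^'n" where "finite M"
    "\<And>m i. m \<in> M \<Longrightarrow> i \<noteq> a \<Longrightarrow> L m $ i < U m $ i"
    "\<And>m. m \<in> M \<Longrightarrow> cbox (L m) (U m) \<subseteq> F"
    "pairwise (\<lambda>m m'. rel_interior (cbox (L m) (U m)) \<inter> rel_interior (cbox (L m') (U m')) = {}) M"
    "(\<lambda>x. x - (1 - l) *\<^sub>R (x - z)) ` F \<subseteq> (\<Union>m\<in>M. cbox (L m) (U m))"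
proof -
  \<comment> \<open>The norm is at most the sum of the absolute coordinates, so
    \<open>CARD('n) * \<delta>\<close> bounds the distance within a cube; halving makes the
    inequality below strict.\<close>
  define \<delta> where "\<delta> = (1 - l) * r / (2 * real CARD('n))"
  have \<delta>: "\<delta> > 0" "real CARD('n) * \<delta> < (1 - l) * r" using l r by (auto simp: \<delta>_def)
  define L U :: "('n \<Rightarrow> int) \<Rightarrow> real^'n" where
    "L m = (\<chi> i. if i = a then c else \<delta> * of_int (m i))" and
    "U m = (\<chi> i. if i = a then c else \<delta> * (of_int (m i) + 1))" for m
  \<comment> \<open>\<open>L\<close> and \<open>U\<close> ignore the entry \<open>m a\<close>;
    fixing it to 0 makes the indexing injective, which finiteness and disjointness of the family
    rely on.\<close>
  define M where "M = {m. m a = 0 \<and> cbox (L m) (U m) \<subseteq> F}"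
  have LU: "L m $ i \<le> U m $ i" "i \<noteq> a \<Longrightarrow> L m $ i < U m $ i" for m i
    using \<delta> by (auto simp: L_def U_def)
  have L_in: "L m \<in> cbox (L m) (U m)" for m using LU by (simp add: mem_box_cart)
  obtain R where R: "\<And>y. y \<in> F \<Longrightarrow> norm y \<le> R"
    using compact_imp_bounded[OF F(1)] by (auto simp: bounded_iff)
  have "finite M"
  proof (rule finite_subset)
    show "M \<subseteq> (\<Pi>\<^sub>E i\<in>UNIV. {- \<lceil>R / \<delta>\<rceil>..\<lceil>R / \<delta>\<rceil>})"
    proof (intro subsetI PiE_I)
      fix m i assume m: "m \<in> M"
      then have LF: "L m \<in> F" using L_in[of m] by (auto simp: M_def)
      have "0 \<le> R" using R[OF z] norm_ge_zero order_trans by blast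
      then have R0: "0 \<le> \<lceil>R / \<delta>\<rceil>" using \<delta> by (simp add: order.strict_trans2[of _ 0])
      show "m i \<in> {- \<lceil>R / \<delta>\<rceil>..\<lceil>R / \<delta>\<rceil>}"
      proof (cases "i = a")
        case True
        then show ?thesis using m R0 by (simp add: M_def)
      next
        case False
        then have "\<delta> * \<bar>of_int (m i)\<bar> = \<bar>L m $ i\<bar>" using \<delta> by (simp add: L_def abs_mult)
        also have "\<dots> \<le> R" using component_le_norm_cart[of "L m" i] R[OF LF] by linarith
        finally have "\<bar>of_int (m i)\<bar> \<le> R / \<delta>" using \<delta> by (simp add: pos_le_divide_eq mult.commute)
        then have "\<bar>of_int (m i)\<bar> \<le> real_of_int \<lceil>R / \<delta>\<rceil>" by linarith
        then have "\<bar>m i\<bar> \<le> \<lceil>R / \<delta>\<rceil>" by linarith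
        then show ?thesis by auto
      qed
    qed simp
  qed (rule finite_PiE, simp_all)
  note fin = this
  have pw: "pairwise (\<lambda>m m'. rel_interior (cbox (L m) (U m)) \<inter> rel_interior (cbox (L m') (U m')) = {}) M"
  proof (rule pairwiseI)
    have disj: "rel_interior (cbox (L m) (U m)) \<inter> rel_interior (cbox (L m') (U m')) = {}" if "i \<noteq> a" "m i < m' i" for m m' i
    proof (rule rel_interior_disjoint_if_separated[where a = "axis i 1" and b = "\<delta> * of_int (m' i)" and z = "L m"])
      have le: "\<delta> * (of_int (m i) + 1) \<le> \<delta> * of_int (m' i)" using that \<delta> by simp
      show "axis i 1 \<bullet> y \<le> \<delta> * of_int (m' i)" if "y \<in> cbox (L m) (U m)" for y
      proof -
        have "y $ i \<le> U m $ i" using that by (simp add: mem_box_cart)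
        then show ?thesis using le \<open>i \<noteq> a\<close> by (simp add: inner_axis' U_def)
      qed
      show "\<delta> * of_int (m' i) \<le> axis i 1 \<bullet> y" if "y \<in> cbox (L m') (U m')" for y
      proof -
        have "L m' $ i \<le> y $ i" using that by (simp add: mem_box_cart)
        then show ?thesis using \<open>i \<noteq> a\<close> by (simp add: inner_axis' L_def)
      qed
      show "axis i 1 \<bullet> L m < \<delta> * of_int (m' i)"
        using that \<delta> by (simp add: inner_axis' L_def)
    qed (use L_in in simp_all)
    fix m m' assume m: "m \<in> M" "m' \<in> M" "m \<noteq> m'"
    then obtain i where i: "m i \<noteq> m' i" by auto
    then have "i \<noteq> a" using m by (auto simp: M_def)
    then show "rel_interior (cbox (L m) (U m)) \<inter> rel_interior (cbox (L m') (U m')) = {}"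
      using disj[of i m m'] disj[of i m' m] i by (metis inf_commute neqE)
  qed
  have cover: "(\<lambda>x. x - (1 - l) *\<^sub>R (x - z)) ` F \<subseteq> (\<Union>m\<in>M. cbox (L m) (U m))"
  proof
    fix y' assume "y' \<in> (\<lambda>x. x - (1 - l) *\<^sub>R (x - z)) ` F"
    then obtain y where y: "y \<in> F" "y' = y - (1 - l) *\<^sub>R (y - z)" by auto
    moreover have za: "z $ a = c" "y $ a = c" using F(3) z y(1) by auto
    ultimately have y'a: "y' $ a = c" by simp
    define m where "m i = (if i = a then 0 else \<lfloor>y' $ i / \<delta>\<rfloor>)" for i
    have close: "\<delta> * of_int \<lfloor>x / \<delta>\<rfloor> \<le> x" "x \<le> \<delta> * (of_int \<lfloor>x / \<delta>\<rfloor> + 1)" for x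
    proof -
      have "\<delta> * of_int \<lfloor>x / \<delta>\<rfloor> \<le> \<delta> * (x / \<delta>)" "\<delta> * (x / \<delta>) \<le> \<delta> * (of_int \<lfloor>x / \<delta>\<rfloor> + 1)"
        using \<delta> by (intro mult_left_mono; simp)+
      then show "\<delta> * of_int \<lfloor>x / \<delta>\<rfloor> \<le> x" "x \<le> \<delta> * (of_int \<lfloor>x / \<delta>\<rfloor> + 1)"
        using \<delta> by simp_all
    qed
    have y'_in: "y' \<in> cbox (L m) (U m)"
      unfolding mem_box_cart using y'a close by (auto simp: L_def U_def m_def)
    have "cbox (L m) (U m) \<subseteq> F"
    proof
      fix x assume x: "x \<in> cbox (L m) (U m)"
      have xa: "x $ a = c" using x unfolding mem_box_cart by (auto simp: L_def U_def dest: spec[of _ a])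
      define v where "v = x - y'"
      have "\<bar>v $ i\<bar> \<le> \<delta>" for i
      proof (cases "i = a")
        case True
        then show ?thesis using xa y'a \<delta> by (simp add: v_def)
      next
        case False
        have "L m $ i \<le> x $ i" "x $ i \<le> U m $ i" "L m $ i \<le> y' $ i" "y' $ i \<le> U m $ i"
          using x y'_in by (auto simp: mem_box_cart)
        then show ?thesis using False by (auto simp: L_def U_def v_def algebra_simps abs_le_iff)
      qed
      then have "(\<Sum>i\<in>UNIV. \<bar>v $ i\<bar>) \<le> real CARD('n) * \<delta>" by (rule sum_bounded_above)
      then have v: "norm v < (1 - l) * r" using norm_le_l1_cart[of v] \<delta> by linarith
      \<comment> \<open>\<open>x\<close> becomes the convex combination of \<open>y\<close> and
        \<open>w\<close> with weights \<open>l\<close> and \<open>1 - l\<close>. The point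
        \<open>w\<close> absorbs the deviation \<open>v\<close>, enlarged by
        \<open>1 / (1 - l)\<close>, and the ball around \<open>z\<close> leaves room for
        that.\<close>
      define w where "w = z + (1 / (1 - l)) *\<^sub>R v"
      have "norm v / (1 - l) < r" using v l by (simp add: field_simps)
      then have "w \<in> ball z r" using l by (simp add: w_def dist_norm)
      moreover have "w $ a = c" using za xa y'a by (simp add: w_def v_def)
      ultimately have "w \<in> F" using r by auto
      then have "l *\<^sub>R y + (1 - l) *\<^sub>R w \<in> F" using y l by (intro convexD[OF F(2)]) auto
      moreover have "(1 - l) *\<^sub>R w = (1 - l) *\<^sub>R z + v" using l by (simp add: w_def scaleR_add_right)
      then have "l *\<^sub>R y + (1 - l) *\<^sub>R w = x"
        by (simp add: v_def y(2) algebra_simps)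
      ultimately show "x \<in> F" by simp
    qed
    then have "m \<in> M" by (simp add: M_def m_def)
    then show "y' \<in> (\<Union>m\<in>M. cbox (L m) (U m))" using y'_in by blast
  qed
  show thesis
  proof (rule that[OF fin _ _ pw cover])
    show "L m $ i < U m $ i" if "i \<noteq> a" for m i using that by (rule LU(2))
    show "cbox (L m) (U m) \<subseteq> F" if "m \<in> M" for m using that by (simp add: M_def)
  qed
qed

text \<open>The union of the cubes is squeezed between a homothetic copy of \<open>F\<close> and
  \<open>F\<close>. Its measure is multiplied by exactly \<open>s\<close>, and the stretch maps
  homothetic copies of \<open>F\<close> to homothetic copies of its image, so both inequalities hold
  up to \<open>l ^ k\<close>.\<close>

lemma hausdorff_measure_coord_stretch:
  fixes F :: "(real^'n) set"
  assumes F: "compact F" "convex F" "F \<subseteq> {y. y $ a = c}" and r: "r > 0" "ball z r \<inter> {y. y $ a = c} \<subseteq> F"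
    and z: "z \<in> F" and s: "s > 0" and ab: "b \<noteq> a"
  shows "hausdorff_measure k (coord_stretch b s ` F) = ennreal s * hausdorff_measure k F"
proof -
  let ?T = "coord_stretch b s"
  have "ennreal (l ^ k) * (ennreal s * hausdorff_measure k F) \<le> hausdorff_measure k (?T ` F) \<and>
    ennreal (l ^ k) * hausdorff_measure k (?T ` F) \<le> ennreal s * hausdorff_measure k F" if l: "0 < l" "l < 1" for l
  proof -
    obtain M :: "('n \<Rightarrow> int) set" and L U :: "('n \<Rightarrow> int) \<Rightarrow> real^'n" where M: "finite M"
      and LU: "\<And>m i. m \<in> M \<Longrightarrow> i \<noteq> a \<Longrightarrow> L m $ i < U m $ i"
      and sub: "\<And>m. m \<in> M \<Longrightarrow> cbox (L m) (U m) \<subseteq> F"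
      and disj: "pairwise (\<lambda>m m'. rel_interior (cbox (L m) (U m)) \<inter> rel_interior (cbox (L m') (U m')) = {}) M"
      and cover: "(\<lambda>x. x - (1 - l) *\<^sub>R (x - z)) ` F \<subseteq> (\<Union>m\<in>M. cbox (L m) (U m))"
      using grid_cubes_in_convex[OF F r z l] by blast
    let ?C = "\<lambda>m. cbox (L m) (U m)"
    have inj: "inj ?T" using s by (intro inj_coord_stretch) simp
    have sum_T: "(\<Sum>m\<in>M. hausdorff_measure k (?T ` ?C m)) = ennreal s * (\<Sum>m\<in>M. hausdorff_measure k (?C m))"
      unfolding sum_distrib_left using LU ab by (intro sum.cong hausdorff_measure_coord_stretch_cbox s) auto
    have "hausdorff_measure k (\<Union>m\<in>M. ?C m) = (\<Sum>m\<in>M. hausdorff_measure k (?C m))"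
      by (intro hausdorff_measure_UN_convex M disj) auto
    moreover have "hausdorff_measure k (\<Union>m\<in>M. ?T ` ?C m) = (\<Sum>m\<in>M. hausdorff_measure k (?T ` ?C m))"
    proof (intro hausdorff_measure_UN_convex M)
      show "compact (?T ` ?C m)" for m
        by (intro compact_continuous_image linear_continuous_on linear_conv_bounded_linear[THEN iffD1]
              linear_coord_stretch compact_cbox)
      show "convex (?T ` ?C m)" for m
        by (intro convex_linear_image linear_coord_stretch) auto
      have "rel_interior (?T ` ?C m) = ?T ` rel_interior (?C m)" for m
        by (intro rel_interior_convex_linear_image[symmetric] linear_coord_stretch) auto
      then show "pairwise (\<lambda>m m'. rel_interior (?T ` ?C m) \<inter> rel_interior (?T ` ?C m') = {}) M"
        using disj by (simp add: pairwise_def image_Int[OF inj, symmetric])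
    qed
    ultimately have T_union: "hausdorff_measure k (?T ` (\<Union>m\<in>M. ?C m)) = ennreal s * hausdorff_measure k (\<Union>m\<in>M. ?C m)"
      by (simp add: sum_T image_UN)
    have "ennreal (l ^ k) * hausdorff_measure k F \<le> hausdorff_measure k (\<Union>m\<in>M. ?C m)"
      unfolding hausdorff_measure_homothety_about[OF l(1), of k z F, symmetric] by (rule hausdorff_measure_mono[OF cover])
    then have "ennreal s * (ennreal (l ^ k) * hausdorff_measure k F) \<le> hausdorff_measure k (?T ` (\<Union>m\<in>M. ?C m))"
      unfolding T_union by (rule mult_left_mono) simp
    also have "\<dots> \<le> hausdorff_measure k (?T ` F)"
      using sub by (intro hausdorff_measure_mono image_mono) auto
    finally have 1: "ennreal s * (ennreal (l ^ k) * hausdorff_measure k F) \<le> hausdorff_measure k (?T ` F)" .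
    have "ennreal (l ^ k) * hausdorff_measure k (?T ` F) = hausdorff_measure k (?T ` (\<lambda>x. x - (1 - l) *\<^sub>R (x - z)) ` F)"
      unfolding hausdorff_measure_homothety_about[OF l(1), of k "?T z" "?T ` F", symmetric]
      by (simp add: image_image coord_stretch_homothety)
    also have "\<dots> \<le> hausdorff_measure k (?T ` (\<Union>m\<in>M. ?C m))"
      by (intro hausdorff_measure_mono image_mono cover)
    also have "\<dots> \<le> ennreal s * hausdorff_measure k F"
      unfolding T_union using sub by (intro mult_left_mono hausdorff_measure_mono) auto
    finally show ?thesis using 1 by (simp add: mult.left_commute)
  qed
  note le = this
  show ?thesis
  proof (rule antisym)
    show "hausdorff_measure k (?T ` F) \<le> ennreal s * hausdorff_measure k F"
      by (rule ennreal_le_if_scaled_le) (rule le[THEN conjunct2])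
    show "ennreal s * hausdorff_measure k F \<le> hausdorff_measure k (?T ` F)"
      by (rule ennreal_le_if_scaled_le) (rule le[THEN conjunct1])
  qed
qed


section \<open>From coordinate axes to arbitrary directions\<close>

text \<open>Householder reflection along \<open>v - w\<close>; for \<open>v = w\<close> the formula
  gives the identity. The fixed points in the last conclusion let a second reflection keep what a
  first one has achieved.\<close>

lemma reflection_exists:
  fixes v w :: "'a::euclidean_space"
  assumes "norm v = norm w"
  obtains f where "orthogonal_transformation f" "f v = w" "\<And>y. y \<bullet> v = y \<bullet> w \<Longrightarrow> f y = y"
proof
  define p where "p = v - w"
  let ?f = "\<lambda>y. y - (2 * (p \<bullet> y) / (p \<bullet> p)) *\<^sub>R p"
  have vw: "v \<bullet> v = w \<bullet> w" using assms by (simp add: norm_eq)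
  have "linear ?f"
    by (rule linearI) (simp_all add: algebra_simps add_divide_distrib)
  moreover have "?f x \<bullet> ?f y = x \<bullet> y" for x y
  proof (cases "p = 0")
    case False
    have "E - 2 * Y / P * X - (2 * X / P * Y - 2 * X / P * (2 * Y / P * P)) = E" if "P \<noteq> 0" for E P X Y :: real
      using that by simp
    from this[of "p \<bullet> p" "x \<bullet> y" "p \<bullet> y" "p \<bullet> x"] False show ?thesis
      unfolding inner_diff_left inner_diff_right inner_scaleR_left inner_scaleR_right
      by (simp add: inner_commute[of x p])
  qed simp
  ultimately show "orthogonal_transformation ?f" by (simp add: orthogonal_transformation_def)
  show "?f v = w"
  proof (cases "p = 0")
    case False
    have "p \<bullet> p = 2 * (p \<bullet> v)"
      using vw by (simp add: p_def inner_diff_left inner_diff_right inner_commute)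
    then have "2 * (p \<bullet> v) / (p \<bullet> p) = 1" using False by (metis divide_self inner_eq_zero_iff)
    then have "?f v = v - p" by (simp only: scaleR_one)
    then show ?thesis by (simp add: p_def)
  qed (simp add: p_def)
  show "?f y = y" if "y \<bullet> v = y \<bullet> w" for y
  proof -
    have "p \<bullet> y = 0" using that by (simp add: p_def inner_diff_right inner_commute[of _ y])
    then show ?thesis by simp
  qed
qed

lemma orthogonal_pair_to_axes:
  fixes u e :: "real^'n" and a b :: 'n
  assumes "norm u = 1" "norm e = 1" "u \<bullet> e = 0" "a \<noteq> b"
  obtains f :: "real^'n \<Rightarrow> real^'n" where "orthogonal_transformation f" "f u = axis a 1" "f e = axis b 1"
proof -
  obtain g :: "real^'n \<Rightarrow> real^'n" where g: "orthogonal_transformation g" "g u = axis a 1"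
    using reflection_exists[of u "axis a 1"] assms norm_axis_1 by metis
  have "g u \<bullet> g e = u \<bullet> e" using g(1) unfolding orthogonal_transformation_def by blast
  then have ge: "norm (g e) = 1" "g u \<bullet> g e = 0"
    using g(1) assms by (simp_all add: orthogonal_transformation_norm)
  obtain h :: "real^'n \<Rightarrow> real^'n" where h: "orthogonal_transformation h" "h (g e) = axis b 1"
      "\<And>y. y \<bullet> g e = y \<bullet> axis b 1 \<Longrightarrow> h y = y"
    using reflection_exists[of "g e" "axis b 1"] ge norm_axis_1 by metis
  \<comment> \<open>\<open>axis a 1\<close> is orthogonal to \<open>g e\<close> and to
    \<open>axis b 1\<close>, so \<open>h\<close> fixes it.\<close>
  have "h (axis a 1) = axis a 1"
    using ge g assms by (intro h(3)) (simp add: inner_axis_axis)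
  then show thesis
    using that[of "h \<circ> g"] orthogonal_transformation_compose[OF h(1) g(1)] g h by simp
qed

lemma dist_orthogonal_transformation:
  "orthogonal_transformation f \<Longrightarrow> dist (f x) (f y) = dist x y"
  by (metis dist_norm linear_diff orthogonal_transformation_linear orthogonal_transformation_norm)

text \<open>An orthogonal map taking \<open>u\<close> and \<open>e\<close> to two coordinate axes
  turns this into \<open>coord_stretch\<close>; \<open>d\<close> provides two distinct axes.\<close>

lemma hausdorff_measure_stretch:
  fixes F :: "(real^'n) set"
  assumes F: "compact F" "convex F" "F \<subseteq> {y. u \<bullet> y = c}" and r: "r > 0" "ball z r \<inter> {y. u \<bullet> y = c} \<subseteq> F"
    and z: "z \<in> F" and s: "s > 0" and ue: "norm u = 1" "norm e = 1" "u \<bullet> e = 0" and d: "CARD('n) \<ge> 2"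
  shows "hausdorff_measure k ((\<lambda>y. y + ((s - 1) * (e \<bullet> y)) *\<^sub>R e) ` F) = ennreal s * hausdorff_measure k F"
proof -
  obtain a b :: 'n where ab: "a \<noteq> b"
    using d card_le_Suc0_iff_eq[of "UNIV :: 'n set"] by auto
  obtain f :: "real^'n \<Rightarrow> real^'n" where f: "orthogonal_transformation f" "f u = axis a 1" "f e = axis b 1"
    using orthogonal_pair_to_axes[OF ue ab] by blast
  have lin: "linear f" using f(1) by (rule orthogonal_transformation_linear)
  have inner: "f x \<bullet> f y = x \<bullet> y" for x y using f(1) by (simp add: orthogonal_transformation_def)
  have fa: "f y $ a = u \<bullet> y" for y using inner[of u y] f(2) by (simp add: inner_axis')
  have fb: "f y $ b = e \<bullet> y" for y using inner[of e y] f(3) by (simp add: inner_axis')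
  let ?T = "\<lambda>y. y + ((s - 1) * (e \<bullet> y)) *\<^sub>R e"
  have fT: "f (?T y) = coord_stretch b s (f y)" for y
  proof -
    have "f (?T y) = f y + ((s - 1) * (e \<bullet> y)) *\<^sub>R axis b 1"
      by (simp only: linear_add[OF lin] linear_scale[OF lin] f(3))
    also have "\<dots> = coord_stretch b s (f y)"
      by (simp add: vec_eq_iff coord_stretch_nth fb axis_def algebra_simps)
    finally show ?thesis .
  qed
  have "hausdorff_measure k (?T ` F) = hausdorff_measure k (f ` ?T ` F)"
    by (rule hausdorff_measure_isometry[symmetric]) (rule dist_orthogonal_transformation[OF f(1)])
  also have "f ` ?T ` F = coord_stretch b s ` f ` F"
    by (simp add: image_image fT)
  also have "hausdorff_measure k \<dots> = ennreal s * hausdorff_measure k (f ` F)"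
  proof (rule hausdorff_measure_coord_stretch[where a = a and c = c and z = "f z" and r = r])
    show "compact (f ` F)"
      using F(1) lin by (intro compact_continuous_image linear_continuous_on linear_conv_bounded_linear[THEN iffD1])
    show "convex (f ` F)" using F(2) lin by (intro convex_linear_image)
    show "f ` F \<subseteq> {y. y $ a = c}" using F(3) by (auto simp: fa)
    show "ball (f z) r \<inter> {y. y $ a = c} \<subseteq> f ` F"
    proof
      fix y assume y: "y \<in> ball (f z) r \<inter> {y. y $ a = c}"
      obtain x where x: "y = f x" using orthogonal_transformation_surj[OF f(1)] by (metis surjD)
      then have "x \<in> F" using y r(2) by (auto simp: fa dist_orthogonal_transformation[OF f(1)])
      then show "y \<in> f ` F" using x by blast
    qed
  qed (use z s r ab in auto)
  also have "hausdorff_measure k (f ` F) = hausdorff_measure k F"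
    by (rule hausdorff_measure_isometry) (rule dist_orthogonal_transformation[OF f(1)])
  finally show ?thesis .
qed

lemma linear_proj_hyperplane: "linear (proj_hyperplane x)"
  by (rule linearI) (simp_all add: proj_hyperplane_def algebra_simps add_divide_distrib)

lemma norm_proj_hyperplane:
  assumes "norm x = 1"
  shows "(norm (proj_hyperplane x y))\<^sup>2 = (norm y)\<^sup>2 - (x \<bullet> y)\<^sup>2"
proof -
  have "x \<bullet> x = 1" using assms by (simp add: dot_square_norm)
  then show ?thesis
    unfolding power2_norm_eq_inner proj_hyperplane_def inner_diff_left inner_diff_right
    by (simp only: inner_scaleR_left inner_scaleR_right inner_commute[of y x]) (simp add: power2_eq_square)
qed

text \<open>The component \<open>w\<close> of \<open>x\<close> orthogonal to \<open>u\<close> is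
  parallel to the hyperplane. On \<open>F\<close> the projection shortens exactly the direction of
  \<open>w\<close>, by the factor \<open>\<bar>x \<bullet> u\<bar>\<close>. It produces the same
  distances as the stretch \<open>?T\<close> inside the hyperplane, hence an image of the same
  measure.\<close>

lemma hausdorff_measure_proj_hyperplane:
  fixes F :: "(real^'n) set"
  assumes F: "compact F" "convex F" "F \<subseteq> {y. u \<bullet> y = c}" and r: "r > 0" "ball z r \<inter> {y. u \<bullet> y = c} \<subseteq> F"
    and z: "z \<in> F" and ux: "norm u = 1" "norm x = 1" "x \<bullet> u \<noteq> 0" and d: "CARD('n) \<ge> 2"
  shows "hausdorff_measure k (proj_hyperplane x ` F) = ennreal \<bar>x \<bullet> u\<bar> * hausdorff_measure k F"
proof -
  define \<tau> where "\<tau> = x \<bullet> u"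
  define w where "w = x - \<tau> *\<^sub>R u"
  have xx: "x \<bullet> x = 1" "u \<bullet> u = 1" using ux by (simp_all add: dot_square_norm)
  have uw: "u \<bullet> w = 0" by (simp add: w_def \<tau>_def inner_diff_right xx inner_commute)
  have ww: "(norm w)\<^sup>2 = 1 - \<tau>\<^sup>2"
    unfolding power2_norm_eq_inner w_def inner_diff_left inner_diff_right
    by (simp only: inner_scaleR_left inner_scaleR_right inner_commute[of u x] xx \<tau>_def[symmetric]) (simp add: power2_eq_square)
  have xv: "x \<bullet> (y - y') = w \<bullet> (y - y')" if "y \<in> F" "y' \<in> F" for y y'
  proof -
    have "u \<bullet> (y - y') = 0" using F(3) that by (auto simp: inner_diff_right)
    then show ?thesis by (simp add: w_def inner_diff_left)
  qed
  have dist_proj: "(dist (proj_hyperplane x y) (proj_hyperplane x y'))\<^sup>2 = (norm (y - y'))\<^sup>2 - (x \<bullet> (y - y'))\<^sup>2" for y y'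
    by (simp add: dist_norm linear_diff[OF linear_proj_hyperplane, symmetric] norm_proj_hyperplane ux)
  show ?thesis
  \<comment> \<open>\<open>w = 0\<close> means that \<open>x\<close> is \<open>u\<close> or
    \<open>- u\<close>; then there is no direction \<open>e\<close>, and the projection is an
    isometry on \<open>F\<close>.\<close>
  proof (cases "w = 0")
    case True
    then have "dist (proj_hyperplane x y) (proj_hyperplane x y') = dist y y'" if "y \<in> F" "y' \<in> F" for y y'
      using dist_proj[of y y'] xv[OF that] by (simp add: dist_norm)
    moreover have "\<bar>\<tau>\<bar> = 1" using ww True by (auto simp: power2_eq_1_iff)
    ultimately show ?thesis
      using hausdorff_measure_isometry[of F "proj_hyperplane x" k] by (simp add: \<tau>_def)
  next
    case False
    define e where "e = (1 / norm w) *\<^sub>R w"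
    have e: "norm e = 1" "u \<bullet> e = 0" "w = norm w *\<^sub>R e"
      using False uw by (simp_all add: e_def)
    have ee: "e \<bullet> e = 1" using e(1) by (simp add: dot_square_norm)
    let ?T = "\<lambda>y. y + ((\<bar>\<tau>\<bar> - 1) * (e \<bullet> y)) *\<^sub>R e"
    have "dist (proj_hyperplane x y) (proj_hyperplane x y') = dist (?T y) (?T y')" if yy: "y \<in> F" "y' \<in> F" for y y'
    proof -
      let ?v = "y - y'" and ?t = "(\<bar>\<tau>\<bar> - 1) * (e \<bullet> (y - y'))"
      have "x \<bullet> ?v = norm w * (e \<bullet> ?v)"
        using xv[OF yy] e(3) by (metis inner_scaleR_left)
      then have "(x \<bullet> ?v)\<^sup>2 = (1 - \<tau>\<^sup>2) * (e \<bullet> ?v)\<^sup>2" using ww by (simp add: power_mult_distrib)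
      moreover have "?T y - ?T y' = ?v + ?t *\<^sub>R e" by (simp add: algebra_simps)
      then have "(dist (?T y) (?T y'))\<^sup>2 = (norm (?v + ?t *\<^sub>R e))\<^sup>2" by (simp only: dist_norm)
      moreover have "(norm (?v + ?t *\<^sub>R e))\<^sup>2 = (norm ?v)\<^sup>2 + 2 * ?t * (e \<bullet> ?v) + ?t\<^sup>2"
        unfolding power2_norm_eq_inner inner_add_left inner_add_right
        by (simp add: ee inner_commute[of ?v e] power2_eq_square del: inner_diff_right inner_diff_left)
      \<comment> \<open>Both maps lower the squared length by \<open>1 - \<tau>\<^sup>2\<close>
        times the squared \<open>e\<close>-component.\<close>
      moreover have "2 * ?t * (e \<bullet> ?v) + ?t\<^sup>2 = - (1 - \<tau>\<^sup>2) * (e \<bullet> ?v)\<^sup>2"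
      proof -
        have "2 * ((T - 1) * E) * E + ((T - 1) * E)\<^sup>2 = - (1 - T\<^sup>2) * E\<^sup>2" for T E :: real
          by (simp add: power2_eq_square algebra_simps)
        from this[of "\<bar>\<tau>\<bar>" "e \<bullet> ?v"] show ?thesis by simp
      qed
      ultimately have "(dist (proj_hyperplane x y) (proj_hyperplane x y'))\<^sup>2 = (dist (?T y) (?T y'))\<^sup>2"
        using dist_proj[of y y'] by (simp only:)
      then show ?thesis by simp
    qed
    then have "hausdorff_measure k (proj_hyperplane x ` F) = hausdorff_measure k (?T ` F)"
      by (rule hausdorff_measure_image_cong)
    also have "\<dots> = ennreal \<bar>\<tau>\<bar> * hausdorff_measure k F"
      using ux by (intro hausdorff_measure_stretch[OF F r z _ ux(1) e(1,2) d]) (simp add: \<tau>_def)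
    finally show ?thesis by (simp add: \<tau>_def)
  qed
qed

section \<open>Polytopes and monotonicity of the surface area\<close>

lemma dist_le_if_obtuse:
  fixes p y z :: "'a::real_inner"
  assumes "(p - y) \<bullet> (z - y) \<le> 0"
  shows "dist p y \<le> dist p z"
proof -
  have "(norm (p - z))\<^sup>2 = (norm (p - y))\<^sup>2 - 2 * ((p - y) \<bullet> (z - y)) + (norm (z - y))\<^sup>2"
    unfolding power2_norm_eq_inner by (simp add: algebra_simps inner_commute)
  then have "(norm (p - y))\<^sup>2 \<le> (norm (p - z))\<^sup>2"
    using assms zero_le_power2[of "norm (z - y)"] by linarith
  then show ?thesis by (simp add: dist_norm abs_le_square_iff[symmetric])
qed

text \<open>The nearest-point map of \<open>K\<close> is a contraction that maps the boundary of a larger convex body onto that of \<open>K\<close>.\<close>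
lemma hausdorff_measure_frontier_mono:
  fixes K L :: "'a::euclidean_space set"
  assumes K: "compact K" "convex K" "interior K \<noteq> {}" and L: "compact L" and sub: "K \<subseteq> L"
  shows "hausdorff_measure k (frontier K) \<le> hausdorff_measure k (frontier L)"
proof -
  have ne: "K \<noteq> {}" using K(3) by auto
  have closed: "closed K" using K(1) by (rule compact_imp_closed)
  have "frontier K \<subseteq> closest_point K ` frontier L"
  proof
    fix y assume y: "y \<in> frontier K"
    then have yK: "y \<in> K" using closed frontier_subset_closed by blast
    show "y \<in> closest_point K ` frontier L"
    proof (cases "y \<in> interior L")
      case False
      then have "y \<in> frontier L" using yK sub closure_subset by (auto simp: frontier_def)
      moreover have "closest_point K y = y" using yK by (rule closest_point_self)
      ultimately show ?thesis by (metis image_eqI)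
    next
      case True
      obtain a where a: "a \<noteq> 0" "\<And>x. x \<in> K \<Longrightarrow> a \<bullet> y \<le> a \<bullet> x"
        using supporting_hyperplane_rel_boundary[OF K(2) yK] y rel_interior_nonempty_interior[OF K(3)]
        by (metis frontier_def DiffD2)
      \<comment> \<open>\<open>- a\<close> is an outer normal of \<open>K\<close> at
        \<open>y\<close>, so all points of this ray have \<open>y\<close> as nearest point in
        \<open>K\<close>; the ray leaves \<open>L\<close> because \<open>L\<close> is
        bounded.\<close>
      obtain d where d: "d > 0" "y + d *\<^sub>R (- a) \<in> frontier L"
        using ray_to_frontier[OF compact_imp_bounded[OF L] True, of "- a"] a(1)
        by (metis neg_equal_0_iff_equal)
      have "closest_point K (y + d *\<^sub>R (- a)) = y"
      proof (rule closest_point_unique[OF K(2) closed yK, symmetric])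
        show "\<forall>x\<in>K. dist (y + d *\<^sub>R (- a)) y \<le> dist (y + d *\<^sub>R (- a)) x"
          using a(2) d(1) by (intro ballI dist_le_if_obtuse) (simp add: inner_diff_right mult_left_mono)
      qed
      then show ?thesis using d(2) by (metis image_eqI)
    qed
  qed
  then have "hausdorff_measure k (frontier K) \<le> hausdorff_measure k (closest_point K ` frontier L)"
    by (rule hausdorff_measure_mono)
  also have "\<dots> \<le> ennreal (1 ^ k) * hausdorff_measure k (frontier L)"
    using closest_point_lipschitz[OF K(2) closed ne] by (intro hausdorff_measure_lipschitz_le) auto
  finally show ?thesis by simp
qed

section \<open>Polytopes as irredundant intersections of half-spaces\<close>

definition halfspaces :: "('a::euclidean_space \<times> real) set \<Rightarrow> 'a set" where
  "halfspaces I = {y. \<forall>i\<in>I. fst i \<bullet> y \<le> snd i}"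

lemma halfspaces_eq_INT: "halfspaces I = (\<Inter>i\<in>I. {y. fst i \<bullet> y \<le> snd i})"
  by (auto simp: halfspaces_def)

lemma closed_halfspaces: "closed (halfspaces I)"
  unfolding halfspaces_eq_INT by (intro closed_INT ballI closed_halfspace_le)

lemma convex_halfspaces: "convex (halfspaces I)"
  unfolding halfspaces_eq_INT by (intro convex_INT ballI convex_halfspace_le)

lemma open_strict_halfspaces: "finite I \<Longrightarrow> open {y. \<forall>i\<in>I. fst i \<bullet> y < snd i}"
proof -
  assume "finite I"
  moreover have "{y. \<forall>i\<in>I. fst i \<bullet> y < snd i} = (\<Inter>i\<in>I. {y. fst i \<bullet> y < snd i})" by auto
  ultimately show ?thesis by (auto intro!: open_INT open_halfspace_lt)
qed

text \<open>Irredundancy gives every constraint a face with interior points relative to its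
  hyperplane, as the projection formula for facets demands, and makes facets of different
  constraints almost disjoint. The point \<open>p\<close> strictly inside is the base point for both
  arguments.\<close>

locale irredundant_polytope =
  fixes I :: "((real^'n) \<times> real) set" and p :: "real^'n"
  assumes finite: "finite I"
    and norm_1: "i \<in> I \<Longrightarrow> norm (fst i) = 1"
    and inner_point: "i \<in> I \<Longrightarrow> fst i \<bullet> p < snd i"
    and bounded: "bounded (halfspaces I)"
    and irredundant: "i \<in> I \<Longrightarrow> halfspaces (I - {i}) \<noteq> halfspaces I"
begin

definition facet :: "(real^'n) \<times> real \<Rightarrow> (real^'n) set" where
  "facet i = halfspaces I \<inter> {y. fst i \<bullet> y = snd i}"

lemma compact_facet: "compact (facet i)"
  unfolding facet_def using bounded
  by (simp add: compact_eq_bounded_closed bounded_Int closed_Int closed_halfspaces closed_hyperplane)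

lemma convex_facet: "convex (facet i)"
  unfolding facet_def by (intro convex_Int convex_halfspaces convex_hyperplane)

lemma facet_le: "y \<in> facet i \<Longrightarrow> j \<in> I \<Longrightarrow> fst j \<bullet> y \<le> snd j"
  by (simp add: facet_def halfspaces_def)

lemma facet_eq: "y \<in> facet i \<Longrightarrow> fst i \<bullet> y = snd i"
  by (simp add: facet_def)

text \<open>Without constraint \<open>i\<close> some \<open>y\<close> beyond its hyperplane becomes
  admissible. The segment from \<open>p\<close> to \<open>y\<close> crosses that hyperplane in
  \<open>z\<close>, where the other constraints are strict because they are strict at
  \<open>p\<close> and \<open>t < 1\<close>.\<close>

lemma facet_strict_point:
  assumes i: "i \<in> I"
  obtains z where "z \<in> facet i" "\<And>j. j \<in> I \<Longrightarrow> j \<noteq> i \<Longrightarrow> fst j \<bullet> z < snd j"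
proof -
  have "halfspaces I \<subseteq> halfspaces (I - {i})" by (auto simp: halfspaces_def)
  then obtain y where y: "y \<in> halfspaces (I - {i})" "y \<notin> halfspaces I"
    using irredundant[OF i] by blast
  then obtain j where j: "j \<in> I" "\<not> fst j \<bullet> y \<le> snd j"
    unfolding halfspaces_def by blast
  moreover have "fst j \<bullet> y \<le> snd j" if "j \<in> I - {i}" for j
    using y(1) that by (simp add: halfspaces_def)
  ultimately have "j = i" by blast
  then have yi: "fst i \<bullet> y > snd i" using j(2) by simp
  define t where "t = (snd i - fst i \<bullet> p) / (fst i \<bullet> y - fst i \<bullet> p)"
  have t: "0 < t" "t < 1" "t * (fst i \<bullet> y - fst i \<bullet> p) = snd i - fst i \<bullet> p"
    using yi inner_point[OF i] by (simp_all add: t_def divide_less_eq)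
  define z where "z = (1 - t) *\<^sub>R p + t *\<^sub>R y"
  have zi: "fst i \<bullet> z = snd i"
    using t(3) by (simp add: z_def inner_add_right algebra_simps)
  have strict: "fst j \<bullet> z < snd j" if "j \<in> I" "j \<noteq> i" for j
  proof -
    have "(1 - t) * (fst j \<bullet> p) < (1 - t) * snd j" using inner_point[OF that(1)] t by simp
    moreover have "t * (fst j \<bullet> y) \<le> t * snd j" using y(1) that t by (simp add: halfspaces_def)
    ultimately show ?thesis by (simp add: z_def inner_add_right algebra_simps)
  qed
  have "fst j \<bullet> z \<le> snd j" if "j \<in> I" for j
    using zi strict[OF that] by (cases "j = i") (simp_all add: less_imp_le)
  then have "z \<in> facet i" unfolding facet_def halfspaces_def using zi by simp
  then show thesis using strict by (rule that)
qed

lemma facet_relative_ball: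
  assumes i: "i \<in> I"
  obtains z r where "z \<in> facet i" "r > 0" "ball z r \<inter> {y. fst i \<bullet> y = snd i} \<subseteq> facet i"
proof -
  obtain z where z: "z \<in> facet i" "\<And>j. j \<in> I \<Longrightarrow> j \<noteq> i \<Longrightarrow> fst j \<bullet> z < snd j"
    using facet_strict_point[OF i] by blast
  have "open {y. \<forall>j\<in>I - {i}. fst j \<bullet> y < snd j}" using finite by (intro open_strict_halfspaces) simp
  moreover have "z \<in> {y. \<forall>j\<in>I - {i}. fst j \<bullet> y < snd j}" using z by simp
  ultimately obtain r where r: "r > 0" "ball z r \<subseteq> {y. \<forall>j\<in>I - {i}. fst j \<bullet> y < snd j}"
    by (meson openE)
  have "ball z r \<inter> {y. fst i \<bullet> y = snd i} \<subseteq> facet i"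
  proof
    fix y assume y: "y \<in> ball z r \<inter> {y. fst i \<bullet> y = snd i}"
    then have "y \<in> {y. \<forall>j\<in>I - {i}. fst j \<bullet> y < snd j}" using r(2) by blast
    then have "fst j \<bullet> y \<le> snd j" if "j \<in> I" for j
      using y that by (cases "j = i") (simp_all add: less_imp_le)
    then show "y \<in> facet i" using y by (simp add: facet_def halfspaces_def)
  qed
  then show thesis using that z r by blast
qed

text \<open>The hyperplane of \<open>j\<close> separates the two: it contains
  \<open>facet j\<close>, and a point of \<open>facet i\<close> lies strictly below it.\<close>

lemma rel_interior_facets_disjoint:
  assumes "i \<in> I" "j \<in> I" "i \<noteq> j"
  shows "rel_interior (facet i) \<inter> rel_interior (facet j) = {}"
proof -
  obtain z where z: "z \<in> facet i" "\<And>j. j \<in> I \<Longrightarrow> j \<noteq> i \<Longrightarrow> fst j \<bullet> z < snd j"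
    using facet_strict_point[OF assms(1)] by blast
  show ?thesis
    using assms z by (intro rel_interior_disjoint_if_separated[where a = "fst j" and b = "snd j" and z = z])
      (auto simp: convex_facet facet_le facet_eq)
qed

lemma frontier_eq_facets: "frontier (halfspaces I) = (\<Union>i\<in>I. facet i)"
proof (intro subset_antisym subsetI)
  fix y assume "y \<in> frontier (halfspaces I)"
  then have y: "y \<in> halfspaces I" "y \<notin> interior (halfspaces I)"
    using closure_closed[OF closed_halfspaces[of I]] by (auto simp: frontier_def)
  have "{y. \<forall>i\<in>I. fst i \<bullet> y < snd i} \<subseteq> interior (halfspaces I)"
    using finite by (intro interior_maximal open_strict_halfspaces) (auto simp: halfspaces_def less_imp_le)
  then obtain i where "i \<in> I" "\<not> fst i \<bullet> y < snd i" using y(2) by blast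
  then show "y \<in> (\<Union>i\<in>I. facet i)" using y(1) by (force simp: facet_def halfspaces_def)
next
  fix y assume "y \<in> (\<Union>i\<in>I. facet i)"
  then obtain i where i: "i \<in> I" "y \<in> facet i" by auto
  have "y \<notin> interior (halfspaces I)"
  proof
    assume "y \<in> interior (halfspaces I)"
    then obtain e where e: "e > 0" "cball y e \<subseteq> halfspaces I" by (meson mem_interior_cball)
    have "y + e *\<^sub>R fst i \<in> cball y e" using e norm_1[OF i(1)] by (simp add: dist_norm)
    then have "fst i \<bullet> (y + e *\<^sub>R fst i) \<le> snd i" using e i(1) by (auto simp: halfspaces_def)
    then show False using facet_eq[OF i(2)] norm_1[OF i(1)] e(1) by (simp add: inner_add_right dot_square_norm)
  qed
  then show "y \<in> frontier (halfspaces I)"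
    using i closure_closed[OF closed_halfspaces[of I]] by (simp add: frontier_def facet_def)
qed

lemma hausdorff_measure_frontier:
  "hausdorff_measure k (frontier (halfspaces I)) = (\<Sum>i\<in>I. hausdorff_measure k (facet i))"
  unfolding frontier_eq_facets
  by (intro hausdorff_measure_UN_convex finite compact_facet convex_facet pairwiseI rel_interior_facets_disjoint)

text \<open>Sliding a point in direction \<open>x\<close> keeps its projection. The slide ends at
  the first constraint that becomes tight, and only constraints with
  \<open>x \<bullet> fst i > 0\<close> can stop it; \<open>q i\<close> is the time at which
  constraint \<open>i\<close> does.\<close>

lemma proj_eq_union_facets:
  assumes x: "norm x = 1"
  shows "proj_hyperplane x ` halfspaces I = (\<Union>i\<in>{i \<in> I. x \<bullet> fst i > 0}. proj_hyperplane x ` facet i)"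
proof (intro subset_antisym subsetI)
  let ?J = "{i \<in> I. x \<bullet> fst i > 0}"
  fix w assume "w \<in> proj_hyperplane x ` halfspaces I"
  then obtain y where y: "y \<in> halfspaces I" "w = proj_hyperplane x y" by auto
  have "x \<bullet> x = 1" using x by (simp add: dot_square_norm)
  then have proj: "proj_hyperplane x (y + t *\<^sub>R x) = w" for t
    using y(2) by (simp add: proj_hyperplane_def inner_add_right algebra_simps)
  \<comment> \<open>With no such constraint the polytope would contain a ray, whose point at time
    \<open>2 * R + 1\<close> contradicts the bound \<open>R\<close>.\<close>
  have "?J \<noteq> {}"
  proof
    assume J: "?J = {}"
    have ray: "y + t *\<^sub>R x \<in> halfspaces I" if "t \<ge> 0" for t
      unfolding halfspaces_def
    proof (intro CollectI ballI)
      fix i assume i: "i \<in> I"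
      then have "x \<bullet> fst i \<le> 0" using J by (metis (mono_tags, lifting) empty_iff mem_Collect_eq not_less)
      then have "t * (x \<bullet> fst i) \<le> 0" using that by (intro mult_nonneg_nonpos)
      then show "fst i \<bullet> (y + t *\<^sub>R x) \<le> snd i"
        using y(1) i by (auto simp: halfspaces_def inner_add_right inner_commute[of "fst i" x] dest!: bspec)
    qed
    obtain R where R: "\<And>v. v \<in> halfspaces I \<Longrightarrow> norm v \<le> R"
      using bounded by (auto simp: bounded_iff)
    have "R \<ge> 0" using R[OF y(1)] norm_ge_zero order_trans by blast
    then have "norm (y + (2 * R + 1) *\<^sub>R x) \<le> R" by (intro R ray) simp
    moreover have "norm ((2 * R + 1) *\<^sub>R x) \<le> norm (y + (2 * R + 1) *\<^sub>R x) + norm y"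
      using norm_triangle_ineq4[of "y + (2 * R + 1) *\<^sub>R x" y] by simp
    ultimately show False using R[OF y(1)] \<open>R \<ge> 0\<close> x by simp
  qed
  define q where "q i = (snd i - fst i \<bullet> y) / (x \<bullet> fst i)" for i
  define t where "t = Min (q ` ?J)"
  have finJ: "finite (q ` ?J)" "q ` ?J \<noteq> {}" using finite \<open>?J \<noteq> {}\<close> by auto
  obtain i where i: "i \<in> ?J" "t = q i" using Min_in[OF finJ] by (auto simp: t_def)
  have t0: "t \<ge> 0"
    unfolding i(2) q_def using y(1) i by (auto simp: halfspaces_def intro!: divide_nonneg_nonneg)
  have "y + t *\<^sub>R x \<in> halfspaces I"
    unfolding halfspaces_def
  proof (intro CollectI ballI)
    fix j assume j: "j \<in> I"
    have yj: "fst j \<bullet> y \<le> snd j" using y(1) j by (simp add: halfspaces_def)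
    show "fst j \<bullet> (y + t *\<^sub>R x) \<le> snd j"
    proof (cases "x \<bullet> fst j > 0")
      case True
      then have "t \<le> q j" unfolding t_def using finJ j by (intro Min_le) auto
      then have "t * (x \<bullet> fst j) \<le> snd j - fst j \<bullet> y" using True by (simp add: q_def pos_le_divide_eq)
      then show ?thesis by (simp add: inner_add_right inner_commute[of "fst j" x])
    next
      case False
      then have "t * (x \<bullet> fst j) \<le> 0" using t0 by (intro mult_nonneg_nonpos) auto
      then show ?thesis using yj by (simp add: inner_add_right inner_commute[of "fst j" x])
    qed
  qed
  moreover have "fst i \<bullet> (y + t *\<^sub>R x) = snd i"
    using i by (simp add: q_def inner_add_right inner_commute[of "fst i" x])
  ultimately have "y + t *\<^sub>R x \<in> facet i" by (simp add: facet_def)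
  then have "w \<in> proj_hyperplane x ` facet i" using proj[of t] by (metis image_eqI)
  then show "w \<in> (\<Union>i\<in>?J. proj_hyperplane x ` facet i)" using i(1) by blast
qed (auto simp: facet_def)

text \<open>Points with equal projection differ by \<open>s *\<^sub>R x\<close>. Each of them
  satisfies the constraint that is tight at the other, which forces \<open>s \<le> 0\<close> and
  \<open>s \<ge> 0\<close>. So they coincide, and the facets themselves would overlap.\<close>

lemma rel_interior_proj_facets_disjoint:
  assumes x: "norm x = 1" and ij: "i \<in> I" "j \<in> I" "i \<noteq> j" "x \<bullet> fst i > 0" "x \<bullet> fst j > 0"
  shows "rel_interior (proj_hyperplane x ` facet i) \<inter> rel_interior (proj_hyperplane x ` facet j) = {}"
proof (rule ccontr)
  have ri: "rel_interior (proj_hyperplane x ` facet i) = proj_hyperplane x ` rel_interior (facet i)" for i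
    by (rule rel_interior_convex_linear_image[symmetric]) (auto simp: linear_proj_hyperplane convex_facet)
  assume "\<not> ?thesis"
  then obtain y y' where y: "y \<in> rel_interior (facet i)" "y' \<in> rel_interior (facet j)"
      and eq: "proj_hyperplane x y = proj_hyperplane x y'"
    unfolding ri by auto
  then have yF: "y \<in> facet i" "y' \<in> facet j" using rel_interior_subset by blast+
  define s where "s = (x \<bullet> y' - x \<bullet> y) / (x \<bullet> x)"
  have y': "y' = y + s *\<^sub>R x"
    using eq by (simp add: proj_hyperplane_def s_def diff_divide_distrib scaleR_diff_left algebra_simps)
  have "s * (x \<bullet> fst i) \<le> 0"
    using facet_le[OF yF(2) ij(1)] facet_eq[OF yF(1)] by (simp add: y' inner_add_right inner_commute[of "fst i" x])
  moreover have "s * (x \<bullet> fst j) \<ge> 0"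
    using facet_le[OF yF(1) ij(2)] facet_eq[OF yF(2)] by (simp add: y' inner_add_right inner_commute[of "fst j" x])
  ultimately have "s = 0" using ij(4,5) by (smt (verit) mult_pos_pos mult_neg_pos)
  then have "y = y'" using y' by simp
  then show False using rel_interior_facets_disjoint[OF ij(1-3)] y by auto
qed

lemma hausdorff_measure_proj_pos:
  assumes x: "norm x = 1" and d: "CARD('n) \<ge> 2"
  shows "hausdorff_measure k (proj_hyperplane x ` halfspaces I)
    = (\<Sum>i\<in>{i \<in> I. x \<bullet> fst i > 0}. ennreal \<bar>x \<bullet> fst i\<bar> * hausdorff_measure k (facet i))"
proof -
  have "hausdorff_measure k (proj_hyperplane x ` halfspaces I)
      = (\<Sum>i\<in>{i \<in> I. x \<bullet> fst i > 0}. hausdorff_measure k (proj_hyperplane x ` facet i))"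
    unfolding proj_eq_union_facets[OF x]
  proof (rule hausdorff_measure_UN_convex)
    show "compact (proj_hyperplane x ` facet i)" for i
      by (intro compact_continuous_image linear_continuous_on linear_conv_bounded_linear[THEN iffD1]
            linear_proj_hyperplane compact_facet)
    show "convex (proj_hyperplane x ` facet i)" for i
      by (intro convex_linear_image linear_proj_hyperplane convex_facet)
  qed (use finite rel_interior_proj_facets_disjoint[OF x] in \<open>auto simp: pairwise_def\<close>)
  also have "\<dots> = (\<Sum>i\<in>{i \<in> I. x \<bullet> fst i > 0}. ennreal \<bar>x \<bullet> fst i\<bar> * hausdorff_measure k (facet i))"
  proof (rule sum.cong)
    fix i assume i: "i \<in> {i \<in> I. x \<bullet> fst i > 0}"
    then obtain z r where "z \<in> facet i" "r > 0" "ball z r \<inter> {y. fst i \<bullet> y = snd i} \<subseteq> facet i"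
      using facet_relative_ball[of i] by blast
    then show "hausdorff_measure k (proj_hyperplane x ` facet i) = ennreal \<bar>x \<bullet> fst i\<bar> * hausdorff_measure k (facet i)"
      using i x d norm_1 by (intro hausdorff_measure_proj_hyperplane[where u = "fst i" and c = "snd i"])
        (auto simp: compact_facet convex_facet facet_eq)
  qed simp
  finally show ?thesis .
qed

text \<open>Every interior point of the projection is covered by exactly two facets, one on either side.\<close>
lemma hausdorff_measure_proj:
  assumes x: "norm x = 1" and d: "CARD('n) \<ge> 2"
  shows "2 * hausdorff_measure k (proj_hyperplane x ` halfspaces I)
    = (\<Sum>i\<in>I. ennreal \<bar>x \<bullet> fst i\<bar> * hausdorff_measure k (facet i))"
proof -
  let ?t = "\<lambda>i. ennreal \<bar>x \<bullet> fst i\<bar> * hausdorff_measure k (facet i)"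
  \<comment> \<open>Reversing \<open>x\<close> keeps the projection and exchanges the facets of the
    two sides.\<close>
  have neg: "proj_hyperplane (- x) = proj_hyperplane x" by (simp add: proj_hyperplane_def fun_eq_iff)
  have "hausdorff_measure k (proj_hyperplane x ` halfspaces I) = (\<Sum>i\<in>{i \<in> I. x \<bullet> fst i < 0}. ?t i)"
    using hausdorff_measure_proj_pos[of "- x" k] x d by (simp add: neg)
  then have "2 * hausdorff_measure k (proj_hyperplane x ` halfspaces I)
      = (\<Sum>i\<in>{i \<in> I. x \<bullet> fst i > 0}. ?t i) + (\<Sum>i\<in>{i \<in> I. x \<bullet> fst i < 0}. ?t i)"
    using hausdorff_measure_proj_pos[OF x d, of k] by (simp add: mult_2)
  also have "\<dots> = (\<Sum>i\<in>{i \<in> I. x \<bullet> fst i > 0} \<union> {i \<in> I. x \<bullet> fst i < 0}. ?t i)"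
    using finite by (intro sum.union_disjoint[symmetric]) auto
  \<comment> \<open>Facets parallel to \<open>x\<close> have coefficient 0.\<close>
  also have "\<dots> = (\<Sum>i\<in>I. ?t i)"
    using finite by (intro sum.mono_neutral_left) auto
  finally show ?thesis .
qed

end


section \<open>Polytopes between a convex body and a dilated copy of it\<close>

definition dilation :: "'a::real_vector \<Rightarrow> real \<Rightarrow> 'a \<Rightarrow> 'a" where
  "dilation p s y = p + s *\<^sub>R (y - p)"

lemma dilation_inverse: "s \<noteq> 0 \<Longrightarrow> dilation p s (dilation p (1 / s) y) = y"
  by (simp add: dilation_def)

lemma dist_dilation: "s > 0 \<Longrightarrow> dist (dilation p s x) (dilation p s y) = s * dist x y" for x y :: "'a::real_normed_vector"
  by (simp add: dilation_def dist_norm flip: scaleR_diff_right)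

lemma open_dilation:
  fixes S :: "'a::real_normed_vector set"
  assumes "open S" "s \<noteq> 0"
  shows "open (dilation p s ` S)"
proof -
  have "dilation p s = (\<lambda>x. (p - s *\<^sub>R p) + s *\<^sub>R x)" by (simp add: dilation_def fun_eq_iff algebra_simps)
  then show ?thesis using open_affinity[OF assms] by simp
qed

lemma compact_dilation: "compact S \<Longrightarrow> compact (dilation p s ` S)" for S :: "'a::real_normed_vector set"
  unfolding dilation_def by (intro compact_continuous_image continuous_intros)

lemma frontier_dilation_subset:
  fixes K :: "'a::euclidean_space set"
  assumes "compact K" "s > 0"
  shows "frontier (dilation p s ` K) \<subseteq> dilation p s ` frontier K"
proof
  fix y assume y: "y \<in> frontier (dilation p s ` K)"
  have "closed (dilation p s ` K)" using assms(1) by (intro compact_imp_closed compact_dilation)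
  then obtain x where x: "x \<in> K" "y = dilation p s x" using y frontier_subset_closed by blast
  have "x \<notin> interior K"
  proof
    assume "x \<in> interior K"
    then have "y \<in> dilation p s ` interior K" using x by blast
    also have "\<dots> \<subseteq> interior (dilation p s ` K)"
      using assms interior_subset by (intro interior_maximal image_mono open_dilation) auto
    finally show False using y by (simp add: frontier_def)
  qed
  then have "x \<in> frontier K" using x closure_subset by (auto simp: frontier_def)
  then show "y \<in> dilation p s ` frontier K" using x by blast
qed

text \<open>Shrinking \<open>x\<close> towards the interior point \<open>p\<close> by
  \<open>1 / s\<close> lands in the interior of \<open>K\<close>, and the dilation brings it back to
  \<open>x\<close>.\<close>

lemma convex_subset_interior_dilation:
  fixes K :: "'a::euclidean_space set"
  assumes "convex K" "p \<in> interior K" "s > 1"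
  shows "K \<subseteq> interior (dilation p s ` K)"
proof
  fix x assume x: "x \<in> K"
  have "x - (1 - 1 / s) *\<^sub>R (x - p) \<in> interior K"
    using assms by (intro mem_interior_convex_shrink x) auto
  moreover have "x - (1 - 1 / s) *\<^sub>R (x - p) = dilation p (1 / s) x"
    by (simp add: dilation_def algebra_simps)
  ultimately have "x \<in> dilation p s ` interior K"
    using dilation_inverse[of s p x] assms(3) by (metis image_eqI less_numeral_extra(1) less_trans less_irrefl)
  also have "\<dots> \<subseteq> interior (dilation p s ` K)"
    using assms interior_subset by (intro interior_maximal image_mono open_dilation) auto
  finally show "x \<in> interior (dilation p s ` K)" .
qed

text \<open>A subset of least cardinality with the same intersection admits no further
  removal.\<close>

lemma halfspaces_irredundant_subset:
  assumes "finite I0"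
  obtains I where "I \<subseteq> I0" "halfspaces I = halfspaces I0" "\<And>i. i \<in> I \<Longrightarrow> halfspaces (I - {i}) \<noteq> halfspaces I"
proof -
  obtain I where I: "I \<subseteq> I0 \<and> halfspaces I = halfspaces I0"
      and min: "\<And>J. J \<subseteq> I0 \<and> halfspaces J = halfspaces I0 \<Longrightarrow> card I \<le> card J"
    using ex_has_least_nat[of "\<lambda>I. I \<subseteq> I0 \<and> halfspaces I = halfspaces I0" I0 card] by blast
  have "halfspaces (I - {i}) \<noteq> halfspaces I" if "i \<in> I" for i
  proof
    assume "halfspaces (I - {i}) = halfspaces I"
    then have "card I \<le> card (I - {i})" using I by (intro min) auto
    moreover have "finite I" using I assms finite_subset by blast
    then have "card (I - {i}) < card I" using that by (rule card_Diff1_less)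
    ultimately show False by simp
  qed
  then show thesis using that I by blast
qed

text \<open>Every boundary point of the dilated body \<open>L\<close> is cut off from
  \<open>K\<close> by a half-space containing \<open>K\<close>; compactness of
  \<open>frontier L\<close> leaves finitely many. Their intersection misses
  \<open>frontier L\<close> and meets \<open>L\<close>, so, being connected, it lies in
  \<open>L\<close>.\<close>

lemma irredundant_polytope_between:
  fixes K :: "(real^'n) set"
  assumes K: "compact K" "convex K" "p \<in> interior K" and s: "s > 1"
  obtains I where "irredundant_polytope I p" "K \<subseteq> halfspaces I" "halfspaces I \<subseteq> dilation p s ` K"
proof -
  define L where "L = dilation p s ` K"
  have L: "compact L" "K \<subseteq> interior L" "p \<in> interior L"
    unfolding L_def using K s convex_subset_interior_dilation[OF K(2,3) s] interior_subset
    by (auto intro: compact_dilation)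
  have ex: "\<exists>a b. norm a = 1 \<and> (\<forall>x\<in>K. a \<bullet> x < b) \<and> b < a \<bullet> y" if "y \<in> frontier L" for y
  proof -
    have "y \<notin> K" using that L(2) by (auto simp: frontier_def)
    then obtain a b where ab: "a \<bullet> y < b" "\<And>x. x \<in> K \<Longrightarrow> b < a \<bullet> x"
      using separating_hyperplane_closed_point[OF K(2) compact_imp_closed[OF K(1)]] by blast
    have "p \<in> K" using K(3) interior_subset by blast
    then have "a \<noteq> 0" using ab by force
    \<comment> \<open>The separation lemma puts \<open>K\<close> on the upper side; the sign flip
      puts it below, and dividing by \<open>norm a\<close> gives a unit normal.\<close>
    then show ?thesis
      using ab by (intro exI[of _ "(- 1 / norm a) *\<^sub>R a"] exI[of _ "- b / norm a"]) (auto simp: divide_strict_right_mono)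
  qed
  define H where "H = {i :: (real^'n) \<times> real. norm (fst i) = 1 \<and> (\<forall>x\<in>K. fst i \<bullet> x < snd i)}"
  have cover: "frontier L \<subseteq> (\<Union>i\<in>H. {y. snd i < fst i \<bullet> y})"
    using ex by (force simp: H_def)
  obtain I0 where I0: "I0 \<subseteq> H" "finite I0" "frontier L \<subseteq> (\<Union>i\<in>I0. {y. snd i < fst i \<bullet> y})"
    by (rule compactE_image[OF compact_frontier[OF L(1)] _ cover]) (auto simp: open_halfspace_gt)
  obtain I where I: "I \<subseteq> I0" "halfspaces I = halfspaces I0" "\<And>i. i \<in> I \<Longrightarrow> halfspaces (I - {i}) \<noteq> halfspaces I"
    using halfspaces_irredundant_subset[OF I0(2)] by blast
  have KI: "K \<subseteq> halfspaces I"
    using I(1) I0(1) by (auto simp: halfspaces_def H_def less_imp_le)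
  have pK: "p \<in> K" using K(3) interior_subset by blast
  have IL: "halfspaces I \<subseteq> L"
  proof (rule ccontr)
    assume "\<not> halfspaces I \<subseteq> L"
    moreover have "halfspaces I \<inter> L \<noteq> {}" using pK KI L(3) interior_subset by blast
    ultimately have "halfspaces I \<inter> frontier L \<noteq> {}"
      by (intro connected_Int_frontier convex_connected convex_halfspaces) auto
    then obtain y where y: "y \<in> halfspaces I0" "y \<in> frontier L" using I(2) by auto
    then obtain i where "i \<in> I0" "snd i < fst i \<bullet> y" using I0(3) by blast
    then show False using y(1) unfolding halfspaces_def by fastforce
  qed
  have "irredundant_polytope I p"
  proof
    show "finite I" using I(1) I0(2) finite_subset by blast
    show "bounded (halfspaces I)" using IL L(1) bounded_subset compact_imp_bounded by blast
    show "norm (fst i) = 1" "fst i \<bullet> p < snd i" if "i \<in> I" for i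
      using that I(1) I0(1) pK by (auto simp: H_def)
  qed (rule I(3))
  then show thesis using that KI IL by (simp add: L_def)
qed

section \<open>The spherical mean of \<open>\<bar>\<langle>x, u\<rangle>\<bar>\<close>\<close>

lemma nn_integral_lborel_translate:
  fixes h :: "'a::euclidean_space \<Rightarrow> ennreal"
  assumes [measurable]: "h \<in> borel_measurable borel"
  shows "(\<integral>\<^sup>+ y. h (c + y) \<partial>lborel) = (\<integral>\<^sup>+ y. h y \<partial>lborel)"
  by (subst (2) lborel_distr_plus[of c, symmetric], subst nn_integral_distr) auto

text \<open>Weil's argument for the uniqueness of Haar measure, with the unit ball as the test function that \<open>f\<close> preserves.\<close>
lemma nn_integral_lborel_orthogonal:
  fixes f :: "'a::euclidean_space \<Rightarrow> 'a"
  assumes f: "orthogonal_transformation f" and h[measurable]: "h \<in> borel_measurable borel"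
  shows "(\<integral>\<^sup>+ y. h (f y) \<partial>lborel) = (\<integral>\<^sup>+ y. h y \<partial>lborel)"
proof -
  define k :: "'a \<Rightarrow> ennreal" where "k = indicator (cball 0 1)"
  have [measurable]: "k \<in> borel_measurable borel"
    unfolding k_def by (rule borel_measurable_indicator) simp
  have lin: "linear f" using f by (rule orthogonal_transformation_linear)
  then have [measurable]: "f \<in> borel_measurable borel"
    by (intro borel_measurable_continuous_onI linear_continuous_on linear_conv_bounded_linear[THEN iffD1])
  have k_eq: "k (f x) = k x" "k (- x) = k x" for x
    using f by (auto simp: k_def indicator_def orthogonal_transformation_norm)
  define c where "c = (\<integral>\<^sup>+ y. k y \<partial>lborel)"
  have c: "c = ennreal (unit_ball_vol DIM('a))"
    by (simp add: c_def k_def emeasure_cball)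
  have surj: "\<exists>z. f z = y" for y
    using orthogonal_transformation_surj[OF f] by (metis surjD)
  have "(\<integral>\<^sup>+ x. h (f x) \<partial>lborel) * c = (\<integral>\<^sup>+ x. \<integral>\<^sup>+ y. h (f x) * k y \<partial>lborel \<partial>lborel)"
    by (simp add: c_def nn_integral_cmult nn_integral_multc)
  also have "\<dots> = (\<integral>\<^sup>+ x. \<integral>\<^sup>+ y. h (f x) * k (- f x + y) \<partial>lborel \<partial>lborel)"
    by (intro nn_integral_cong nn_integral_lborel_translate[symmetric]) auto
  also have "\<dots> = (\<integral>\<^sup>+ y. \<integral>\<^sup>+ x. h (f x) * k (- f x + y) \<partial>lborel \<partial>lborel)"
    by (rule lborel_pair.Fubini'[symmetric]) simp
  also have "\<dots> = (\<integral>\<^sup>+ y. \<integral>\<^sup>+ x. h (f x + y) * k x \<partial>lborel \<partial>lborel)"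
  proof (rule nn_integral_cong)
    fix y
    \<comment> \<open>Shifting by a preimage \<open>z\<close> of \<open>y\<close> turns the argument
      of \<open>k\<close> into \<open>- f x\<close>, and \<open>k\<close> is invariant under
      \<open>f\<close> and under sign change.\<close>
    obtain z where z: "f z = y" using surj by auto
    have "(\<integral>\<^sup>+ x. h (f x) * k (- f x + y) \<partial>lborel) = (\<integral>\<^sup>+ x. h (f (z + x)) * k (- f (z + x) + y) \<partial>lborel)"
      by (rule nn_integral_lborel_translate[symmetric]) simp
    also have "\<dots> = (\<integral>\<^sup>+ x. h (f x + y) * k x \<partial>lborel)"
      by (intro nn_integral_cong) (simp add: linear_add[OF lin] z k_eq add.commute)
    finally show "(\<integral>\<^sup>+ x. h (f x) * k (- f x + y) \<partial>lborel) = \<dots>" .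
  qed
  also have "\<dots> = (\<integral>\<^sup>+ x. \<integral>\<^sup>+ y. h (f x + y) * k x \<partial>lborel \<partial>lborel)"
    by (rule lborel_pair.Fubini') simp
  also have "\<dots> = (\<integral>\<^sup>+ x. (\<integral>\<^sup>+ y. h y \<partial>lborel) * k x \<partial>lborel)"
    by (intro nn_integral_cong) (simp add: nn_integral_multc nn_integral_lborel_translate)
  also have "\<dots> = (\<integral>\<^sup>+ y. h y \<partial>lborel) * c"
    by (simp add: c_def nn_integral_cmult)
  finally have "c * (\<integral>\<^sup>+ x. h (f x) \<partial>lborel) = c * (\<integral>\<^sup>+ y. h y \<partial>lborel)"
    by (simp add: mult.commute)
  moreover have "c \<noteq> 0" "c \<noteq> \<infinity>"
    unfolding c by (metis ennreal_eq_0_iff not_le unit_ball_vol_pos of_nat_0_le_iff) simp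
  ultimately show ?thesis
    unfolding ennreal_mult_cancel_left infinity_ennreal_def by blast
qed

text \<open>Layer cake: \<open>norm y\<close> is the length of \<open>{0..<norm y}\<close>, and the
  part of the unit ball beyond radius \<open>s\<close> has volume \<open>?V * (1 - s ^ ?d)\<close>,
  which is integrated over \<open>{0..1}\<close>.\<close>

lemma nn_integral_norm_cball:
  "(\<integral>\<^sup>+ y. ennreal (norm y) * indicator (cball 0 1) y \<partial>(lborel :: (real^'n) measure))
     = ennreal (unit_ball_vol (real CARD('n)) * (real CARD('n) / real (CARD('n) + 1)))"
proof -
  let ?L = "lborel :: (real^'n) measure" and ?d = "CARD('n)"
  let ?V = "unit_ball_vol (real CARD('n))"
  have "(\<integral>\<^sup>+ y. ennreal (norm y) * indicator (cball 0 1) y \<partial>?L)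
      = (\<integral>\<^sup>+ y. \<integral>\<^sup>+ s. indicator {0..1} s * (indicator (cball 0 1) y * indicator {s<..} (norm y)) \<partial>lborel \<partial>?L)"
  proof (rule nn_integral_cong)
    fix y :: "real^'n"
    have "(\<integral>\<^sup>+ s. indicator {0..1} s * (indicator (cball 0 1) y * indicator {s<..} (norm y)) \<partial>lborel)
        = (\<integral>\<^sup>+ s. indicator (cball 0 1) y * indicator {0..<norm y} s \<partial>lborel)"
      by (intro nn_integral_cong) (auto simp: indicator_def)
    also have "\<dots> = indicator (cball 0 1) y * ennreal (norm y)"
      by (subst nn_integral_cmult) auto
    finally show "ennreal (norm y) * indicator (cball 0 1) y
        = (\<integral>\<^sup>+ s. indicator {0..1} s * (indicator (cball 0 1) y * indicator {s<..} (norm y)) \<partial>lborel)"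
      by (simp add: mult.commute)
  qed
  also have "\<dots> = (\<integral>\<^sup>+ s. \<integral>\<^sup>+ y. indicator {0..1} s * (indicator (cball 0 1) y * indicator {s<..} (norm y)) \<partial>?L \<partial>lborel)"
    by (rule lborel_pair.Fubini'[symmetric]) (auto simp: indicator_def of_bool_def)
  also have "\<dots> = (\<integral>\<^sup>+ s. ennreal (?V * (1 - s ^ ?d)) * indicator {0..1} s \<partial>lborel)"
  proof (rule nn_integral_cong)
    fix s :: real
    show "(\<integral>\<^sup>+ y. indicator {0..1} s * (indicator (cball 0 1) y * indicator {s<..} (norm y)) \<partial>?L)
        = ennreal (?V * (1 - s ^ ?d)) * indicator {0..1} s"
    proof (cases "s \<in> {0..1}")
      case True
      have "(\<integral>\<^sup>+ y. indicator {0..1} s * (indicator (cball 0 1) y * indicator {s<..} (norm y)) \<partial>?L)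
          = (\<integral>\<^sup>+ y. indicator (cball 0 1 - cball 0 s) y \<partial>?L)"
        using True by (intro nn_integral_cong) (auto simp: indicator_def)
      also have "\<dots> = emeasure ?L (cball 0 1 - cball 0 s)" by simp
      also have "\<dots> = emeasure ?L (cball 0 1) - emeasure ?L (cball 0 s)"
        using True by (intro emeasure_Diff) (auto simp: emeasure_cball)
      also have "\<dots> = ennreal (?V * (1 - s ^ ?d))"
        using True by (simp add: emeasure_cball ennreal_minus algebra_simps)
      finally show ?thesis using True by simp
    qed simp
  qed
  also have "\<dots> = ennreal (?V * (real ?d / real (?d + 1)))"
  proof (rule nn_integral_has_integral_lebesgue')
    have "((\<lambda>s. ?V * (1 - s ^ ?d)) has_integral ?V * (1 - 1 ^ (?d + 1) / (?d + 1)) - ?V * (0 - 0 ^ (?d + 1) / (?d + 1))) {0..1}"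
    proof (rule fundamental_theorem_of_calculus)
      fix s :: real
      have "((\<lambda>s. ?V * (s - s ^ (?d + 1) / (?d + 1))) has_real_derivative ?V * (1 - s ^ ?d)) (at s within {0..1})"
      proof -
        have "((\<lambda>s. s - s ^ (?d + 1) / real (?d + 1)) has_real_derivative 1 - s ^ ?d) (at s within {0..1})"
          by (rule DERIV_cong[OF DERIV_diff[OF DERIV_ident DERIV_cdivide[OF DERIV_pow]]]) (simp add: field_simps)
        from DERIV_cmult[OF this] show ?thesis by simp
      qed
      then show "((\<lambda>s. ?V * (s - s ^ (?d + 1) / (?d + 1))) has_vector_derivative ?V * (1 - s ^ ?d)) (at s within {0..1})"
        by (simp add: has_real_derivative_iff_has_vector_derivative)
    qed simp
    then show "((\<lambda>s. ?V * (1 - s ^ ?d)) has_integral ?V * (real ?d / real (?d + 1))) {0..1}"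
      by (simp add: field_simps)
  qed (auto intro!: mult_nonneg_nonneg power_le_one)
  finally show ?thesis .
qed

lemma has_integral_abs_mult_sqrt_power:
  "((\<lambda>t. \<bar>t\<bar> * sqrt (1 - t\<^sup>2) ^ k) has_integral 2 / real (k + 2)) {-1..1}"
proof -
  let ?f = "\<lambda>t::real. t * sqrt (1 - t\<^sup>2) ^ k"
  have pos: "(?f has_integral 1 / real (k + 2)) {0..1}"
  proof -
    \<comment> \<open>An antiderivative of \<open>?f\<close>; the square root is not differentiable
      at \<open>t = 1\<close>, so the derivative is taken in the open interval only.\<close>
    let ?F = "\<lambda>t::real. - (sqrt (1 - t\<^sup>2) ^ (k + 2)) / real (k + 2)"
    have "(?f has_integral ?F 1 - ?F 0) {0..1}"
    proof (rule fundamental_theorem_of_calculus_interior)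
      fix t :: real assume t: "t \<in> {0<..<1}"
      then have "t\<^sup>2 < 1" by (simp add: power_less_one_iff)
      then have r: "sqrt (1 - t\<^sup>2) > 0" by simp
      then have "((\<lambda>t. sqrt (1 - t\<^sup>2)) has_real_derivative - t / sqrt (1 - t\<^sup>2)) (at t)"
        by (auto intro!: derivative_eq_intros simp: field_simps)
      from DERIV_cdivide[OF DERIV_minus[OF DERIV_power[OF this, of "k + 2"]], of "real (k + 2)"]
      have "(?F has_real_derivative ?f t) (at t)"
        by (rule DERIV_cong) (use r in \<open>simp add: field_simps\<close>)
      then show "(?F has_vector_derivative ?f t) (at t)"
        by (simp add: has_real_derivative_iff_has_vector_derivative)
    qed (auto intro!: continuous_intros)
    then show ?thesis by simp
  qed
  have "((\<lambda>t. \<bar>t\<bar> * sqrt (1 - t\<^sup>2) ^ k) has_integral 1 / real (k + 2)) {0..1}"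
    by (rule has_integral_eq[OF _ pos]) auto
  moreover have "((\<lambda>t. \<bar>t\<bar> * sqrt (1 - t\<^sup>2) ^ k) has_integral 1 / real (k + 2)) {-1..0}"
    using has_integral_reflect_real[of "\<lambda>t. \<bar>t\<bar> * sqrt (1 - t\<^sup>2) ^ k" "1 / real (k + 2)" 1 0] calculation
    by (simp del: has_integral_reflect_real)
  ultimately show ?thesis
    using has_integral_combine[of "-1" 0 1 "\<lambda>t. \<bar>t\<bar> * sqrt (1 - t\<^sup>2) ^ k"] by fastforce
qed

text \<open>Slicing orthogonally to \<open>e\<close>: the slice at height \<open>t\<close> is a ball
  of radius \<open>sqrt (1 - t\<^sup>2)\<close> in one dimension less, which leaves a
  one-dimensional integral with exponent \<open>DIM('a) - 1\<close>.\<close>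

lemma nn_integral_abs_component_cball:
  fixes e :: "'a::euclidean_space"
  assumes e: "e \<in> Basis"
  shows "(\<integral>\<^sup>+ y. ennreal \<bar>y \<bullet> e\<bar> * indicator (cball 0 1) y \<partial>lborel)
     = ennreal (unit_ball_vol (real (DIM('a) - 1)) * 2 / real (DIM('a) + 1))"
proof -
  define B where "B = Basis - {e}"
  have B: "insert e B = Basis" "e \<notin> B" "finite B" "card B = DIM('a) - 1"
    using e by (auto simp: B_def)
  let ?k = "card B"
  let ?P = "Pi\<^sub>M B (\<lambda>_. lborel :: real measure)"
  interpret product_sigma_finite "\<lambda>_. lborel :: real measure" ..
  have norm_eq: "norm (\<Sum>b\<in>Basis. f b *\<^sub>R b :: 'a) = sqrt (\<Sum>b\<in>Basis. (f b)\<^sup>2)" for f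
    unfolding norm_conv_dist by (subst euclidean_dist_l2) (auto simp: L2_set_def)
  have norm_le: "norm (\<Sum>b\<in>Basis. f b *\<^sub>R b :: 'a) \<le> 1 \<longleftrightarrow> (f e)\<^sup>2 + (\<Sum>b\<in>B. (f b)\<^sup>2) \<le> 1" for f
  proof -
    have "(\<Sum>b\<in>Basis. (f b)\<^sup>2) = (f e)\<^sup>2 + (\<Sum>b\<in>B. (f b)\<^sup>2)"
      unfolding B(1)[symmetric] using B(2,3) by simp
    then show ?thesis by (simp add: norm_eq)
  qed
  have comp_eq: "(\<Sum>b\<in>Basis. f b *\<^sub>R b :: 'a) \<bullet> e = f e" for f
    using e by (simp add: inner_sum_left_Basis)
  let ?g = "\<lambda>f :: 'a \<Rightarrow> real. ennreal \<bar>f e\<bar> * indicator {f. (f e)\<^sup>2 + (\<Sum>b\<in>B. (f b)\<^sup>2) \<le> 1} f"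
  have meas: "?g \<in> borel_measurable (Pi\<^sub>M (insert e B) (\<lambda>_. lborel))"
    by measurable
  have "(\<integral>\<^sup>+ y. ennreal \<bar>y \<bullet> e\<bar> * indicator (cball 0 1) y \<partial>(lborel :: 'a measure))
      = (\<integral>\<^sup>+ f. ?g f \<partial>(Pi\<^sub>M (insert e B) (\<lambda>_. lborel)))"
    unfolding B(1)
    by (subst lborel_eq, subst nn_integral_distr)
       (auto intro!: nn_integral_cong simp: comp_eq norm_le indicator_def)
  also have "\<dots> = (\<integral>\<^sup>+ t. \<integral>\<^sup>+ x. ?g (x(e := t)) \<partial>?P \<partial>lborel)"
    using B meas by (subst product_nn_integral_insert_rev) auto
  also have "\<dots> = (\<integral>\<^sup>+ t. ennreal (unit_ball_vol ?k) * (ennreal (\<bar>t\<bar> * sqrt (1 - t\<^sup>2) ^ ?k) * indicator {-1..1} t) \<partial>lborel)"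
  proof (rule nn_integral_cong_AE)
    \<comment> \<open>The volume formula is applied with positive radius, so the two heights with a
      degenerate slice are set aside as a null set.\<close>
    have "AE t in lborel. t \<notin> {-1, 1::real}"
      by (intro AE_not_in countable_imp_null_set_lborel) auto
    then show "AE t in lborel. (\<integral>\<^sup>+ x. ?g (x(e := t)) \<partial>?P)
        = ennreal (unit_ball_vol ?k) * (ennreal (\<bar>t\<bar> * sqrt (1 - t\<^sup>2) ^ ?k) * indicator {-1..1} t)"
    proof eventually_elim
      case (elim t)
      have upd: "(\<Sum>b\<in>B. (if b = e then t else x b)\<^sup>2) = (\<Sum>b\<in>B. (x b)\<^sup>2)" for x :: "'a \<Rightarrow> real"
        using B by (intro sum.cong) auto
      show ?case
      proof (cases "t \<in> {-1<..<1}")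
        case True
        then have t: "t\<^sup>2 < 1" by (simp add: abs_square_less_1 abs_less_iff)
        then have r: "sqrt (1 - t\<^sup>2) > 0" by simp
        have "(\<integral>\<^sup>+ x. ?g (x(e := t)) \<partial>?P)
            = (\<integral>\<^sup>+ x. ennreal \<bar>t\<bar> * indicator ({f. sqrt (\<Sum>i\<in>B. (f i)\<^sup>2) \<le> sqrt (1 - t\<^sup>2)} \<inter> space ?P) x \<partial>?P)"
          using t by (intro nn_integral_cong) (auto simp: indicator_def upd)
        also have "\<dots> = ennreal \<bar>t\<bar> * emeasure ?P ({f. sqrt (\<Sum>i\<in>B. (f i)\<^sup>2) \<le> sqrt (1 - t\<^sup>2)} \<inter> space ?P)"
          by (subst nn_integral_cmult) (auto simp: B)
        also have "\<dots> = ennreal \<bar>t\<bar> * ennreal (unit_ball_vol ?k * sqrt (1 - t\<^sup>2) ^ ?k)"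
          by (subst emeasure_cball_aux[OF B(3) r]) simp
        also have "\<dots> = ennreal (unit_ball_vol ?k) * ennreal (\<bar>t\<bar> * sqrt (1 - t\<^sup>2) ^ ?k)"
          using r by (simp add: ennreal_mult'[symmetric] mult_ac)
        finally show ?thesis using True by simp
      next
        case False
        with elim have t: "t \<notin> {-1..1}" by auto
        then have "1 < \<bar>t\<bar>" by auto
        then have "1 < t\<^sup>2" using one_less_power[of "\<bar>t\<bar>" 2] by simp
        then have "\<not> t\<^sup>2 + (\<Sum>b\<in>B. (x b)\<^sup>2) \<le> 1" for x :: "'a \<Rightarrow> real"
          using sum_nonneg[of B "\<lambda>b. (x b)\<^sup>2"] by auto
        then show ?thesis using t by (simp add: upd)
      qed
    qed
  qed
  also have "\<dots> = ennreal (unit_ball_vol ?k) * (\<integral>\<^sup>+ t. ennreal (\<bar>t\<bar> * sqrt (1 - t\<^sup>2) ^ ?k) * indicator {-1..1} t \<partial>lborel)"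
    by (rule nn_integral_cmult) simp
  also have "(\<integral>\<^sup>+ t. ennreal (\<bar>t\<bar> * sqrt (1 - t\<^sup>2) ^ ?k) * indicator {-1..1} t \<partial>lborel) = ennreal (2 / real (?k + 2))"
    by (rule nn_integral_has_integral_lebesgue'[OF _ has_integral_abs_mult_sqrt_power])
       (auto simp: abs_le_square_iff[symmetric] abs_square_le_1 abs_le_iff intro!: mult_nonneg_nonneg zero_le_power)
  also have "real (?k + 2) = real (DIM('a) + 1)" using B(4) DIM_positive[where 'a = 'a] by simp
  finally show ?thesis using B(4) by (simp add: ennreal_mult'[symmetric])
qed


lemma nn_integral_abs_inner_cball:
  fixes x :: "real^'n"
  assumes "norm x = 1" "CARD('n) \<ge> 2"
  shows "(\<integral>\<^sup>+ y. ennreal \<bar>x \<bullet> y\<bar> * indicator (cball 0 1) y \<partial>lborel)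
     = ennreal (unit_ball_vol (real (CARD('n) - 1)) * 2 / real (CARD('n) + 1))"
proof -
  obtain e :: "real^'n" where e: "e \<in> Basis" by (meson nonempty_Basis equals0I)
  then obtain f where f: "orthogonal_transformation f" "f x = e"
    using rotation_exists[of x e] assms by auto
  have "x \<bullet> y = f y \<bullet> e" "y \<in> cball 0 1 \<longleftrightarrow> f y \<in> cball 0 1" for y
    using f orthogonal_transformation_norm[OF f(1)] by (auto simp: orthogonal_transformation_def inner_commute simp flip: f(2))
  then have "(\<integral>\<^sup>+ y. ennreal \<bar>x \<bullet> y\<bar> * indicator (cball 0 1) y \<partial>lborel)
      = (\<integral>\<^sup>+ y. ennreal \<bar>f y \<bullet> e\<bar> * indicator (cball 0 1) (f y) \<partial>lborel)"
    by (intro nn_integral_cong) (auto simp: indicator_def)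
  also have "\<dots> = (\<integral>\<^sup>+ y. ennreal \<bar>y \<bullet> e\<bar> * indicator (cball 0 1) y \<partial>lborel)"
    by (rule nn_integral_lborel_orthogonal[OF f(1), where h = "\<lambda>y. ennreal \<bar>y \<bullet> e\<bar> * indicator (cball 0 1) y"])
       (intro borel_measurable_times_ennreal borel_measurable_indicator, auto)
  finally show ?thesis using nn_integral_abs_component_cball[OF e] by simp
qed

section \<open>The invariant measure on the sphere\<close>

lemma borel_measurable_uniform_sphere:
  assumes "uniform_sphere_measure (\<sigma> :: (real^'n) measure)" "f \<in> borel \<rightarrow>\<^sub>M N"
  shows "f \<in> \<sigma> \<rightarrow>\<^sub>M N"
proof -
  have "sets \<sigma> = sets (restrict_space borel (sphere 0 1))"
    using assms(1) by (simp add: uniform_sphere_measure_def)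
  from measurable_cong_sets[OF this refl, of N] show ?thesis
    using measurable_restrict_space1[OF assms(2)] by blast
qed

lemma space_uniform_sphere:
  assumes "uniform_sphere_measure (\<sigma> :: (real^'n) measure)"
  shows "space \<sigma> = sphere 0 1"
proof -
  have "sets \<sigma> = sets (restrict_space borel (sphere 0 1))"
    using assms by (simp add: uniform_sphere_measure_def)
  from sets_eq_imp_space_eq[OF this] show ?thesis by (simp add: space_restrict_space)
qed

lemma nn_integral_sphere_rotation:
  fixes \<sigma> :: "(real^'n) measure"
  assumes \<sigma>: "uniform_sphere_measure \<sigma>" and A: "rotation_matrix A" and h: "h \<in> borel_measurable borel"
  shows "(\<integral>\<^sup>+ x. h (A *v x) \<partial>\<sigma>) = (\<integral>\<^sup>+ x. h x \<partial>\<sigma>)"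
proof -
  have orth: "orthogonal_transformation ((*v) A)"
    using A by (simp add: rotation_matrix_def orthogonal_transformation_matrix)
  have "(*v) A \<in> restrict_space borel (sphere 0 1) \<rightarrow>\<^sub>M restrict_space borel (sphere 0 1)"
  proof (rule measurable_restrict_space3)
    show "(*v) A \<in> borel_measurable borel"
      by (intro borel_measurable_continuous_onI matrix_vector_mult_linear_continuous_on)
    show "(*v) A \<in> sphere 0 1 \<rightarrow> sphere 0 1"
      using orthogonal_transformation_norm[OF orth] by auto
  qed
  moreover have eq: "sets \<sigma> = sets (restrict_space borel (sphere 0 1))"
    using \<sigma> by (simp add: uniform_sphere_measure_def)
  ultimately have meas: "(*v) A \<in> \<sigma> \<rightarrow>\<^sub>M \<sigma>"
    using measurable_cong_sets[OF eq eq] by blast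
  have "distr \<sigma> \<sigma> ((*v) A) = \<sigma>" using \<sigma> A by (simp add: uniform_sphere_measure_def)
  then have "(\<integral>\<^sup>+ x. h x \<partial>\<sigma>) = (\<integral>\<^sup>+ x. h x \<partial>distr \<sigma> \<sigma> ((*v) A))" by simp
  also have "\<dots> = (\<integral>\<^sup>+ x. h (A *v x) \<partial>\<sigma>)"
    using meas borel_measurable_uniform_sphere[OF \<sigma> h] by (subst nn_integral_distr) simp_all
  finally show ?thesis ..
qed

text \<open>\<open>uniform_sphere_measure\<close> grants invariance under orthogonal maps of
  determinant 1 only; for \<open>CARD('n) \<ge> 2\<close> these act transitively on vectors of equal
  norm.\<close>

lemma nn_integral_abs_inner_sphere_cong:
  fixes \<sigma> :: "(real^'n) measure"
  assumes d: "CARD('n) \<ge> 2" and \<sigma>: "uniform_sphere_measure \<sigma>" and uv: "norm u = norm v"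
  shows "(\<integral>\<^sup>+ x. ennreal \<bar>x \<bullet> u\<bar> \<partial>\<sigma>) = (\<integral>\<^sup>+ x. ennreal \<bar>x \<bullet> v\<bar> \<partial>\<sigma>)"
proof -
  obtain f where f: "orthogonal_transformation f" "det (matrix f) = 1" "f u = v"
    using rotation_exists[OF d uv] by auto
  have lin: "linear f" using f(1) by (rule orthogonal_transformation_linear)
  have "rotation_matrix (matrix f)"
    using f orthogonal_transformation_matrix by (auto simp: rotation_matrix_def)
  from nn_integral_sphere_rotation[OF \<sigma> this, of "\<lambda>x. ennreal \<bar>x \<bullet> v\<bar>"]
  have "(\<integral>\<^sup>+ x. ennreal \<bar>f x \<bullet> v\<bar> \<partial>\<sigma>) = (\<integral>\<^sup>+ x. ennreal \<bar>x \<bullet> v\<bar> \<partial>\<sigma>)"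
    by (simp add: fun_cong[OF matrix_vector_mul(2)[OF lin]])
  moreover have "f x \<bullet> v = x \<bullet> u" for x
    using f(1) by (simp add: orthogonal_transformation_def flip: f(3))
  ultimately show ?thesis by simp
qed

lemma c1_pos: "d \<ge> 1 \<Longrightarrow> c1 d > 0"
  by (auto simp: c1_def intro!: divide_pos_pos mult_pos_pos Gamma_real_pos)

text \<open>Numerator: the integral of \<open>\<bar>x \<bullet> y\<bar>\<close> over the unit ball
  for a unit vector \<open>x\<close>. Denominator: that of \<open>norm y\<close>.\<close>

lemma c1_eq_unit_ball_vol:
  assumes "d \<ge> 1"
  shows "c1 d = (unit_ball_vol (real (d - 1)) * 2 / real (d + 1)) / (unit_ball_vol (real d) * (real d / real (d + 1)))"
proof -
  have G: "Gamma (real d / 2 + 1) = real d / 2 * Gamma (real d / 2)"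
    using assms by (intro Gamma_plus1) (auto dest!: nonpos_Ints_nonpos)
  have r: "(real d - 1) / 2 + 1 = real (d + 1) / 2" "real (d - 1) / 2 = (real d - 1) / 2"
    using assms by (simp_all add: field_simps)
  have p: "pi powr (real d / 2) = pi powr ((real d - 1) / 2) * sqrt pi"
    by (subst powr_half_sqrt[symmetric]) (auto simp: powr_add[symmetric] diff_divide_distrib)
  have "(P / G2 * 2 / E) / (P * s / (D / 2 * G1) * (D / E)) = G1 / (s * G2)"
    if "P > 0" "G1 > 0" "G2 > 0" "s > 0" "D > 0" "E > 0" for P G1 G2 s D E :: real
    using that by (simp add: field_simps)
  moreover have "Gamma (real d / 2) > 0" "Gamma (real (d + 1) / 2) > 0"
    using assms by (auto intro!: Gamma_real_pos)
  ultimately show ?thesis using assms unfolding unit_ball_vol_def c1_def G r p by simp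
qed

text \<open>Integrate \<open>\<bar>x \<bullet> y\<bar>\<close> over sphere times unit ball. Over the
  sphere first, rotation invariance and homogeneity give \<open>C * norm y\<close>; over the ball
  first, the result does not depend on \<open>x\<close>. Equating both orders yields
  \<open>C\<close> as a quotient of ball integrals.\<close>

lemma integral_abs_inner_sphere:
  fixes \<sigma> :: "(real^'n) measure"
  assumes d: "CARD('n) \<ge> 2" and \<sigma>: "uniform_sphere_measure \<sigma>" and u: "norm u = 1"
  shows "(\<integral>x. \<bar>x \<bullet> u\<bar> \<partial>\<sigma>) = c1 CARD('n)"
proof -
  let ?L = "lborel :: (real^'n) measure"
  interpret prob_space \<sigma> using \<sigma> by (simp add: uniform_sphere_measure_def)
  interpret pair_sigma_finite \<sigma> ?L ..
  have id_meas: "(\<lambda>x. x) \<in> \<sigma> \<rightarrow>\<^sub>M borel"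
    by (rule borel_measurable_uniform_sphere[OF \<sigma>]) simp
  have inner_meas [measurable]: "(\<lambda>x. x \<bullet> y) \<in> borel_measurable \<sigma>" for y
    by (rule borel_measurable_uniform_sphere[OF \<sigma>]) simp
  have ball_meas [measurable]: "(indicator (cball 0 1) :: real^'n \<Rightarrow> ennreal) \<in> borel_measurable borel"
    by (rule borel_measurable_indicator) simp
  have prod_meas: "(\<lambda>(x, y). ennreal \<bar>x \<bullet> y\<bar> * indicator (cball 0 1) y) \<in> borel_measurable (\<sigma> \<Otimes>\<^sub>M ?L)"
  proof -
    have [measurable]: "fst \<in> \<sigma> \<Otimes>\<^sub>M ?L \<rightarrow>\<^sub>M borel"
      using measurable_compose[OF measurable_fst id_meas] .
    have [measurable]: "snd \<in> \<sigma> \<Otimes>\<^sub>M ?L \<rightarrow>\<^sub>M borel"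
      using measurable_snd[of \<sigma> ?L] by simp
    have "(\<lambda>p. ennreal \<bar>fst p \<bullet> snd p\<bar> * indicator (cball 0 1) (snd p)) \<in> borel_measurable (\<sigma> \<Otimes>\<^sub>M ?L)"
      by measurable
    then show ?thesis by (simp add: case_prod_beta')
  qed
  define C where "C = (\<integral>\<^sup>+ x. ennreal \<bar>x \<bullet> u\<bar> \<partial>\<sigma>)"
  have homog: "(\<integral>\<^sup>+ x. ennreal \<bar>x \<bullet> y\<bar> \<partial>\<sigma>) = C * ennreal (norm y)" for y
  proof -
    have "(\<integral>\<^sup>+ x. ennreal \<bar>x \<bullet> y\<bar> \<partial>\<sigma>) = (\<integral>\<^sup>+ x. ennreal \<bar>x \<bullet> (norm y *\<^sub>R u)\<bar> \<partial>\<sigma>)"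
      using u by (intro nn_integral_abs_inner_sphere_cong[OF d \<sigma>]) simp
    also have "\<dots> = (\<integral>\<^sup>+ x. ennreal \<bar>x \<bullet> u\<bar> * ennreal (norm y) \<partial>\<sigma>)"
      by (intro nn_integral_cong) (simp add: abs_mult ennreal_mult'[symmetric] mult.commute)
    also have "\<dots> = C * ennreal (norm y)"
      unfolding C_def by (intro nn_integral_multc) measurable
    finally show ?thesis .
  qed
  let ?N = "unit_ball_vol (real CARD('n)) * (real CARD('n) / real (CARD('n) + 1))"
  let ?J = "unit_ball_vol (real (CARD('n) - 1)) * 2 / real (CARD('n) + 1)"
  have "C * ennreal ?N = (\<integral>\<^sup>+ y. C * (ennreal (norm y) * indicator (cball 0 1) y) \<partial>?L)"
    unfolding nn_integral_norm_cball[symmetric] by (rule nn_integral_cmult[symmetric]) simp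
  also have "\<dots> = (\<integral>\<^sup>+ y. \<integral>\<^sup>+ x. ennreal \<bar>x \<bullet> y\<bar> * indicator (cball 0 1) y \<partial>\<sigma> \<partial>?L)"
  proof (rule nn_integral_cong)
    fix y :: "real^'n"
    have "(\<integral>\<^sup>+ x. ennreal \<bar>x \<bullet> y\<bar> * indicator (cball 0 1) y \<partial>\<sigma>) = (\<integral>\<^sup>+ x. ennreal \<bar>x \<bullet> y\<bar> \<partial>\<sigma>) * indicator (cball 0 1) y"
      by (rule nn_integral_multc) measurable
    then show "C * (ennreal (norm y) * indicator (cball 0 1) y) = (\<integral>\<^sup>+ x. ennreal \<bar>x \<bullet> y\<bar> * indicator (cball 0 1) y \<partial>\<sigma>)"
      by (simp only: homog mult.assoc)
  qed
  also have "\<dots> = (\<integral>\<^sup>+ x. \<integral>\<^sup>+ y. ennreal \<bar>x \<bullet> y\<bar> * indicator (cball 0 1) y \<partial>?L \<partial>\<sigma>)"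
    by (rule Fubini'[OF prod_meas])
  also have "\<dots> = (\<integral>\<^sup>+ x. ennreal ?J \<partial>\<sigma>)"
    using d by (intro nn_integral_cong nn_integral_abs_inner_cball) (auto simp: space_uniform_sphere[OF \<sigma>])
  also have "\<dots> = ennreal ?J" by (simp add: emeasure_space_1)
  finally have CN: "C * ennreal ?N = ennreal ?J" .
  have N: "?N > 0" by (intro mult_pos_pos divide_pos_pos) auto
  have "c1 CARD('n) = ?J / ?N" using d by (intro c1_eq_unit_ball_vol) simp
  moreover have "?N \<noteq> 0" using N by linarith
  ultimately have "c1 CARD('n) * ?N = ?J" using nonzero_eq_divide_eq by blast
  then have "ennreal (c1 CARD('n)) * ennreal ?N = ennreal ?J"
    using N by (subst ennreal_mult''[symmetric]) auto
  then have "ennreal ?N * C = ennreal ?N * ennreal (c1 CARD('n))"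
    using CN by (simp only: mult.commute)
  moreover have "ennreal ?N \<noteq> 0" "ennreal ?N \<noteq> top"
    using N by (simp_all only: ennreal_eq_0_iff not_le) simp
  ultimately have "C = ennreal (c1 CARD('n))"
    unfolding ennreal_mult_cancel_left by blast
  moreover have "(\<integral>x. \<bar>x \<bullet> u\<bar> \<partial>\<sigma>) = enn2real C"
    unfolding C_def by (rule integral_eq_nn_integral) (auto intro!: borel_measurable_abs inner_meas)
  ultimately show ?thesis using c1_pos[of "CARD('n)"] by (simp add: less_imp_le)
qed

section \<open>Polynomial approximation of the absolute value\<close>

text \<open>The polynomial in \<open>u = sin x\<close> with value
  \<open>sin ((2 * n + 1) * x) / sin x\<close>, up to sign the Chebyshev polynomial of degree
  \<open>2 * n + 1\<close> divided by \<open>u\<close>. Even multiples would bring in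
  \<open>cos x\<close>. The recursion is
  \<open>sin (y + 2 * x) + sin (y - 2 * x) = 2 * sin y * cos (2 * x)\<close> with
  \<open>cos (2 * x) = 1 - 2 * u\<^sup>2\<close>.\<close>

fun sine_quotient_poly :: "nat \<Rightarrow> real poly" where
  "sine_quotient_poly 0 = 1"
| "sine_quotient_poly (Suc 0) = [:3, 0, -4:]"
| "sine_quotient_poly (Suc (Suc n)) = [:2, 0, -4:] * sine_quotient_poly (Suc n) - sine_quotient_poly n"

lemma degree_sine_quotient_poly: "degree (sine_quotient_poly n) \<le> 2 * n"
proof (induction n rule: sine_quotient_poly.induct)
  case (3 n)
  have "degree ([:2, 0, -4:] * sine_quotient_poly (Suc n)) \<le> 2 * Suc (Suc n)"
    using degree_mult_le[of "[:2, 0, -4:]" "sine_quotient_poly (Suc n)"] 3(1) by simp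
  then show ?case using 3(2) by (auto intro: degree_diff_le)
qed auto

lemma sine_quotient_poly_sin:
  "sin x * poly (sine_quotient_poly n) (sin x) = sin (real (2 * n + 1) * x)"
proof (induction n rule: sine_quotient_poly.induct)
  case 2
  have "sin (3 * x) = sin (2 * x + x)" by simp
  also have "\<dots> = 2 * sin x * (cos x)\<^sup>2 + (1 - 2 * (sin x)\<^sup>2) * sin x"
    unfolding sin_add sin_double cos_double_sin by (simp add: power2_eq_square)
  also have "\<dots> = 3 * sin x - 4 * sin x ^ 3"
    unfolding cos_squared_eq by (simp add: power2_eq_square power3_eq_cube algebra_simps)
  finally show ?case by (simp add: algebra_simps power3_eq_cube)
next
  case (3 n)
  let ?y = "real (2 * Suc n + 1) * x"
  have "sin (?y + 2 * x) + sin (?y - 2 * x) = 2 * sin ?y * cos (2 * x)"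
    by (simp add: sin_add sin_diff)
  moreover have "?y + 2 * x = real (2 * Suc (Suc n) + 1) * x" "?y - 2 * x = real (2 * n + 1) * x"
    by (simp_all add: algebra_simps)
  moreover have "cos (2 * x) = 1 - 2 * (sin x)\<^sup>2" by (rule cos_double_sin)
  ultimately have "sin (real (2 * Suc (Suc n) + 1) * x) + sin (real (2 * n + 1) * x) = 2 * sin ?y * (1 - 2 * (sin x)\<^sup>2)"
    by metis
  then have "sin (real (2 * Suc (Suc n) + 1) * x) = (2 - 4 * (sin x)\<^sup>2) * sin ?y - sin (real (2 * n + 1) * x)"
    by argo
  also have "\<dots> = sin x * poly (sine_quotient_poly (Suc (Suc n))) (sin x)"
    unfolding 3(1)[symmetric] 3(2)[symmetric] by (simp add: algebra_simps power2_eq_square)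
  finally show ?case by simp
qed auto

lemma abs_sin_mult_le: "\<bar>sin (real m * x)\<bar> \<le> real m * \<bar>sin x\<bar>"
proof (induction m)
  case (Suc m)
  have "sin (real (Suc m) * x) = sin (real m * x + x)" by (simp add: algebra_simps)
  then have "\<bar>sin (real (Suc m) * x)\<bar> = \<bar>sin (real m * x) * cos x + cos (real m * x) * sin x\<bar>"
    by (simp add: sin_add)
  also have "\<dots> \<le> \<bar>sin (real m * x)\<bar> * \<bar>cos x\<bar> + \<bar>cos (real m * x)\<bar> * \<bar>sin x\<bar>"
    by (metis abs_mult abs_triangle_ineq)
  also have "\<dots> \<le> \<bar>sin (real m * x)\<bar> * 1 + 1 * \<bar>sin x\<bar>"
    by (intro add_mono mult_left_mono mult_right_mono) auto
  finally show ?case using Suc by (simp add: algebra_simps)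
qed auto

lemma sine_quotient_poly_even: "poly (sine_quotient_poly n) (- u) = poly (sine_quotient_poly n) u"
  by (induction n rule: sine_quotient_poly.induct) auto

text \<open>With \<open>u = sin x\<close> and \<open>m = 2 * n + 1\<close> the bounds become
  \<open>\<bar>sin (m * x)\<bar> \<le> m * \<bar>sin x\<bar>\<close> and
  \<open>\<bar>sin (m * x)\<bar> \<le> 1\<close>. The second is the decay away from 0 that
  concentrates the kernel.\<close>

lemma abs_sine_quotient_poly_le:
  assumes "\<bar>u\<bar> \<le> 1" "u \<noteq> 0"
  shows "\<bar>poly (sine_quotient_poly n) u\<bar> \<le> real (2 * n + 1)" "\<bar>poly (sine_quotient_poly n) u\<bar> * \<bar>u\<bar> \<le> 1"
proof -
  define x where "x = arcsin u"
  have u: "u = sin x" using assms by (simp add: x_def)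
  have eq: "\<bar>u\<bar> * \<bar>poly (sine_quotient_poly n) u\<bar> = \<bar>sin (real (2 * n + 1) * x)\<bar>"
    unfolding u sine_quotient_poly_sin[symmetric] abs_mult by simp
  have "\<bar>u\<bar> * \<bar>poly (sine_quotient_poly n) u\<bar> \<le> \<bar>u\<bar> * real (2 * n + 1)"
    using abs_sin_mult_le[of "2 * n + 1" x] eq u by (simp add: mult.commute)
  then show "\<bar>poly (sine_quotient_poly n) u\<bar> \<le> real (2 * n + 1)"
    using assms by simp
  show "\<bar>poly (sine_quotient_poly n) u\<bar> * \<bar>u\<bar> \<le> 1"
    using eq by (simp add: mult.commute)
qed

lemma half_le_sin:
  assumes "0 \<le> x" "x \<le> (1::real)"
  shows "x / 2 \<le> sin x"
proof -
  have "\<bar>sin x - (\<Sum>m<3. sin_coeff m * x ^ m)\<bar> \<le> inverse (fact 3) * \<bar>x\<bar> ^ 3"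
    by (rule Maclaurin_sin_bound)
  moreover have "(\<Sum>m<3. sin_coeff m * x ^ m) = x"
    by (simp add: eval_nat_numeral sin_coeff_def)
  ultimately have "\<bar>sin x - x\<bar> \<le> x ^ 3 / 6" using assms by (simp add: fact_numeral)
  then have "x - sin x \<le> x ^ 3 / 6" by linarith
  moreover have "x ^ 3 \<le> x" using power_decreasing[of 1 3 x] assms by simp
  ultimately show ?thesis using assms by simp
qed

text \<open>With \<open>m = 2 * n + 1\<close> and \<open>u = sin x\<close>, the range of
  \<open>u\<close> is chosen such that \<open>m * x \<le> 1\<close>. There
  \<open>half_le_sin\<close> bounds \<open>sin (m * x)\<close> below by \<open>m * x / 2\<close>,
  and \<open>x \<ge> u\<close>.\<close>

lemma sine_quotient_poly_ge:
  assumes u: "0 < u" "u \<le> 1 / (2 * real (2 * n + 1))"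
  shows "real (2 * n + 1) / 2 \<le> poly (sine_quotient_poly n) u"
proof -
  let ?m = "real (2 * n + 1)"
  define x where "x = arcsin u"
  have "1 / (2 * ?m) \<le> 1 / 2" by (simp add: field_simps)
  then have "u \<le> 1 / 2" using u(2) by linarith
  then have bounds: "- 1 \<le> u" "u \<le> 1" using u(1) by auto
  then have ux: "sin x = u" by (simp add: x_def)
  have "u \<le> sin (1 / ?m)"
    using u(2) half_le_sin[of "1 / ?m"] by simp
  moreover have pi2: "- (pi / 2) \<le> 1 / ?m" "1 / ?m \<le> pi / 2"
  proof -
    show "- (pi / 2) \<le> 1 / ?m" by (rule order_trans[of _ 0]) auto
    have "1 / ?m \<le> 1" by simp
    then show "1 / ?m \<le> pi / 2" using pi_ge_two by linarith
  qed
  ultimately have x_le: "x \<le> 1 / ?m"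
    using arcsin_le_arcsin[of u "sin (1 / ?m)"] bounds unfolding x_def arcsin_sin[OF pi2] by simp
  have x0: "0 < x" using arcsin_less_arcsin[of 0 u] bounds u(1) by (simp add: x_def)
  have "?m * x / 2 \<le> sin (?m * x)"
    using x_le x0 by (intro half_le_sin) (auto simp: field_simps)
  also have "\<dots> = u * poly (sine_quotient_poly n) u"
    using sine_quotient_poly_sin[of x n] ux by simp
  finally have "?m / 2 * x \<le> u * poly (sine_quotient_poly n) u" by simp
  moreover have "u \<le> x" using x0 sin_x_le_x[of x] ux by simp
  then have "?m / 2 * u \<le> ?m / 2 * x" by (intro mult_left_mono) auto
  ultimately have "u * (?m / 2) \<le> u * poly (sine_quotient_poly n) u" by (metis (no_types) order_trans mult.commute)
  then show ?thesis using u by simp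
qed

lemma poly_antiderivative_exists:
  fixes k :: "real poly"
  obtains A where "pderiv A = k" "degree A \<le> degree k + 1" "poly A 0 = 0"
proof
  let ?A = "\<Sum>i\<le>degree k. monom (coeff k i / real (i + 1)) (i + 1)"
  have "pderiv (monom (coeff k i / real (i + 1)) (i + 1)) = monom (coeff k i) i" for i
    by (simp add: pderiv_monom)
  then show "pderiv ?A = k"
    by (simp only: higher_pderiv_sum[of 1, simplified] poly_as_sum_of_monoms)
  show "degree ?A \<le> degree k + 1"
    by (intro degree_sum_le) (auto intro: order_trans[OF degree_monom_le])
  show "poly ?A 0 = 0"
    by (simp add: poly_sum poly_monom)
qed

text \<open>The Jackson-type kernel \<open>(sin (m \<theta>) / sin \<theta>)\<^sup>4\<close> in the variable \<open>u = sin \<theta>\<close>, with \<open>m = 2 * n + 1\<close>. Its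
  second antiderivative, normalised to have slope 1 at the point 1, is the approximation to the absolute value.\<close>
lemma abs_poly_approx:
  obtains q :: "real poly" where "degree q \<le> 8 * n + 2"
    "\<And>s. \<bar>s\<bar> \<le> 1 \<Longrightarrow> \<bar>\<bar>s\<bar> - poly q s\<bar> \<le> 48 / real (2 * n + 1)"
proof -
  define m where "m = real (2 * n + 1)"
  \<comment> \<open>The power 4 makes the kernel nonnegative with a tail below
    \<open>1 / x ^ 4\<close>. With power 2 the same estimates would lose a logarithm of
    \<open>m\<close>.\<close>
  define k where "k = sine_quotient_poly n ^ 4"
  have m1: "m \<ge> 1" by (simp add: m_def)
  obtain A where A: "pderiv A = k" "degree A \<le> degree k + 1" "poly A 0 = 0"
    by (rule poly_antiderivative_exists)
  obtain B where B: "pderiv B = A" "degree B \<le> degree A + 1" "poly B 0 = 0"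
    by (rule poly_antiderivative_exists)
  have dA: "(poly A has_real_derivative poly k x) (at x)" for x
    using poly_DERIV[of A x] A by simp
  have dB: "(poly B has_real_derivative poly A x) (at x)" for x
    using poly_DERIV[of B x] B by simp
  have k_even: "poly k (- x) = poly k x" for x
    by (simp add: k_def sine_quotient_poly_even)
  have k_nonneg: "0 \<le> poly k x" for x
    by (simp add: k_def)
  have A_odd: "poly A (- x) = - poly A x" for x
  proof -
    have "((\<lambda>x. poly A x + poly A (- x)) has_real_derivative 0) (at x)" for x
      using DERIV_add[OF dA[of x] DERIV_chain2[OF dA[of "- x"] DERIV_minus[OF DERIV_ident]]] by (simp add: k_even)
    then have "\<forall>x. ((\<lambda>x. poly A x + poly A (- x)) has_real_derivative 0) (at x)" by blast
    from DERIV_isconst_all[OF this, of x 0] show ?thesis using A by simp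
  qed
  have B_even: "poly B (- x) = poly B x" for x
  proof -
    have "((\<lambda>x. poly B x - poly B (- x)) has_real_derivative 0) (at x)" for x
      using DERIV_diff[OF dB[of x] DERIV_chain2[OF dB[of "- x"] DERIV_minus[OF DERIV_ident]]] by (simp add: A_odd)
    then have "\<forall>x. ((\<lambda>x. poly B x - poly B (- x)) has_real_derivative 0) (at x)" by blast
    from DERIV_isconst_all[OF this, of x 0] show ?thesis by simp
  qed
  have k_le: "poly k x \<le> m ^ 4" "poly k x \<le> 1 / x ^ 4" if x: "0 < x" "x \<le> 1" for x
  proof -
    have "\<bar>poly (sine_quotient_poly n) x\<bar> ^ 4 \<le> m ^ 4"
      using abs_sine_quotient_poly_le(1)[of x n] x by (intro power_mono) (auto simp: m_def)
    then show "poly k x \<le> m ^ 4" by (simp add: k_def)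
    have "(\<bar>poly (sine_quotient_poly n) x\<bar> * \<bar>x\<bar>) ^ 4 \<le> 1"
      using abs_sine_quotient_poly_le(2)[of x n] x by (intro power_le_one) auto
    then show "poly k x \<le> 1 / x ^ 4" using x by (simp add: k_def field_simps power_mult_distrib)
  qed
  have A_mono: "poly A x \<le> poly A y" if "x \<le> y" for x y
    using DERIV_nonneg_imp_nondecreasing[OF that, of "poly A"] dA k_nonneg by blast
  \<comment> \<open>For \<open>0 < x < 1 / (2 * m)\<close> the kernel is at least
    \<open>(m / 2) ^ 4\<close>, and \<open>(m / 2) ^ 4 / (2 * m) = m ^ 3 / 32\<close>.\<close>
  have A_lower: "m ^ 3 / 32 \<le> poly A 1"
  proof -
    let ?x = "1 / (2 * m)"
    have "poly A 0 - (m / 2) ^ 4 * 0 \<le> poly A ?x - (m / 2) ^ 4 * ?x"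
    proof (rule DERIV_nonneg_imp_increasing_open[where f = "\<lambda>x. poly A x - (m / 2) ^ 4 * x"])
      fix x assume x: "0 < x" "x < ?x"
      have "m / 2 \<le> poly (sine_quotient_poly n) x"
        using sine_quotient_poly_ge[of x n] x unfolding m_def by simp
      then have "(m / 2) ^ 4 \<le> poly k x"
        unfolding k_def poly_power using m1 by (intro power_mono) auto
      moreover have "((\<lambda>x. poly A x - (m / 2) ^ 4 * x) has_real_derivative poly k x - (m / 2) ^ 4) (at x)"
        by (auto intro!: derivative_eq_intros simp: A(1))
      ultimately show "\<exists>y. ((\<lambda>x. poly A x - (m / 2) ^ 4 * x) has_real_derivative y) (at x) \<and> 0 \<le> y"
        by (intro exI[of _ "poly k x - (m / 2) ^ 4"]) auto
    qed (use m1 in \<open>auto intro!: continuous_intros\<close>)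
    then have "m ^ 3 / 32 \<le> poly A ?x" using m1 A by (simp add: field_simps eval_nat_numeral)
    also have "\<dots> \<le> poly A 1" using m1 by (intro A_mono) (auto simp: field_simps)
    finally show ?thesis .
  qed
  have A_tail: "poly A 1 - poly A s \<le> 1 / (3 * s ^ 3)" if s: "0 < s" "s \<le> 1" for s
  proof -
    have "poly A 1 + 1 / (3 * 1 ^ 3) \<le> poly A s + 1 / (3 * s ^ 3)"
    proof (rule DERIV_nonpos_imp_nonincreasing[OF s(2), where f = "\<lambda>x. poly A x + 1 / (3 * x ^ 3)"])
      fix x assume x: "s \<le> x" "x \<le> 1"
      then have x0: "x > 0" using s by simp
      have "((\<lambda>x. poly A x + 1 / (3 * x ^ 3)) has_real_derivative poly k x - 1 / x ^ 4) (at x)"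
        using x0 by (auto intro!: derivative_eq_intros simp: A(1) field_simps eval_nat_numeral)
      then show "\<exists>y. ((\<lambda>x. poly A x + 1 / (3 * x ^ 3)) has_real_derivative y) (at x) \<and> y \<le> 0"
        using k_le(2)[OF x0 x(2)] by (intro exI[of _ "poly k x - 1 / x ^ 4"]) auto
    qed
    then show ?thesis using s by simp
  qed
  \<comment> \<open>The part up to \<open>1 / m\<close> contributes at most
    \<open>m ^ 4 * (1 / m)\<close>, the tail beyond it at most \<open>m ^ 3 / 3\<close>.\<close>
  have A_upper: "poly A 1 \<le> 4 / 3 * m ^ 3"
  proof -
    have "poly A (1 / m) - m ^ 4 * (1 / m) \<le> poly A 0 - m ^ 4 * 0"
    proof (rule DERIV_nonpos_imp_decreasing_open[where f = "\<lambda>x. poly A x - m ^ 4 * x"])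
      fix x assume x: "0 < x" "x < 1 / m"
      moreover have "1 / m \<le> 1" using m1 by simp
      ultimately have "x \<le> 1" by linarith
      moreover have "((\<lambda>x. poly A x - m ^ 4 * x) has_real_derivative poly k x - m ^ 4) (at x)"
        by (auto intro!: derivative_eq_intros simp: A(1))
      ultimately show "\<exists>y. ((\<lambda>x. poly A x - m ^ 4 * x) has_real_derivative y) (at x) \<and> y \<le> 0"
        using k_le(1)[of x] x by (intro exI[of _ "poly k x - m ^ 4"]) auto
    qed (use m1 in \<open>auto intro!: continuous_intros\<close>)
    then have "poly A (1 / m) \<le> m ^ 3" using m1 A by (simp add: field_simps eval_nat_numeral)
    moreover have "poly A 1 - poly A (1 / m) \<le> m ^ 3 / 3"
      using A_tail[of "1 / m"] m1 by (simp add: power_divide)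
    ultimately show ?thesis by linarith
  qed
  \<comment> \<open>For \<open>s \<ge> 0\<close>, \<open>h s\<close> is \<open>poly A 1\<close>
    times the approximation error. Its derivative is the kernel's mass beyond \<open>s\<close>, so
    \<open>h\<close> grows essentially only while \<open>s\<close> is of order
    \<open>1 / m\<close>.\<close>
  define h where "h s = poly A 1 * s - poly B s" for s
  have dh: "(h has_real_derivative poly A 1 - poly A x) (at x)" for x
    unfolding h_def by (auto intro!: derivative_eq_intros simp: B(1))
  have h0: "h 0 = 0" using B by (simp add: h_def)
  have h_nonneg: "0 \<le> h s" if "0 \<le> s" "s \<le> 1" for s
  proof -
    have "\<exists>y. (h has_real_derivative y) (at x) \<and> 0 \<le> y" if "0 \<le> x" "x \<le> s" for x
      using that \<open>s \<le> 1\<close> A_mono[of x 1] by (intro exI[of _ "poly A 1 - poly A x"] conjI dh) auto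
    from DERIV_nonneg_imp_nondecreasing[OF \<open>0 \<le> s\<close> this] show ?thesis by (simp add: h0)
  qed
  have A_nonneg: "0 \<le> poly A s" if "0 \<le> s" for s
    using A_mono[OF that] A by simp
  have h_small: "h s \<le> 4 / 3 * m ^ 2" if s: "0 \<le> s" "s \<le> 1 / m" for s
  proof -
    have "poly B 0 \<le> poly B s"
      by (rule DERIV_nonneg_imp_nondecreasing[OF s(1)]) (use dB A_nonneg in blast)
    then have "0 \<le> poly B s" using B(3) by simp
    then have "h s \<le> poly A 1 * s" unfolding h_def by linarith
    also have "\<dots> \<le> (4 / 3 * m ^ 3) * (1 / m)"
      using A_upper A_nonneg[of 1] s m1 by (intro mult_mono) auto
    also have "\<dots> = 4 / 3 * m ^ 2" using m1 by (simp add: field_simps eval_nat_numeral)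
    finally show ?thesis .
  qed
  have h_le: "h s \<le> 3 / 2 * m ^ 2" if s: "0 \<le> s" "s \<le> 1" for s
  proof (cases "s \<le> 1 / m")
    case True
    then have "h s \<le> 4 / 3 * m\<^sup>2" by (rule h_small[OF s(1)])
    moreover have "0 \<le> m\<^sup>2" by simp
    ultimately show ?thesis by linarith
  next
    case False
    then have ms: "1 / m \<le> s" by simp
    \<comment> \<open>Beyond \<open>1 / m\<close> the derivative of \<open>h\<close> is at most
      \<open>1 / (3 * x ^ 3)\<close>, whose integral is at most \<open>m ^ 2 / 6\<close>; and
      \<open>4 / 3 + 1 / 6 = 3 / 2\<close>.\<close>
    have "h s + 1 / (6 * s ^ 2) \<le> h (1 / m) + 1 / (6 * (1 / m) ^ 2)"
    proof (rule DERIV_nonpos_imp_nonincreasing[OF ms, where f = "\<lambda>x. h x + 1 / (6 * x ^ 2)"])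
      fix x assume x: "1 / m \<le> x" "x \<le> s"
      then have x0: "x > 0" using m1 by (smt (verit) divide_pos_pos)
      have "((\<lambda>x. h x + 1 / (6 * x ^ 2)) has_real_derivative (poly A 1 - poly A x) - 1 / (3 * x ^ 3)) (at x)"
        using x0 by (auto intro!: derivative_eq_intros dh simp: field_simps eval_nat_numeral)
      then show "\<exists>y. ((\<lambda>x. h x + 1 / (6 * x ^ 2)) has_real_derivative y) (at x) \<and> y \<le> 0"
        using A_tail[of x] x0 x s by (intro exI[of _ "(poly A 1 - poly A x) - 1 / (3 * x ^ 3)"]) auto
    qed
    moreover have "0 \<le> 1 / (6 * s ^ 2)" by simp
    moreover have "1 / (6 * (1 / m) ^ 2) = m ^ 2 / 6" using m1 by (simp add: field_simps)
    moreover have "h (1 / m) \<le> 4 / 3 * m ^ 2" using m1 by (intro h_small) auto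
    ultimately show ?thesis by linarith
  qed
  have A1: "poly A 1 > 0" using A_lower m1 by (smt (verit) divide_pos_pos zero_less_power)
  have main: "\<bar>s - poly B s / poly A 1\<bar> \<le> 48 / m" if s: "0 \<le> s" "s \<le> 1" for s
  proof -
    have "s - poly B s / poly A 1 = h s / poly A 1" using A1 by (simp add: h_def field_simps)
    then have "\<bar>s - poly B s / poly A 1\<bar> = h s / poly A 1" using h_nonneg[OF s] A1 by simp
    also have "\<dots> \<le> (3 / 2 * m ^ 2) / (m ^ 3 / 32)"
      using h_le[OF s] h_nonneg[OF s] A_lower m1 by (intro frac_le) auto
    also have "\<dots> = 48 / m" using m1 by (simp add: field_simps eval_nat_numeral)
    finally show "\<bar>s - poly B s / poly A 1\<bar> \<le> 48 / m" .
  qed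
  show thesis
  proof
    let ?q = "smult (1 / poly A 1) B"
    have "degree k \<le> 8 * n"
      using degree_power_le[of "sine_quotient_poly n" 4] degree_sine_quotient_poly[of n] by (simp add: k_def)
    then show "degree ?q \<le> 8 * n + 2" using A B by auto
    fix s :: real assume "\<bar>s\<bar> \<le> 1"
    then show "\<bar>\<bar>s\<bar> - poly ?q s\<bar> \<le> 48 / real (2 * n + 1)"
      using main[of "\<bar>s\<bar>"] B_even[of s] by (cases "s \<ge> 0") (auto simp: m_def)
  qed
qed

section \<open>The best approximation error is of order \<open>1 / t\<close>\<close>

lemma bdd_above_abs_poly_error: "bdd_above ((\<lambda>s. \<bar>\<bar>s\<bar> - poly q s\<bar>) ` {-1..1::real})"
  by (intro bounded_imp_bdd_above compact_imp_bounded compact_continuous_image continuous_intros) auto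

lemma abs_poly_error_le_SUP:
  fixes s :: real
  shows
  "\<bar>s\<bar> \<le> 1 \<Longrightarrow> \<bar>\<bar>s\<bar> - poly q s\<bar> \<le> (SUP s\<in>{-1..1}. \<bar>\<bar>s\<bar> - poly q s\<bar>)"
  using cSUP_upper[OF _ bdd_above_abs_poly_error, of s q] by (auto simp: abs_le_iff)

lemma abs_poly_error_SUP_nonneg:
  fixes q :: "real poly"
  shows "0 \<le> (SUP s\<in>{-1..1}. \<bar>\<bar>s\<bar> - poly q s\<bar>)"
  using order_trans[OF abs_ge_zero abs_poly_error_le_SUP[of 0 q]] by simp

lemma abs_approx_error_nonneg: "0 \<le> abs_approx_error t"
  unfolding abs_approx_error_def
proof (rule cINF_greatest)
  show "{q :: real poly. degree q \<le> t} \<noteq> {}" by (auto intro!: exI[of _ 0])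
qed (rule abs_poly_error_SUP_nonneg)

lemma abs_approx_error_le:
  assumes "degree q \<le> t" "\<And>s. \<bar>s\<bar> \<le> 1 \<Longrightarrow> \<bar>\<bar>s\<bar> - poly q s\<bar> \<le> e"
  shows "abs_approx_error t \<le> e"
proof -
  have "abs_approx_error t \<le> (SUP s\<in>{-1..1}. \<bar>\<bar>s\<bar> - poly q s\<bar>)"
    unfolding abs_approx_error_def
  proof (rule cINF_lower)
    show "bdd_below ((\<lambda>q. SUP s\<in>{-1..1}. \<bar>\<bar>s\<bar> - poly q s\<bar>) ` {q :: real poly. degree q \<le> t})"
      by (rule bdd_belowI[of _ 0]) (auto intro: abs_poly_error_SUP_nonneg)
  qed (use assms in auto)
  also have "\<dots> \<le> e" using assms(2) by (intro cSUP_least) auto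
  finally show ?thesis .
qed

lemma abs_approx_error_bigo:
  assumes "t \<ge> 1"
  shows "abs_approx_error t \<le> 480 / real t"
proof (cases "t \<ge> 2")
  case True
  \<comment> \<open>The largest \<open>n\<close> with \<open>8 * n + 2 \<le> t\<close>. Then
    \<open>t \<le> 8 * n + 9\<close>, which \<open>10 * (2 * n + 1)\<close> dominates, and 480 is 10
    times 48.\<close>
  define n where "n = (t - 2) div 8"
  have n: "8 * n + 2 \<le> t" "t \<le> 10 * (2 * n + 1)" using True by (auto simp: n_def)
  obtain q :: "real poly" where "degree q \<le> 8 * n + 2" "\<And>s. \<bar>s\<bar> \<le> 1 \<Longrightarrow> \<bar>\<bar>s\<bar> - poly q s\<bar> \<le> 48 / real (2 * n + 1)"
    using abs_poly_approx[of n] by blast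
  then have "abs_approx_error t \<le> 48 / real (2 * n + 1)"
    using n by (intro abs_approx_error_le[of q]) auto
  also have "\<dots> \<le> 480 / real t"
  proof -
    have "real t \<le> 10 * real (2 * n + 1)" using n(2) by (metis of_nat_le_iff of_nat_mult of_nat_numeral)
    then show ?thesis using True by (simp add: field_simps)
  qed
  finally show ?thesis .
next
  case False
  then have "t = 1" using assms by simp
  moreover have "abs_approx_error t \<le> 1" by (rule abs_approx_error_le[of 0]) auto
  ultimately show ?thesis by simp
qed

section \<open>Averages over spherical designs\<close>

lemma poly_of_degree_le_mono:
  assumes "poly_of_degree_le s p" "s \<le> t"
  shows "poly_of_degree_le t p"
proof -
  obtain a :: "('a \<Rightarrow> nat) \<Rightarrow> real" where
    a: "\<And>x. p x = (\<Sum>\<alpha> | (\<Sum>i\<in>UNIV. \<alpha> i) \<le> s. a \<alpha> * (\<Prod>i\<in>UNIV. (x $ i) ^ \<alpha> i))"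
    using assms(1) by (auto simp: poly_of_degree_le_def)
  have "p x = (\<Sum>\<alpha> | (\<Sum>i\<in>UNIV. \<alpha> i) \<le> t. (if (\<Sum>i\<in>UNIV. \<alpha> i) \<le> s then a \<alpha> else 0) * (\<Prod>i\<in>UNIV. (x $ i) ^ \<alpha> i))" for x
    unfolding a using assms(2)
    by (intro sum.mono_neutral_cong_left) (auto simp: finite_multi_indices)
  then show ?thesis unfolding poly_of_degree_le_def
    by (intro exI[of _ "\<lambda>\<alpha>. if (\<Sum>i\<in>UNIV. \<alpha> i) \<le> s then a \<alpha> else 0"]) blast
qed

lemma poly_of_degree_le_add:
  assumes "poly_of_degree_le t p" "poly_of_degree_le t q"
  shows "poly_of_degree_le t (\<lambda>x. p x + q x)"
proof -
  obtain a b :: "('a \<Rightarrow> nat) \<Rightarrow> real" where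
    a: "\<And>x. p x = (\<Sum>\<alpha> | (\<Sum>i\<in>UNIV. \<alpha> i) \<le> t. a \<alpha> * (\<Prod>i\<in>UNIV. (x $ i) ^ \<alpha> i))" and
    b: "\<And>x. q x = (\<Sum>\<alpha> | (\<Sum>i\<in>UNIV. \<alpha> i) \<le> t. b \<alpha> * (\<Prod>i\<in>UNIV. (x $ i) ^ \<alpha> i))"
    using assms by (auto simp: poly_of_degree_le_def)
  have "p x + q x = (\<Sum>\<alpha> | (\<Sum>i\<in>UNIV. \<alpha> i) \<le> t. (a \<alpha> + b \<alpha>) * (\<Prod>i\<in>UNIV. (x $ i) ^ \<alpha> i))" for x
    unfolding a b by (simp add: sum.distrib algebra_simps)
  then show ?thesis unfolding poly_of_degree_le_def by (intro exI[of _ "\<lambda>\<alpha>. a \<alpha> + b \<alpha>"]) blast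
qed

lemma poly_of_degree_le_cmult:
  assumes "poly_of_degree_le t p"
  shows "poly_of_degree_le t (\<lambda>x. c * p x)"
proof -
  obtain a :: "('a \<Rightarrow> nat) \<Rightarrow> real" where
    a: "\<And>x. p x = (\<Sum>\<alpha> | (\<Sum>i\<in>UNIV. \<alpha> i) \<le> t. a \<alpha> * (\<Prod>i\<in>UNIV. (x $ i) ^ \<alpha> i))"
    using assms by (auto simp: poly_of_degree_le_def)
  have "c * p x = (\<Sum>\<alpha> | (\<Sum>i\<in>UNIV. \<alpha> i) \<le> t. (c * a \<alpha>) * (\<Prod>i\<in>UNIV. (x $ i) ^ \<alpha> i))" for x
    unfolding a by (simp add: sum_distrib_left mult.assoc)
  then show ?thesis unfolding poly_of_degree_le_def by (intro exI[of _ "\<lambda>\<alpha>. c * a \<alpha>"]) blast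
qed

lemma poly_of_degree_le_const: "poly_of_degree_le t (\<lambda>x :: real^'n. c)"
proof -
  have "poly_of_degree_le 0 (\<lambda>x :: real^'n. c)"
    unfolding poly_of_degree_le_def
  proof (intro exI[of _ "\<lambda>\<alpha>. c"] allI)
    fix x :: "real^'n"
    have "{\<alpha> :: 'n \<Rightarrow> nat. (\<Sum>i\<in>UNIV. \<alpha> i) \<le> 0} = {\<lambda>i. 0}" by auto
    then show "c = (\<Sum>\<alpha> | (\<Sum>i\<in>UNIV. \<alpha> i) \<le> 0. c * (\<Prod>i\<in>UNIV. (x $ i) ^ \<alpha> i))" by simp
  qed
  then show ?thesis by (rule poly_of_degree_le_mono) simp
qed

lemma poly_of_degree_le_sum:
  assumes "finite A" "\<And>j. j \<in> A \<Longrightarrow> poly_of_degree_le t (p j)"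
  shows "poly_of_degree_le t (\<lambda>x. \<Sum>j\<in>A. p j x)"
  using assms by (induction A rule: finite_induct) (auto intro: poly_of_degree_le_add poly_of_degree_le_const)

lemma poly_of_degree_le_mult_component:
  fixes p :: "real^'n \<Rightarrow> real"
  assumes "poly_of_degree_le t p"
  shows "poly_of_degree_le (Suc t) (\<lambda>x. x $ j * p x)"
proof -
  obtain a :: "('n \<Rightarrow> nat) \<Rightarrow> real" where
    a: "\<And>x. p x = (\<Sum>\<alpha> | (\<Sum>i\<in>UNIV. \<alpha> i) \<le> t. a \<alpha> * (\<Prod>i\<in>UNIV. (x $ i) ^ \<alpha> i))"
    using assms by (auto simp: poly_of_degree_le_def)
  define up :: "('n \<Rightarrow> nat) \<Rightarrow> 'n \<Rightarrow> nat" where "up \<alpha> = \<alpha>(j := Suc (\<alpha> j))" for \<alpha>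
  define down :: "('n \<Rightarrow> nat) \<Rightarrow> 'n \<Rightarrow> nat" where "down \<alpha> = \<alpha>(j := \<alpha> j - 1)" for \<alpha>
  have down_up: "down (up \<alpha>) = \<alpha>" for \<alpha> by (simp add: up_def down_def)
  then have inj: "inj_on up A" for A by (metis inj_on_inverseI)
  have sum_up: "(\<Sum>i\<in>UNIV. up \<alpha> i) = Suc (\<Sum>i\<in>UNIV. \<alpha> i)" for \<alpha>
    by (simp add: up_def sum.remove[of UNIV j])
  have prod_up: "(\<Prod>i\<in>UNIV. (x $ i) ^ up \<alpha> i) = x $ j * (\<Prod>i\<in>UNIV. (x $ i) ^ \<alpha> i)" for x :: "real^'n" and \<alpha>
    by (simp add: up_def prod.remove[of UNIV j])
  let ?S = "{\<alpha> :: 'n \<Rightarrow> nat. (\<Sum>i\<in>UNIV. \<alpha> i) \<le> t}" and ?S' = "{\<alpha> :: 'n \<Rightarrow> nat. (\<Sum>i\<in>UNIV. \<alpha> i) \<le> Suc t}"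
  \<comment> \<open>Coefficients are carried along the injection \<open>up\<close>; the truncated
    subtraction in \<open>down\<close> is harmless, because only values of \<open>down\<close> on
    the image of \<open>up\<close> enter.\<close>
  define b where "b \<beta> = (if \<beta> \<in> up ` ?S then a (down \<beta>) else 0)" for \<beta>
  have "x $ j * p x = (\<Sum>\<beta>\<in>?S'. b \<beta> * (\<Prod>i\<in>UNIV. (x $ i) ^ \<beta> i))" for x
  proof -
    have "x $ j * p x = (\<Sum>\<alpha>\<in>?S. b (up \<alpha>) * (\<Prod>i\<in>UNIV. (x $ i) ^ up \<alpha> i))"
      unfolding a sum_distrib_left prod_up by (intro sum.cong) (auto simp: b_def down_up mult_ac)
    also have "\<dots> = (\<Sum>\<beta>\<in>up ` ?S. b \<beta> * (\<Prod>i\<in>UNIV. (x $ i) ^ \<beta> i))"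
      by (subst sum.reindex[OF inj]) simp
    also have "\<dots> = (\<Sum>\<beta>\<in>?S'. b \<beta> * (\<Prod>i\<in>UNIV. (x $ i) ^ \<beta> i))"
      by (intro sum.mono_neutral_left) (auto simp: finite_multi_indices sum_up b_def)
    finally show ?thesis .
  qed
  then show ?thesis unfolding poly_of_degree_le_def by (intro exI[of _ b]) blast
qed

lemma poly_of_degree_le_inner_power:
  fixes u :: "real^'n"
  shows "poly_of_degree_le k (\<lambda>x. (x \<bullet> u) ^ k)"
proof (induction k)
  case 0
  show ?case using poly_of_degree_le_const[of 0 1] by simp
next
  case (Suc k)
  have "(x \<bullet> u) ^ Suc k = (\<Sum>i\<in>UNIV. u $ i * (x $ i * (x \<bullet> u) ^ k))" for x
    by (simp add: inner_vec_def[of x u] sum_distrib_right mult_ac)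
  moreover have "poly_of_degree_le (Suc k) (\<lambda>x. \<Sum>i\<in>UNIV. u $ i * (x $ i * (x \<bullet> u) ^ k))"
    by (intro poly_of_degree_le_sum poly_of_degree_le_cmult poly_of_degree_le_mult_component Suc) simp
  ultimately show ?case by simp
qed

lemma poly_of_degree_le_poly_inner:
  fixes u :: "real^'n"
  assumes "degree q \<le> t"
  shows "poly_of_degree_le t (\<lambda>x. poly q (x \<bullet> u))"
  unfolding poly_altdef using assms
  by (intro poly_of_degree_le_sum poly_of_degree_le_cmult poly_of_degree_le_mono[OF poly_of_degree_le_inner_power]) auto

section \<open>Deviation of design means from spherical means\<close>

text \<open>Tested on the constant 1: for an empty \<open>X\<close> the mean would be 0, by
  \<open>1 / 0 = 0\<close> and the empty sum, but the integral is 1.\<close>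

lemma spherical_design_nonempty:
  fixes \<sigma> :: "(real^'n) measure"
  assumes "uniform_sphere_measure \<sigma>" "spherical_design \<sigma> t X"
  shows "card X > 0"
proof -
  interpret prob_space \<sigma> using assms(1) by (simp add: uniform_sphere_measure_def)
  have "(1 / real (card X)) * (\<Sum>x\<in>X. 1) = (\<integral>x. 1 \<partial>\<sigma>)"
    using assms(2) poly_of_degree_le_const[of t 1] unfolding spherical_design_def by blast
  then have "card X \<noteq> 0" by (auto simp: prob_space split: if_splits)
  then show ?thesis by simp
qed

text \<open>Design mean and integral agree on \<open>poly q (x \<bullet> u)\<close>, so the
  deviation is at most the error of \<open>q\<close> in the mean plus its error in the integral.
  Half the deviation is therefore below the uniform error of every admissible \<open>q\<close>,
  hence below the infimum.\<close>

lemma design_mean_abs_inner: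
  fixes \<sigma> :: "(real^'n) measure"
  assumes d: "CARD('n) \<ge> 2" and \<sigma>: "uniform_sphere_measure \<sigma>" and X: "spherical_design \<sigma> t X" and u: "norm u = 1"
  shows "\<bar>(1 / real (card X)) * (\<Sum>x\<in>X. \<bar>x \<bullet> u\<bar>) - c1 CARD('n)\<bar> \<le> 2 * abs_approx_error t"
proof -
  interpret prob_space \<sigma> using \<sigma> by (simp add: uniform_sphere_measure_def)
  let ?m = "\<lambda>f :: real^'n \<Rightarrow> real. (1 / real (card X)) * (\<Sum>x\<in>X. f x)"
  let ?D = "\<bar>?m (\<lambda>x. \<bar>x \<bullet> u\<bar>) - c1 CARD('n)\<bar>"
  have N: "card X > 0" by (rule spherical_design_nonempty[OF \<sigma> X])
  have "?D / 2 \<le> (SUP s\<in>{-1..1}. \<bar>\<bar>s\<bar> - poly q s\<bar>)" if q: "degree q \<le> t" for q :: "real poly"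
  proof -
    let ?e = "SUP s\<in>{-1..1}. \<bar>\<bar>s\<bar> - poly q s\<bar>"
    have inner_le: "\<bar>x \<bullet> u\<bar> \<le> 1" if "norm x = 1" for x
      using Cauchy_Schwarz_ineq2[of x u] that u by simp
    have err: "\<bar>\<bar>x \<bullet> u\<bar> - poly q (x \<bullet> u)\<bar> \<le> ?e" if "norm x = 1" for x
      using inner_le[OF that] by (rule abs_poly_error_le_SUP)
    have exact: "?m (\<lambda>x. poly q (x \<bullet> u)) = (\<integral>x. poly q (x \<bullet> u) \<partial>\<sigma>)"
      using X poly_of_degree_le_poly_inner[OF q, of u] unfolding spherical_design_def by blast
    have err_m: "\<bar>?m (\<lambda>x. \<bar>x \<bullet> u\<bar>) - ?m (\<lambda>x. poly q (x \<bullet> u))\<bar> \<le> ?e"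
    proof -
      have "\<bar>(\<Sum>x\<in>X. \<bar>x \<bullet> u\<bar>) - (\<Sum>x\<in>X. poly q (x \<bullet> u))\<bar> \<le> (\<Sum>x\<in>X. \<bar>\<bar>x \<bullet> u\<bar> - poly q (x \<bullet> u)\<bar>)"
        unfolding sum_subtractf[symmetric] by (rule sum_abs)
      also have "\<dots> \<le> real (card X) * ?e"
        using X by (intro sum_bounded_above err) (auto simp: spherical_design_def)
      finally show ?thesis
        using N unfolding right_diff_distrib[symmetric] by (simp add: abs_mult divide_le_eq mult.commute)
    qed
    have err_int: "\<bar>(\<integral>x. poly q (x \<bullet> u) \<partial>\<sigma>) - (\<integral>x. \<bar>x \<bullet> u\<bar> \<partial>\<sigma>)\<bar> \<le> ?e"
    proof -
      have meas: "(\<lambda>x. poly q (x \<bullet> u)) \<in> borel_measurable \<sigma>" "(\<lambda>x. \<bar>x \<bullet> u\<bar>) \<in> borel_measurable \<sigma>"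
        by (intro borel_measurable_uniform_sphere[OF \<sigma>] borel_measurable_continuous_onI continuous_intros)+
      have bound: "AE x in \<sigma>. \<bar>x \<bullet> u\<bar> \<le> 1"
        using inner_le by (intro AE_I2) (simp add: space_uniform_sphere[OF \<sigma>])
      have "integrable \<sigma> (\<lambda>x. \<bar>x \<bullet> u\<bar>)"
        by (rule integrable_const_bound[OF _ meas(2), of 1]) (use bound in simp)
      moreover have "integrable \<sigma> (\<lambda>x. poly q (x \<bullet> u))"
      proof (rule integrable_const_bound[OF _ meas(1), of "1 + ?e"])
        show "AE x in \<sigma>. norm (poly q (x \<bullet> u)) \<le> 1 + ?e"
        proof (rule AE_I2)
          fix x assume "x \<in> space \<sigma>"
          then have "norm x = 1" by (simp add: space_uniform_sphere[OF \<sigma>])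
          then show "norm (poly q (x \<bullet> u)) \<le> 1 + ?e"
            using err[of x] inner_le[of x] unfolding real_norm_def by linarith
        qed
      qed
      ultimately have int: "integrable \<sigma> (\<lambda>x. \<bar>x \<bullet> u\<bar>)" "integrable \<sigma> (\<lambda>x. poly q (x \<bullet> u))" by blast+
      then have diff: "integrable \<sigma> (\<lambda>x. poly q (x \<bullet> u) - \<bar>x \<bullet> u\<bar>)" by (rule Bochner_Integration.integrable_diff[rotated])
      have "poly q (x \<bullet> u) - \<bar>x \<bullet> u\<bar> \<le> ?e" "- ?e \<le> poly q (x \<bullet> u) - \<bar>x \<bullet> u\<bar>" if "x \<in> space \<sigma>" for x
        using err[of x] that unfolding abs_le_iff by (simp_all add: space_uniform_sphere[OF \<sigma>])
      then have "AE x in \<sigma>. poly q (x \<bullet> u) - \<bar>x \<bullet> u\<bar> \<le> ?e" "AE x in \<sigma>. - ?e \<le> poly q (x \<bullet> u) - \<bar>x \<bullet> u\<bar>"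
        by (auto intro!: AE_I2)
      from integral_le_const[OF diff this(1)] integral_ge_const[OF diff this(2)]
      show ?thesis unfolding Bochner_Integration.integral_diff[OF int(2,1)] by (intro abs_leI) linarith+
    qed
    have "\<bar>a - c\<bar> / 2 \<le> e" if "b = i" "\<bar>a - b\<bar> \<le> e" "\<bar>i - j\<bar> \<le> e" "j = c" for a b c e i j :: real
      using that abs_triangle_ineq[of "a - b" "b - c"] by simp
    from this[OF exact err_m err_int integral_abs_inner_sphere[OF d \<sigma> u]] show ?thesis .
  qed
  then have "?D / 2 \<le> abs_approx_error t"
    unfolding abs_approx_error_def by (intro cINF_greatest) (auto intro!: exI[of _ 0])
  then show ?thesis by simp
qed


section \<open>From polytopes to convex bodies\<close>

lemma le_if_le_power_mult:
  fixes a b :: real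
  assumes "\<And>s. s > 1 \<Longrightarrow> a \<le> s ^ k * b"
  shows "a \<le> b"
proof -
  have "((\<lambda>s. s ^ k * b) \<longlongrightarrow> 1 ^ k * b) (at_right 1)" by (intro tendsto_intros)
  moreover have "\<forall>\<^sub>F s in at_right 1. a \<le> s ^ k * b"
    using assms by (intro eventually_at_rightI[of 1 2]) auto
  ultimately have "a \<le> 1 ^ k * b" by (intro tendsto_lowerbound) auto
  then show ?thesis by simp
qed

text \<open>The second claim is there because \<open>enn2real\<close> sends infinity to 0, so that
  it is monotone only below finite values; comparing the projections of a body and of the polytope
  relies on it.\<close>

lemma (in irredundant_polytope) design_mean_projections_polytope:
  fixes \<sigma> :: "(real^'n) measure"
  assumes d: "CARD('n) \<ge> 2" and \<sigma>: "uniform_sphere_measure \<sigma>" and X: "spherical_design \<sigma> t X"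
    and fin: "hausdorff_measure k (frontier (halfspaces I)) < \<infinity>"
  defines "S \<equiv> enn2real (hausdorff_measure k (frontier (halfspaces I)))"
    and "V \<equiv> \<lambda>x. hausdorff_measure k (proj_hyperplane x ` halfspaces I)"
  shows "\<bar>2 * ((1 / real (card X)) * (\<Sum>x\<in>X. enn2real (V x))) - c1 CARD('n) * S\<bar> \<le> 2 * abs_approx_error t * S"
    and "x \<in> X \<Longrightarrow> V x < \<infinity>"
proof -
  define h where "h i = enn2real (hausdorff_measure k (facet i))" for i
  have sum_fin: "(\<Sum>i\<in>I. hausdorff_measure k (facet i)) < top" using fin by (simp add: hausdorff_measure_frontier)
  then have h: "hausdorff_measure k (facet i) = ennreal (h i)" if "i \<in> I" for i
    using that finite by (simp add: h_def less_top)
  have h0: "0 \<le> h i" for i by (simp add: h_def)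
  have S: "S = (\<Sum>i\<in>I. h i)"
    unfolding S_def hausdorff_measure_frontier using h h0 by (simp add: sum_ennreal sum_nonneg)
  have norm_x: "norm x = 1" if "x \<in> X" for x using X that by (auto simp: spherical_design_def)
  have V2: "2 * V x = ennreal (\<Sum>i\<in>I. \<bar>x \<bullet> fst i\<bar> * h i)" if "x \<in> X" for x
  proof -
    have "2 * V x = (\<Sum>i\<in>I. ennreal (\<bar>x \<bullet> fst i\<bar> * h i))"
      unfolding V_def hausdorff_measure_proj[OF norm_x[OF that] d] using h h0
      by (intro sum.cong) (simp_all add: ennreal_mult)
    then show ?thesis using h0 by (simp add: sum_ennreal)
  qed
  show V_fin: "V x < \<infinity>" if "x \<in> X" for x
  proof (rule ccontr)
    assume "\<not> V x < \<infinity>"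
    then have "V x = top" by (metis infinity_ennreal_def less_top)
    then have "2 * V x = top" by (simp add: ennreal_mult_top)
    then show False using V2[OF that] by simp
  qed
  have V: "2 * enn2real (V x) = (\<Sum>i\<in>I. \<bar>x \<bullet> fst i\<bar> * h i)" if "x \<in> X" for x
  proof -
    have "enn2real (2 * V x) = 2 * enn2real (V x)" by (simp add: enn2real_mult)
    then show ?thesis using V2[OF that] h0 by (simp add: sum_nonneg)
  qed
  let ?m = "\<lambda>i. (1 / real (card X)) * (\<Sum>x\<in>X. \<bar>x \<bullet> fst i\<bar>)"
  have "2 * ((1 / real (card X)) * (\<Sum>x\<in>X. enn2real (V x))) = (1 / real (card X)) * (\<Sum>x\<in>X. 2 * enn2real (V x))"
    by (simp add: sum_distrib_left)
  also have "\<dots> = (1 / real (card X)) * (\<Sum>x\<in>X. \<Sum>i\<in>I. \<bar>x \<bullet> fst i\<bar> * h i)"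
    using V by simp
  also have "\<dots> = (\<Sum>i\<in>I. ?m i * h i)"
    by (subst sum.swap) (simp add: sum_distrib_left sum_distrib_right mult.assoc)
  finally have "2 * ((1 / real (card X)) * (\<Sum>x\<in>X. enn2real (V x))) - c1 CARD('n) * S = (\<Sum>i\<in>I. (?m i - c1 CARD('n)) * h i)"
    by (simp add: S sum_distrib_left sum_subtractf left_diff_distrib)
  also have "\<bar>\<dots>\<bar> \<le> (\<Sum>i\<in>I. \<bar>(?m i - c1 CARD('n)) * h i\<bar>)" by (rule sum_abs)
  also have "\<dots> \<le> (\<Sum>i\<in>I. 2 * abs_approx_error t * h i)"
    unfolding abs_mult using h0 design_mean_abs_inner[OF d \<sigma> X norm_1]
    by (intro sum_mono mult_mono) (auto simp: abs_approx_error_nonneg)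
  finally show "\<bar>2 * ((1 / real (card X)) * (\<Sum>x\<in>X. enn2real (V x))) - c1 CARD('n) * S\<bar> \<le> 2 * abs_approx_error t * S"
    by (simp add: S sum_distrib_left)
qed

lemma design_mean_projections:
  fixes \<sigma> :: "(real^'n) measure" and K :: "(real^'n) set"
  assumes d: "CARD('n) \<ge> 2" and \<sigma>: "uniform_sphere_measure \<sigma>" and X: "spherical_design \<sigma> t X"
    and K: "K \<in> convex_bodies" and fin: "hausdorff_measure (CARD('n) - 1) (frontier K) < \<infinity>"
  shows "\<bar>2 * ((1 / real (card X)) * (\<Sum>x\<in>X. hyper_volume (proj_hyperplane x ` K))) - c1 CARD('n) * surface_area K\<bar>
    \<le> 2 * abs_approx_error t * surface_area K"
proof -
  define k where "k = CARD('n) - 1"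
  let ?H = "hausdorff_measure k :: (real^'n) set \<Rightarrow> ennreal"
  let ?c = "c1 CARD('n)" and ?E = "abs_approx_error t" and ?S = "surface_area K"
  define m where "m f = 2 * ((1 / real (card X)) * (\<Sum>x\<in>X. f x))" for f :: "real^'n \<Rightarrow> real"
  let ?M = "m (\<lambda>x. hyper_volume (proj_hyperplane x ` K))"
  have m_mono: "m f \<le> m g" if "\<And>x. x \<in> X \<Longrightarrow> f x \<le> g x" for f g
    using that by (auto simp: m_def intro!: mult_left_mono sum_mono divide_right_mono)
  have m_scale: "m (\<lambda>x. s * f x) = s * m f" for s f
    by (simp add: m_def sum_distrib_left[symmetric])
  obtain p where "compact K" "convex K" "p \<in> interior K" using K by (auto simp: convex_bodies_def)
  note K = this
  have S0: "0 \<le> ?S" by (simp add: surface_area_def hyper_volume_def)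
  have M0: "0 \<le> ?M" by (simp add: m_def hyper_volume_def sum_nonneg)
  \<comment> \<open>Each one-sided bound passes from \<open>K\<close> to the polytope and back at
    the cost of a single factor \<open>s ^ k\<close>; \<open>k\<close> is the degree of homogeneity
    of surface area and of projection volume alike.\<close>
  have main: "?M \<le> s ^ k * ((?c + 2 * ?E) * ?S) \<and> (?c - 2 * ?E) * ?S \<le> s ^ k * ?M" if s: "s > 1" for s
  proof -
    have s0: "s > 0" using s by simp
    obtain I where I: "irredundant_polytope I p" "K \<subseteq> halfspaces I" "halfspaces I \<subseteq> dilation p s ` K"
      using irredundant_polytope_between[OF K s] by blast
    interpret irredundant_polytope I p by (rule I(1))
    let ?P = "halfspaces I"
    let ?SP = "enn2real (?H (frontier ?P))" and ?V = "\<lambda>x. enn2real (?H (proj_hyperplane x ` ?P))"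
    have compact_P: "compact ?P" using bounded closed_halfspaces by (simp add: compact_eq_bounded_closed)
    have scale: "?H (f ` dilation p s ` A) \<le> ennreal (s ^ k) * ?H (f ` A)"
      if "\<And>x y. dist (f (dilation p s x)) (f (dilation p s y)) = s * dist (f x) (f y)" for f and A :: "(real^'n) set"
      using hausdorff_measure_image_le[OF s0, of A "\<lambda>x. f (dilation p s x)" f k] that by (simp add: image_image)
    have "?H (frontier ?P) \<le> ?H (frontier (dilation p s ` K))"
    proof (rule hausdorff_measure_frontier_mono[OF compact_P convex_halfspaces _ _ I(3)])
      show "interior ?P \<noteq> {}" using K(3) interior_mono[OF I(2)] by blast
    qed (rule compact_dilation[OF K(1)])
    also have "\<dots> \<le> ?H (dilation p s ` frontier K)"
      by (intro hausdorff_measure_mono frontier_dilation_subset K s0)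
    also have "\<dots> \<le> ennreal (s ^ k) * ?H (frontier K)"
      using scale[of "\<lambda>x. x" "frontier K"] by (simp add: dist_dilation[OF s0])
    finally have SP_le: "?H (frontier ?P) \<le> ennreal (s ^ k) * ?H (frontier K)" .
    have fin_scaled: "ennreal (s ^ k) * ?H (frontier K) < \<infinity>"
      using fin by (simp add: k_def ennreal_mult_less_top)
    then have fin_P: "?H (frontier ?P) < \<infinity>" using SP_le by (rule le_less_trans[rotated])
    have "?SP \<le> enn2real (ennreal (s ^ k) * ?H (frontier K))"
      using SP_le fin_scaled by (intro enn2real_mono) auto
    then have SP_upper: "?SP \<le> s ^ k * ?S"
      using s0 by (simp add: enn2real_mult surface_area_def hyper_volume_def k_def)
    have "?H (frontier K) \<le> ?H (frontier ?P)"
      using K by (intro hausdorff_measure_frontier_mono compact_P I(2)) auto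
    then have SP_lower: "?S \<le> ?SP"
      using fin_P unfolding surface_area_def hyper_volume_def k_def[symmetric] by (intro enn2real_mono) auto
    have V_fin: "?H (proj_hyperplane x ` ?P) < \<infinity>" if "x \<in> X" for x
      by (rule design_mean_projections_polytope(2)[OF d \<sigma> X fin_P that])
    have V_lower: "hyper_volume (proj_hyperplane x ` K) \<le> ?V x" if "x \<in> X" for x
      using V_fin[OF that] I(2) unfolding hyper_volume_def k_def[symmetric]
      by (intro enn2real_mono hausdorff_measure_mono image_mono) auto
    have V_upper: "?V x \<le> s ^ k * hyper_volume (proj_hyperplane x ` K)" if "x \<in> X" for x
    proof -
      have "?H (proj_hyperplane x ` ?P) \<le> ?H (proj_hyperplane x ` dilation p s ` K)"
        by (intro hausdorff_measure_mono image_mono I(3))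
      also have "\<dots> \<le> ennreal (s ^ k) * ?H (proj_hyperplane x ` K)"
      proof (rule scale)
        fix y z
        have "dilation p s y - dilation p s z = s *\<^sub>R (y - z)" by (simp add: dilation_def algebra_simps)
        then show "dist (proj_hyperplane x (dilation p s y)) (proj_hyperplane x (dilation p s z))
            = s * dist (proj_hyperplane x y) (proj_hyperplane x z)"
          using s0 by (simp add: dist_norm linear_diff[OF linear_proj_hyperplane, symmetric] linear_scale[OF linear_proj_hyperplane])
      qed
      finally have le: "?H (proj_hyperplane x ` ?P) \<le> ennreal (s ^ k) * ?H (proj_hyperplane x ` K)" .
      have "?H (proj_hyperplane x ` K) < \<infinity>"
        using V_fin[OF that] hausdorff_measure_mono[OF image_mono[OF I(2)]] by (rule le_less_trans[rotated])
      then have "?V x \<le> enn2real (ennreal (s ^ k) * ?H (proj_hyperplane x ` K))"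
        using le by (intro enn2real_mono) (auto simp: ennreal_mult_less_top)
      then show ?thesis using s0 by (simp add: enn2real_mult hyper_volume_def k_def)
    qed
    have est: "\<bar>m ?V - ?c * ?SP\<bar> \<le> 2 * ?E * ?SP"
      unfolding m_def by (rule design_mean_projections_polytope(1)[OF d \<sigma> X fin_P])
    have cE: "0 \<le> ?c + 2 * ?E" using c1_pos[of "CARD('n)"] abs_approx_error_nonneg[of t] by simp
    have "?M \<le> m ?V" by (rule m_mono[OF V_lower])
    also have "\<dots> \<le> (?c + 2 * ?E) * ?SP" using est by (simp add: algebra_simps abs_le_iff)
    also have "\<dots> \<le> (?c + 2 * ?E) * (s ^ k * ?S)" by (rule mult_left_mono[OF SP_upper cE])
    finally have upper: "?M \<le> s ^ k * ((?c + 2 * ?E) * ?S)" by (simp add: mult.left_commute)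
    have lower: "(?c - 2 * ?E) * ?S \<le> s ^ k * ?M"
    \<comment> \<open>\<open>?S \<le> ?SP\<close> may be multiplied only by a nonnegative factor;
      for \<open>?c < 2 * ?E\<close> the left-hand side is at most 0 and the claim is
      trivial.\<close>
    proof (cases "0 \<le> ?c - 2 * ?E")
      case True
      then have "(?c - 2 * ?E) * ?S \<le> (?c - 2 * ?E) * ?SP" by (rule mult_left_mono[OF SP_lower])
      also have "\<dots> \<le> m ?V" using est by (simp add: algebra_simps abs_le_iff)
      also have "\<dots> \<le> m (\<lambda>x. s ^ k * hyper_volume (proj_hyperplane x ` K))" by (rule m_mono[OF V_upper])
      finally show ?thesis by (simp only: m_scale)
    next
      case False
      then have "(?c - 2 * ?E) * ?S \<le> 0" using S0 by (intro mult_nonpos_nonneg) auto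
      also have "0 \<le> s ^ k * ?M" using s0 M0 by simp
      finally show ?thesis .
    qed
    show ?thesis using upper lower by blast
  qed
  have "?M \<le> (?c + 2 * ?E) * ?S" by (rule le_if_le_power_mult) (rule main[THEN conjunct1])
  moreover have "(?c - 2 * ?E) * ?S \<le> ?M" by (rule le_if_le_power_mult) (rule main[THEN conjunct2])
  ultimately have "\<bar>?M - ?c * ?S\<bar> \<le> 2 * ?E * ?S" unfolding abs_le_iff by (simp add: algebra_simps)
  then show ?thesis by (simp only: m_def)
qed

lemma relative_error_surface_estimate:
  fixes \<sigma> :: "(real^'n) measure" and K :: "(real^'n) set"
  assumes d: "CARD('n) \<ge> 2" and \<sigma>: "uniform_sphere_measure \<sigma>" and X: "spherical_design \<sigma> t X"
    and K: "K \<in> convex_bodies"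
  shows "\<bar>surface_estimate X K - surface_area K\<bar> / surface_area K \<le> 2 * abs_approx_error t / c1 CARD('n)"
proof (cases "surface_area K = 0")
  case True
  then show ?thesis using c1_pos[of "CARD('n)"] abs_approx_error_nonneg[of t] by simp
next
  case False
  let ?M = "2 * ((1 / real (card X)) * (\<Sum>x\<in>X. hyper_volume (proj_hyperplane x ` K)))" and ?S = "surface_area K"
  let ?c = "c1 CARD('n)"
  have S: "?S > 0" using False by (simp add: surface_area_def hyper_volume_def less_le)
  have c: "?c > 0" by (rule c1_pos) simp
  have "hausdorff_measure (CARD('n) - 1) (frontier K) < \<infinity>"
    using False unfolding surface_area_def hyper_volume_def by (metis enn2real_top infinity_ennreal_def less_top)
  from design_mean_projections[OF d \<sigma> X K this]
  have "\<bar>?M - ?c * ?S\<bar> / (?c * ?S) \<le> 2 * abs_approx_error t * ?S / (?c * ?S)"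
    using S c by (intro divide_right_mono) auto
  moreover have "surface_estimate X K = ?M / ?c" by (simp add: surface_estimate_def)
  then have "surface_estimate X K - ?S = (?M - ?c * ?S) / ?c" using c by (simp add: field_simps)
  then have "\<bar>surface_estimate X K - ?S\<bar> / ?S = \<bar>?M - ?c * ?S\<bar> / (?c * ?S)" using c by (simp add: abs_divide)
  moreover have "2 * abs_approx_error t * ?S / (?c * ?S) = 2 * abs_approx_error t / ?c" using S by simp
  ultimately show ?thesis by (simp only:)
qed

theorem corollary6p2:
  assumes "CARD('n::finite) \<ge> 2"
  shows "(\<forall>(\<sigma> :: (real^'n) measure) t X.
           uniform_sphere_measure \<sigma> \<longrightarrow> spherical_design \<sigma> t X \<longrightarrow>
           (\<forall>K \<in> convex_bodies.
              \<bar>surface_estimate X K - surface_area K\<bar> / surface_area K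
                \<le> 2 * abs_approx_error t / c1 CARD('n))) \<and>
         (\<exists>C::real. \<forall>(\<sigma> :: (real^'n) measure) t X.
           uniform_sphere_measure \<sigma> \<longrightarrow> t \<ge> 1 \<longrightarrow> spherical_design \<sigma> t X \<longrightarrow>
           (SUP K \<in> convex_bodies. ereal (\<bar>surface_estimate X K - surface_area K\<bar> / surface_area K))
             \<le> ereal (C / real t))"
proof (intro conjI allI impI ballI exI[of _ "960 / c1 CARD('n)"] SUP_least)
  fix \<sigma> :: "(real^'n) measure" and t X and K :: "(real^'n) set"
  assume *: "uniform_sphere_measure \<sigma>" "spherical_design \<sigma> t X" "K \<in> convex_bodies"
  show error: "\<bar>surface_estimate X K - surface_area K\<bar> / surface_area K \<le> 2 * abs_approx_error t / c1 CARD('n)"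
    by (rule relative_error_surface_estimate[OF assms *])
  assume "t \<ge> 1"
  \<comment> \<open>The factor 2 and the constant 480 give 960; the dependence on the dimension is
    in \<open>c1\<close> alone.\<close>
  have "2 * abs_approx_error t / c1 CARD('n) \<le> 2 * (480 / real t) / c1 CARD('n)"
    using abs_approx_error_bigo[OF \<open>t \<ge> 1\<close>] c1_pos[of "CARD('n)"] by (intro divide_right_mono) auto
  also have "\<dots> = 960 / c1 CARD('n) / real t" by simp
  finally show "ereal (\<bar>surface_estimate X K - surface_area K\<bar> / surface_area K) \<le> ereal (960 / c1 CARD('n) / real t)"
    using error by simp
qed

end
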